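(* Let $n\le3$ and let $f\in\mathbb C[[x_1,\dots,x_n]]$ be a free formal power series which is not a product. Then for every $d\ge1$ the complex Lie algebra $\mathfrak D_d=\mathrm{Der}_f/\widehat{\mathfrak m}^d\cdot\mathrm{Der}_f$ is solvable.
   Context: $\widehat{\mathcal O}=\mathbb C[[x_1,\dots,x_n]]$ with maximal ideal $\widehat{\mathfrak m}$; $\mathrm{Der}=\mathrm{Der}_{\mathbb C}\widehat{\mathcal O}$ is the free $\widehat{\mathcal O}$-module of formal vector fields with basis the partial derivatives $\partial_1,\dots,\partial_n$, with its Lie bracket. For $0\neq f\in\widehat{\mathcal O}$, $\mathrm{Der}_f=\{\delta\in\mathrm{Der}\mid\delta(f)\in\widehat{\mathcal O}\cdot f\}$; it is closed under the Lie bracket. $f$ is called a product if $\mathrm{Der}_f\not\subseteq\widehat{\mathfrak m}\cdot\mathrm{Der}$. If $f$ is not a product, $\widehat{\mathfrak m}^d\cdot\mathrm{Der}_f$ is a Lie ideal of $\mathrm{Der}_f$ and $\mathfrak D_d$ carries the induced Lie bracket. $f$ is called free if $f$ is nonzero and reduced and there are $\delta_1,\dots,\delta_n\in\mathrm{Der}_f$ with $\det\bigl(\delta_i(x_j)\bigr)_{i,j}\in\widehat{\mathcal O}^*\cdot f$. A Lie algebra $\mathfrak D$ is solvable if its derived series $\mathfrak D^{(0)}=\mathfrak D$, $\mathfrak D^{(i+1)}=[\mathfrak D^{(i)},\mathfrak D^{(i)}]$ vanishes for $i\gg0$. *)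

theory Defs
  imports
    "HOL-Analysis.Determinants"
    "HOL-Algebra.QuotRing"
    "HOL-Algebra.Algebraic_Closure_Type"
    "HOL-Library.Function_Algebras"
begin

section \<open>Formal power series in finitely many variables\<close>

text \<open>
  A series in variables indexed by the finite type \<open>'n\<close> is its family of coefficients; an
  exponent is a function \<open>'n \<Rightarrow> nat\<close>, and exponents are added pointwise.
\<close>

typedef ('a, 'n) mfps = "UNIV :: (('n \<Rightarrow> nat) \<Rightarrow> 'a) set"
  morphisms mfps_nth Abs_mfps ..

lemma mfps_eqI: "(\<And>m. mfps_nth f m = mfps_nth g m) \<Longrightarrow> f = g"
  by (metis mfps_nth_inject ext)

lemma mfps_nth_Abs [simp]: "mfps_nth (Abs_mfps c) = c"
  by (simp add: Abs_mfps_inverse)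

lemma finite_exponent_splits:
  fixes m :: "'n::finite \<Rightarrow> nat"
  shows "finite {(k, l). k + l = m}"
proof (rule finite_subset)
  have "finite (Pi\<^sub>E (UNIV :: 'n set) (\<lambda>i. {0..m i}))"
    by (intro finite_PiE) auto
  then show "finite (Pi\<^sub>E (UNIV :: 'n set) (\<lambda>i. {0..m i}) \<times> Pi\<^sub>E (UNIV :: 'n set) (\<lambda>i. {0..m i}))"
    by (rule finite_cartesian_product) fact
  show "{(k, l). k + l = m}
      \<subseteq> Pi\<^sub>E (UNIV :: 'n set) (\<lambda>i. {0..m i}) \<times> Pi\<^sub>E (UNIV :: 'n set) (\<lambda>i. {0..m i})"
    by (auto simp: PiE_def extensional_def)
qed

instantiation mfps :: (comm_ring_1, finite) comm_ring_1
begin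

definition zero_mfps :: "('a, 'b) mfps" where
  "0 = Abs_mfps (\<lambda>_. 0)"

definition one_mfps :: "('a, 'b) mfps" where
  "1 = Abs_mfps (\<lambda>m. if m = 0 then 1 else 0)"

definition plus_mfps :: "('a, 'b) mfps \<Rightarrow> ('a, 'b) mfps \<Rightarrow> ('a, 'b) mfps" where
  "f + g = Abs_mfps (\<lambda>m. mfps_nth f m + mfps_nth g m)"

definition minus_mfps :: "('a, 'b) mfps \<Rightarrow> ('a, 'b) mfps \<Rightarrow> ('a, 'b) mfps" where
  "f - g = Abs_mfps (\<lambda>m. mfps_nth f m - mfps_nth g m)"

definition uminus_mfps :: "('a, 'b) mfps \<Rightarrow> ('a, 'b) mfps" where
  "- f = Abs_mfps (\<lambda>m. - mfps_nth f m)"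

definition times_mfps :: "('a, 'b) mfps \<Rightarrow> ('a, 'b) mfps \<Rightarrow> ('a, 'b) mfps" where
  "f * g = Abs_mfps (\<lambda>m. \<Sum>(k, l) | k + l = m. mfps_nth f k * mfps_nth g l)"

lemma mfps_nth_mult:
  "mfps_nth (f * g) m = (\<Sum>(k, l) | k + l = m. mfps_nth f k * mfps_nth g l)"
  for f g :: "('a, 'b) mfps"
  by (simp add: times_mfps_def)

instance
proof
  fix f g h :: "('a, 'b) mfps"
  show "f * g * h = f * (g * h)"
  proof (rule mfps_eqI)
    fix m
    let ?t = "\<lambda>k l p. mfps_nth f k * mfps_nth g l * mfps_nth h p"
    have "mfps_nth (f * g * h) m
        = (\<Sum>q\<in>{(k, l). k + l = m}. \<Sum>r\<in>{(k, l). k + l = fst q}. ?t (fst r) (snd r) (snd q))"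
      by (simp add: mfps_nth_mult sum_distrib_right case_prod_unfold)
    also have "\<dots> = (\<Sum>(q, r)\<in>Sigma {(k, l). k + l = m} (\<lambda>q. {(k, l). k + l = fst q}).
        ?t (fst r) (snd r) (snd q))"
      by (rule sum.Sigma) (auto intro: finite_exponent_splits)
    also have "\<dots> = (\<Sum>(q, r)\<in>Sigma {(k, l). k + l = m} (\<lambda>q. {(k, l). k + l = snd q}).
        ?t (fst q) (fst r) (snd r))"
      by (rule sum.reindex_bij_witness
          [where i = "\<lambda>(q, r). ((fst q + fst r, snd r), (fst q, fst r))"
             and j = "\<lambda>(q, r). ((fst r, snd r + snd q), (snd r, snd q))"])
        (auto simp: add.assoc)
    also have "\<dots>
        = (\<Sum>q\<in>{(k, l). k + l = m}. \<Sum>r\<in>{(k, l). k + l = snd q}. ?t (fst q) (fst r) (snd r))"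
      by (rule sum.Sigma [symmetric]) (auto intro: finite_exponent_splits)
    also have "\<dots> = mfps_nth (f * (g * h)) m"
      by (simp add: mfps_nth_mult sum_distrib_left case_prod_unfold mult.assoc)
    finally show "mfps_nth (f * g * h) m = mfps_nth (f * (g * h)) m" .
  qed
  show "f * g = g * f"
  proof (rule mfps_eqI)
    fix m
    show "mfps_nth (f * g) m = mfps_nth (g * f) m"
      unfolding mfps_nth_mult
      by (rule sum.reindex_bij_witness [where i = prod.swap and j = prod.swap])
        (auto simp: add.commute mult.commute)
  qed
  show "1 * f = f"
  proof (rule mfps_eqI)
    fix m :: "'b \<Rightarrow> nat"
    have "mfps_nth (1 * f) m
        = (\<Sum>q\<in>{(k, l). k + l = m}. if q = (0, m) then mfps_nth f m else 0)"
      unfolding mfps_nth_mult by (rule sum.cong) (auto simp: one_mfps_def split: if_splits)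
    also have "\<dots> = mfps_nth f m"
      by (simp add: finite_exponent_splits)
    finally show "mfps_nth (1 * f) m = mfps_nth f m" .
  qed
  show "(f + g) * h = f * h + g * h"
    by (rule mfps_eqI)
      (simp add: mfps_nth_mult plus_mfps_def case_prod_unfold distrib_right sum.distrib)
  show "(0 :: ('a, 'b) mfps) \<noteq> 1"
  proof
    assume "(0 :: ('a, 'b) mfps) = 1"
    then have "mfps_nth (0 :: ('a, 'b) mfps) 0 = mfps_nth 1 0" by simp
    then show False by (simp add: zero_mfps_def one_mfps_def)
  qed
qed (auto intro!: mfps_eqI
      simp: plus_mfps_def zero_mfps_def minus_mfps_def uminus_mfps_def algebra_simps)

end

definition mfps_const :: "'a::comm_ring_1 \<Rightarrow> ('a, 'n::finite) mfps" where
  "mfps_const c = Abs_mfps (\<lambda>m. if m = 0 then c else 0)"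

definition mfps_X :: "'n \<Rightarrow> ('a::comm_ring_1, 'n::finite) mfps" where
  "mfps_X j = Abs_mfps (\<lambda>m. if m = (\<lambda>i. if i = j then 1 else 0) then 1 else 0)"

definition mfps_max_ideal :: "('a::field, 'n::finite) mfps set" where
  "mfps_max_ideal = {f. mfps_nth f 0 = 0}"

text \<open>The submodule \<open>I \<cdot> S\<close> generated by all \<open>a s\<close>; for \<open>act = (*)\<close> it is the product of ideals.\<close>

definition ideal_smult ::
  "('r::comm_ring_1 \<Rightarrow> 'v::ab_group_add \<Rightarrow> 'v) \<Rightarrow> 'r set \<Rightarrow> 'v set \<Rightarrow> 'v set" where
  "ideal_smult act I S = Modules.module.span act {act a s | a s. a \<in> I \<and> s \<in> S}"

primrec mfps_max_ideal_power :: "nat \<Rightarrow> ('a::field, 'n::finite) mfps set" where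
  "mfps_max_ideal_power 0 = UNIV"
| "mfps_max_ideal_power (Suc d) = ideal_smult (*) mfps_max_ideal (mfps_max_ideal_power d)"

text \<open>The quotient ring by the principal ideal of \<open>f\<close> has no nonzero nilpotent elements.\<close>

definition mfps_reduced :: "('a::comm_ring_1, 'n::finite) mfps \<Rightarrow> bool" where
  "mfps_reduced f \<longleftrightarrow> (\<forall>g k. f dvd g ^ k \<longrightarrow> f dvd g)"


section \<open>Formal and logarithmic vector fields\<close>

type_synonym 'n vfield = "(complex, 'n) mfps \<Rightarrow> (complex, 'n) mfps"

definition Der :: "'n::finite vfield set" where
  "Der = {\<delta>. (\<forall>g h. \<delta> (g + h) = \<delta> g + \<delta> h) \<and>
             (\<forall>c g. \<delta> (mfps_const c * g) = mfps_const c * \<delta> g) \<and>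
             (\<forall>g h. \<delta> (g * h) = \<delta> g * h + g * \<delta> h)}"

definition vfield_scale :: "(complex, 'n::finite) mfps \<Rightarrow> 'n vfield \<Rightarrow> 'n vfield" where
  "vfield_scale a \<delta> = (\<lambda>g. a * \<delta> g)"

definition vfield_bracket :: "'n::finite vfield \<Rightarrow> 'n vfield \<Rightarrow> 'n vfield" where
  "vfield_bracket \<delta> \<epsilon> = (\<lambda>g. \<delta> (\<epsilon> g) - \<epsilon> (\<delta> g))"

definition Der_log :: "(complex, 'n::finite) mfps \<Rightarrow> 'n vfield set" where
  "Der_log f = {\<delta> \<in> Der. f dvd \<delta> f}"

definition is_product :: "(complex, 'n::finite) mfps \<Rightarrow> bool" where
  "is_product f \<longleftrightarrow> \<not> Der_log f \<subseteq> ideal_smult vfield_scale mfps_max_ideal Der"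

definition is_free :: "(complex, 'n::finite) mfps \<Rightarrow> bool" where
  "is_free f \<longleftrightarrow> f \<noteq> 0 \<and> mfps_reduced f \<and>
     (\<exists>\<delta> :: 'n \<Rightarrow> 'n vfield. (\<forall>i. \<delta> i \<in> Der_log f) \<and>
        (\<exists>u. u dvd 1 \<and> det (\<chi> i j. \<delta> i (mfps_X j)) = u * f))"


section \<open>Complex Lie algebras\<close>

text \<open>
  A Lie algebra is a record of type \<^typ>\<open>(complex, 'l) module\<close> whose multiplication is the Lie
  bracket; the field \<open>one\<close> carries no meaning and is never referred to.
\<close>

locale complex_lie_algebra =
  Module.module "ring_of_type_algebra :: complex ring" L for L (structure) +
  assumes bracket_closed:
      "\<lbrakk>x \<in> carrier L; y \<in> carrier L\<rbrakk> \<Longrightarrow> x \<otimes> y \<in> carrier L"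
    and bracket_add_left:
      "\<lbrakk>x \<in> carrier L; y \<in> carrier L; z \<in> carrier L\<rbrakk>
        \<Longrightarrow> (x \<oplus> y) \<otimes> z = x \<otimes> z \<oplus> y \<otimes> z"
    and bracket_add_right:
      "\<lbrakk>x \<in> carrier L; y \<in> carrier L; z \<in> carrier L\<rbrakk>
        \<Longrightarrow> x \<otimes> (y \<oplus> z) = x \<otimes> y \<oplus> x \<otimes> z"
    and bracket_smult_left:
      "\<lbrakk>x \<in> carrier L; y \<in> carrier L\<rbrakk> \<Longrightarrow> (c \<odot> x) \<otimes> y = c \<odot> (x \<otimes> y)"
    and bracket_smult_right:
      "\<lbrakk>x \<in> carrier L; y \<in> carrier L\<rbrakk> \<Longrightarrow> x \<otimes> (c \<odot> y) = c \<odot> (x \<otimes> y)"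
    and bracket_self: "x \<in> carrier L \<Longrightarrow> x \<otimes> x = \<zero>"
    and jacobi:
      "\<lbrakk>x \<in> carrier L; y \<in> carrier L; z \<in> carrier L\<rbrakk>
        \<Longrightarrow> x \<otimes> (y \<otimes> z) \<oplus> y \<otimes> (z \<otimes> x) \<oplus> z \<otimes> (x \<otimes> y) = \<zero>"

definition lie_bracket_space :: "(complex, 'l, 'm) module_scheme \<Rightarrow> 'l set \<Rightarrow> 'l set \<Rightarrow> 'l set" where
  "lie_bracket_space L A B =
     \<Inter> {H. submodule H (ring_of_type_algebra :: complex ring) L \<and>
           {a \<otimes>\<^bsub>L\<^esub> b | a b. a \<in> A \<and> b \<in> B} \<subseteq> H}"

primrec derived_series :: "(complex, 'l, 'm) module_scheme \<Rightarrow> nat \<Rightarrow> 'l set" where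
  "derived_series L 0 = carrier L"
| "derived_series L (Suc i) = lie_bracket_space L (derived_series L i) (derived_series L i)"

locale solvable_lie_algebra = complex_lie_algebra +
  assumes derived_series_vanishes: "\<exists>k. \<forall>i\<ge>k. derived_series L i = {\<zero>}"

text \<open>The analogue of \<^const>\<open>FactRing\<close>; all operations on cosets are induced by representatives.\<close>

definition lie_quotient :: "(complex, 'l) module \<Rightarrow> 'l set \<Rightarrow> (complex, 'l set) module" where
  "lie_quotient L I =
     \<lparr>carrier = a_rcosets\<^bsub>L\<^esub> I, mult = rcoset_mult L I, one = undefined, zero = I,
      add = set_add L, module.smult = (\<lambda>c A. \<Union>x\<in>A. I +>\<^bsub>L\<^esub> (c \<odot>\<^bsub>L\<^esub> x))\<rparr>"

definition Der_log_lie :: "(complex, 'n::finite) mfps \<Rightarrow> (complex, 'n vfield) module" where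
  "Der_log_lie f =
     \<lparr>carrier = Der_log f, mult = vfield_bracket, one = undefined, zero = 0,
      add = (+), module.smult = (\<lambda>c. vfield_scale (mfps_const c))\<rparr>"

definition Der_log_quotient ::
  "(complex, 'n::finite) mfps \<Rightarrow> nat \<Rightarrow> (complex, 'n vfield set) module" where
  "Der_log_quotient f d =
     lie_quotient (Der_log_lie f)
       (ideal_smult vfield_scale (mfps_max_ideal_power d) (Der_log f))"

end

theory Submission
  imports Defs "HOL-Computational_Algebra.Fundamental_Theorem_Algebra"
begin

text \<open>
  Let \<open>D\<close> be the module of logarithmic vector fields of \<open>f\<close> and \<open>m\<close> the maximal ideal. As \<open>f\<close> is not a
  product, the fields in \<open>D\<close> vanish at the origin, so they map every power of \<open>m\<close> into itself. Hence
  \<open>[m D, m^j D] \<subseteq> m^(j+1) D\<close>, the image of \<open>m D\<close> in \<open>D / m^d D\<close> is nilpotent, and solvability is a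
  question about the Lie algebra \<open>D / m D\<close>. By Saito's criterion the fields that witness freeness
  generate \<open>D\<close> (\<open>Der_log_generators\<close>), so \<open>D / m D\<close> has dimension at most 3. If its brackets do not
  span a space of dimension 3, they span at most a plane, whose own brackets span at most a line, and
  the algebra is solvable (\<open>brackets_two_dimensional\<close>, \<open>derived_chain\<close>). Otherwise \<open>D / m D\<close> is a perfect
  Lie algebra of dimension 3, that is \<open>sl(2)\<close> (\<open>sl2_triple_if_independent_brackets\<close>).

  The case \<open>sl(2)\<close> is impossible (\<open>free_no_sl2_triple\<close>). Write \<open>\<delta> f = a_\<delta> f\<close> for \<open>\<delta> \<in> D\<close>. After
  multiplication of \<open>f\<close> by a suitable unit, all cofactors \<open>a_\<delta>\<close> have order at least \<open>N\<close>, for any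
  prescribed \<open>N\<close> (\<open>semi_invariant_of_order\<close>). For \<open>N = 1\<close> this holds because \<open>\<delta> \<mapsto> a_\<delta>(0)\<close> is a character
  of a perfect Lie algebra. To pass from \<open>N\<close> to \<open>N + 1\<close>, let \<open>sl(2)\<close> act on the sums \<open>c + w\<close> of a constant
  and a form of degree \<open>N\<close>, where \<open>\<delta>\<close> maps \<open>v\<close> to the part of degree \<open>N\<close> of \<open>\<delta> v + a_\<delta> v\<close>. The image
  consists of forms of degree \<open>N\<close>, and since \<open>sl(2)\<close> has no nontrivial extensions of a trivial module,
  some invariant vector has a nonzero constant term; it is the factor that is wanted.
  Now let \<open>g\<close> be a unit multiple of \<open>f\<close> with cofactors of order at least \<open>N\<close>. The matrix \<open>\<delta>_i(x_j)\<close> maps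
  the gradient of \<open>g\<close> to \<open>g\<close> times a vector of order at least \<open>N\<close>, and its determinant is a unit times
  \<open>g\<close>, so by Cramer's rule the gradient of \<open>g\<close> has order at least \<open>N\<close>. Thus \<open>f\<close> has order greater than
  \<open>N\<close> for every \<open>N\<close>, which contradicts \<open>f \<noteq> 0\<close>.

  Saito's criterion is usually proved by factoring \<open>f\<close> into primes. Here the only structural fact about
  the ring is that a nonzero ideal stable under all partial derivatives contains a unit
  (\<open>differential_ideal_contains_unit\<close>); it also shows that the ring is an integral domain.
\<close>

(* From here on the dollar sign selects a component of a vector. *)
no_notation fps_nth (infixl "$" 75)

section \<open>Order, units and partial derivatives of formal power series\<close>

definition mfps_order_ge :: "nat \<Rightarrow> ('a::comm_ring_1, 'n::finite) mfps set" where
  "mfps_order_ge N = {g. \<forall>m. (\<Sum>i\<in>UNIV. m i) < N \<longrightarrow> mfps_nth g m = 0}"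

definition mfps_deriv :: "'n::finite \<Rightarrow> ('a::comm_ring_1, 'n) mfps \<Rightarrow> ('a, 'n) mfps" where
  "mfps_deriv j g = Abs_mfps (\<lambda>m. of_nat (Suc (m j)) * mfps_nth g (m(j := Suc (m j))))"

lemma mfps_nth_add [simp]: "mfps_nth (f + g) m = mfps_nth f m + mfps_nth g m"
  and mfps_nth_diff [simp]: "mfps_nth (f - g) m = mfps_nth f m - mfps_nth g m"
  and mfps_nth_uminus [simp]: "mfps_nth (- f) m = - mfps_nth f m"
  and mfps_nth_zero [simp]: "mfps_nth (0 :: ('a::comm_ring_1, 'n::finite) mfps) m = 0"
  and mfps_nth_one: "mfps_nth (1 :: ('a, 'n) mfps) m = (if m = 0 then 1 else 0)"
  for f g :: "('a::comm_ring_1, 'n::finite) mfps"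
  by (simp_all add: plus_mfps_def minus_mfps_def uminus_mfps_def zero_mfps_def one_mfps_def)

lemma mfps_nth_sum [simp]: "mfps_nth (sum f A) m = (\<Sum>x\<in>A. mfps_nth (f x) m)"
  for f :: "'b \<Rightarrow> ('a::comm_ring_1, 'n::finite) mfps"
  by (induction A rule: infinite_finite_induct) auto

lemma mfps_nth_const: "mfps_nth (mfps_const c :: ('a::comm_ring_1, 'n::finite) mfps) m = (if m = 0 then c else 0)"
  by (simp add: mfps_const_def)

lemma mfps_nth_const_mult [simp]: "mfps_nth (mfps_const c * g) m = c * mfps_nth g m"
  for g :: "('a::comm_ring_1, 'n::finite) mfps"
proof -
  have "mfps_nth (mfps_const c * g) m
      = (\<Sum>q\<in>{(k, l). k + l = m}. if q = (0, m) then c * mfps_nth g m else 0)"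
    unfolding mfps_nth_mult by (rule sum.cong) (auto simp: mfps_const_def split: if_splits)
  also have "\<dots> = c * mfps_nth g m"
    by (simp add: finite_exponent_splits)
  finally show ?thesis .
qed

lemma mfps_const_0 [simp]: "mfps_const 0 = (0 :: ('a::comm_ring_1, 'n::finite) mfps)"
  and mfps_const_1 [simp]: "mfps_const 1 = (1 :: ('a, 'n) mfps)"
  and mfps_const_add: "mfps_const (a + b) = (mfps_const a + mfps_const b :: ('a, 'n) mfps)"
  and mfps_const_diff: "mfps_const (a - b) = (mfps_const a - mfps_const b :: ('a, 'n) mfps)"
  and mfps_const_uminus: "mfps_const (- a) = (- mfps_const a :: ('a, 'n) mfps)"
  and mfps_const_mult: "mfps_const (a * b) = (mfps_const a * mfps_const b :: ('a, 'n) mfps)"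
  by (rule mfps_eqI, simp add: mfps_nth_const mfps_nth_one)+

lemma mfps_nth_mult_0: "mfps_nth (f * g) 0 = mfps_nth f 0 * mfps_nth g 0"
  for f g :: "('a::comm_ring_1, 'n::finite) mfps"
proof -
  have "{(k, l). k + l = (0 :: 'n \<Rightarrow> nat)} = {(0, 0)}"
    by (auto simp: fun_eq_iff)
  then show ?thesis
    by (simp add: mfps_nth_mult)
qed

lemma order_geD: "g \<in> mfps_order_ge N \<Longrightarrow> (\<Sum>i\<in>UNIV. m i) < N \<Longrightarrow> mfps_nth g m = 0"
  by (simp add: mfps_order_ge_def)

lemma order_ge_0 [simp]: "mfps_order_ge 0 = UNIV"
  by (simp add: mfps_order_ge_def)

lemma order_ge_zero [simp]: "0 \<in> mfps_order_ge N"
  by (simp add: mfps_order_ge_def)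

lemma order_ge_add: "f \<in> mfps_order_ge N \<Longrightarrow> g \<in> mfps_order_ge N \<Longrightarrow> f + g \<in> mfps_order_ge N"
  and order_ge_diff: "f \<in> mfps_order_ge N \<Longrightarrow> g \<in> mfps_order_ge N \<Longrightarrow> f - g \<in> mfps_order_ge N"
  by (simp_all add: mfps_order_ge_def)

lemma order_ge_sum: "(\<And>x. x \<in> A \<Longrightarrow> f x \<in> mfps_order_ge N) \<Longrightarrow> sum f A \<in> mfps_order_ge N"
  by (induction A rule: infinite_finite_induct) (auto intro: order_ge_add)

lemma order_ge_mono: "M \<le> N \<Longrightarrow> mfps_order_ge N \<subseteq> mfps_order_ge M"
  by (auto simp: mfps_order_ge_def)

lemma order_ge_mult:
  assumes "f \<in> mfps_order_ge M" and "g \<in> mfps_order_ge N"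
  shows "f * g \<in> mfps_order_ge (M + N)"
proof -
  have "mfps_nth (f * g) m = 0" if m: "(\<Sum>i\<in>UNIV. m i) < M + N" for m
    unfolding mfps_nth_mult
  proof (rule sum.neutral, safe)
    fix k l :: "'b \<Rightarrow> nat"
    assume kl: "m = k + l"
    with m have "(\<Sum>i\<in>UNIV. k i) < M \<or> (\<Sum>i\<in>UNIV. l i) < N"
      by (auto simp: sum.distrib)
    then show "mfps_nth f k * mfps_nth g l = 0"
      using assms by (auto dest: order_geD)
  qed
  then show ?thesis
    by (simp add: mfps_order_ge_def)
qed

lemma order_ge_mult_right: "g \<in> mfps_order_ge N \<Longrightarrow> f * g \<in> mfps_order_ge N"
  using order_ge_mult[of f 0 g N] by simp

lemma order_ge_mult_left: "f \<in> mfps_order_ge N \<Longrightarrow> f * g \<in> mfps_order_ge N"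
  using order_ge_mult[of f N g 0] by simp

lemma order_ge_power: "f \<in> mfps_order_ge 1 \<Longrightarrow> f ^ k \<in> mfps_order_ge k"
  using order_ge_mult[of f 1] by (induction k) auto

lemma zero_if_all_orders: "(\<And>N. g \<in> mfps_order_ge N) \<Longrightarrow> g = 0"
  by (rule mfps_eqI) (metis lessI mfps_nth_zero order_geD)

lemma order_ge_1_iff: "g \<in> mfps_order_ge 1 \<longleftrightarrow> mfps_nth g 0 = 0"
proof
  show "mfps_nth g 0 = 0" if "g \<in> mfps_order_ge 1"
    using that by (rule order_geD) simp
next
  assume "mfps_nth g 0 = 0"
  moreover have "m = 0" if "(\<Sum>i\<in>UNIV. m i) < 1" for m :: "'b \<Rightarrow> nat"
    using that by (simp add: fun_eq_iff)
  ultimately show "g \<in> mfps_order_ge 1"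
    by (auto simp: mfps_order_ge_def)
qed

lemma order_ge_1_eq_max_ideal: "mfps_order_ge 1 = mfps_max_ideal"
  by (auto simp: order_ge_1_iff mfps_max_ideal_def simp del: One_nat_def)

text \<open>
  The inverse of \<open>1 - y\<close>, with \<open>y\<close> of order at least 1, is the geometric series. A coefficient of
  degree \<open>k\<close> only sees the powers \<open>y ^ i\<close> with \<open>i \<le> k\<close>, so that series is defined coefficientwise.
\<close>

lemma mfps_unit_iff: "g dvd 1 \<longleftrightarrow> mfps_nth g 0 \<noteq> 0"
  for g :: "('a::field, 'n::finite) mfps"
proof
  assume "g dvd 1"
  then obtain h where "g * h = 1" by (metis dvdE)
  then have "mfps_nth g 0 * mfps_nth h 0 = 1"
    by (metis mfps_nth_mult_0 mfps_nth_one)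
  then show "mfps_nth g 0 \<noteq> 0" by auto
next
  assume g0: "mfps_nth g 0 \<noteq> 0"
  define c where "c = inverse (mfps_nth g 0)"
  define y where "y = 1 - mfps_const c * g"
  have y: "y \<in> mfps_order_ge 1"
    using g0 by (simp add: order_ge_1_iff y_def c_def mfps_nth_one del: One_nat_def)
  define s where "s = Abs_mfps (\<lambda>m. mfps_nth (\<Sum>i\<le>(\<Sum>i\<in>UNIV. m i). y ^ i) m)"
  have s: "s - (\<Sum>i\<le>N. y ^ i) \<in> mfps_order_ge (Suc N)" for N
  proof -
    have "mfps_nth s m = mfps_nth (\<Sum>i\<le>N. y ^ i) m" if "(\<Sum>i\<in>UNIV. m i) < Suc N" for m
    proof -
      have "mfps_nth s m = (\<Sum>i\<le>(\<Sum>i\<in>UNIV. m i). mfps_nth (y ^ i) m)"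
        by (simp add: s_def)
      also have "\<dots> = (\<Sum>i\<le>N. mfps_nth (y ^ i) m)"
        using that by (intro sum.mono_neutral_left) (auto simp: not_le dest: order_geD[OF order_ge_power[OF y]] intro: leI)
      finally show ?thesis by simp
    qed
    then show ?thesis by (auto simp: mfps_order_ge_def)
  qed
  have "(1 - y) * s - 1 \<in> mfps_order_ge N" for N
  proof -
    have "(1 - y) * s - 1 = (1 - y) * (s - (\<Sum>i\<le>N. y ^ i)) - y ^ Suc N"
      using one_diff_power_eq[of y "Suc N"] by (simp add: lessThan_Suc_atMost algebra_simps)
    also have "\<dots> \<in> mfps_order_ge (Suc N)"
      by (intro order_ge_diff order_ge_mult_right s order_ge_power y)
    finally show ?thesis
      using order_ge_mono[of N "Suc N"] by auto
  qed
  then have "(1 - y) * s = 1"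
    using zero_if_all_orders by (metis eq_iff_diff_eq_0)
  then have "g * (mfps_const c * s) = 1"
    by (simp add: y_def mult_ac)
  then show "g dvd 1" by (metis dvd_triv_left)
qed

lemma mfps_nth_deriv:
  "mfps_nth (mfps_deriv j g) m = of_nat (Suc (m j)) * mfps_nth g (m(j := Suc (m j)))"
  by (simp add: mfps_deriv_def)

lemma mfps_deriv_add: "mfps_deriv j (f + g) = mfps_deriv j f + mfps_deriv j g"
  for f g :: "('a::comm_ring_1, 'n::finite) mfps"
  by (rule mfps_eqI) (simp add: mfps_nth_deriv algebra_simps)

lemma mfps_deriv_const_mult: "mfps_deriv j (mfps_const c * g) = mfps_const c * mfps_deriv j g"
  for g :: "('a::comm_ring_1, 'n::finite) mfps"
  by (rule mfps_eqI) (simp add: mfps_nth_deriv mult.left_commute del: of_nat_Suc)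

lemma mfps_deriv_mult:
  fixes f g :: "('a::comm_ring_1, 'n::finite) mfps"
  shows "mfps_deriv j (f * g) = mfps_deriv j f * g + f * mfps_deriv j g"
proof (rule mfps_eqI)
  fix m :: "'n \<Rightarrow> nat"
  let ?up = "\<lambda>k :: 'n \<Rightarrow> nat. k(j := Suc (k j))"
  let ?dn = "\<lambda>k :: 'n \<Rightarrow> nat. k(j := k j - 1)"
  let ?A = "{(k, l). k + l = ?up m}" and ?B = "{(k, l). k + l = m}"
  have fA: "finite ?A" by (rule finite_exponent_splits)
  have L: "(\<Sum>(k, l)\<in>?A. of_nat (k j) * (mfps_nth f k * mfps_nth g l)) = mfps_nth (mfps_deriv j f * g) m"
  proof -
    have "(\<Sum>(k, l)\<in>?A. of_nat (k j) * (mfps_nth f k * mfps_nth g l))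
        = (\<Sum>(k, l)\<in>{(k, l) \<in> ?A. k j > 0}. of_nat (k j) * (mfps_nth f k * mfps_nth g l))"
      by (rule sum.mono_neutral_right[OF fA]) (auto intro: gr0I)
    also have "\<dots> = (\<Sum>(k, l)\<in>?B. mfps_nth (mfps_deriv j f) k * mfps_nth g l)"
      by (rule sum.reindex_bij_witness[where i = "\<lambda>(k, l). (?up k, l)" and j = "\<lambda>(k, l). (?dn k, l)"])
        (auto simp: mfps_nth_deriv fun_eq_iff mult.assoc split: if_splits)
    finally show ?thesis by (simp add: mfps_nth_mult)
  qed
  have R: "(\<Sum>(k, l)\<in>?A. of_nat (l j) * (mfps_nth f k * mfps_nth g l)) = mfps_nth (f * mfps_deriv j g) m"
  proof -
    have "(\<Sum>(k, l)\<in>?A. of_nat (l j) * (mfps_nth f k * mfps_nth g l))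
        = (\<Sum>(k, l)\<in>{(k, l) \<in> ?A. l j > 0}. of_nat (l j) * (mfps_nth f k * mfps_nth g l))"
      by (rule sum.mono_neutral_right[OF fA]) (auto intro: gr0I)
    also have "\<dots> = (\<Sum>(k, l)\<in>?B. mfps_nth f k * mfps_nth (mfps_deriv j g) l)"
      by (rule sum.reindex_bij_witness[where i = "\<lambda>(k, l). (k, ?up l)" and j = "\<lambda>(k, l). (k, ?dn l)"])
        (auto simp: mfps_nth_deriv fun_eq_iff mult_ac split: if_splits)
    finally show ?thesis by (simp add: mfps_nth_mult)
  qed
  have "mfps_nth (mfps_deriv j (f * g)) m
      = (\<Sum>(k, l)\<in>?A. of_nat (Suc (m j)) * (mfps_nth f k * mfps_nth g l))"
    by (simp add: mfps_nth_deriv mfps_nth_mult sum_distrib_left case_prod_unfold)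
  also have "\<dots> = (\<Sum>(k, l)\<in>?A. of_nat (k j) * (mfps_nth f k * mfps_nth g l)
      + of_nat (l j) * (mfps_nth f k * mfps_nth g l))"
  proof (rule sum.cong[OF refl], clarify)
    fix k l :: "'n \<Rightarrow> nat"
    assume "k + l = ?up m"
    then have "Suc (m j) = k j + l j" by (metis fun_upd_same plus_fun_apply)
    then show "of_nat (Suc (m j)) * (mfps_nth f k * mfps_nth g l)
        = of_nat (k j) * (mfps_nth f k * mfps_nth g l) + of_nat (l j) * (mfps_nth f k * mfps_nth g l)"
      by (simp only: of_nat_add distrib_right)
  qed
  also have "\<dots> = mfps_nth (mfps_deriv j f * g + f * mfps_deriv j g) m"
    using L R by (simp add: sum.distrib case_prod_unfold)
  finally show "mfps_nth (mfps_deriv j (f * g)) m = mfps_nth (mfps_deriv j f * g + f * mfps_deriv j g) m" .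
qed

lemma mfps_deriv_X: "mfps_deriv j (mfps_X i :: ('a::comm_ring_1, 'n::finite) mfps) = (if i = j then 1 else 0)"
  by (rule mfps_eqI) (auto simp: mfps_nth_deriv mfps_X_def mfps_nth_one fun_eq_iff)

lemma order_ge_deriv:
  assumes "g \<in> mfps_order_ge (Suc N)"
  shows "mfps_deriv j g \<in> mfps_order_ge N"
proof -
  have "(\<Sum>i\<in>UNIV. (m(j := Suc (m j))) i) = Suc (\<Sum>i\<in>UNIV. m i)" for m :: "'b \<Rightarrow> nat"
    by (subst (1 2) sum.remove[of UNIV j]) auto
  then show ?thesis
    using assms by (auto simp: mfps_order_ge_def mfps_nth_deriv)
qed

section \<open>Ideals stable under the partial derivatives\<close>

text \<open>
  Taylor's formula: if the coefficient of \<open>x^m\<close> in \<open>g\<close> is nonzero, the iterated derivative of \<open>g\<close> of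
  multidegree \<open>m\<close> has a nonzero constant term, because \<open>m!\<close> is invertible in characteristic 0.
\<close>

lemma differential_ideal_contains_unit:
  fixes I :: "('a::field_char_0, 'n::finite) mfps set"
  assumes deriv: "\<And>j g. g \<in> I \<Longrightarrow> mfps_deriv j g \<in> I" and "g \<in> I" and "g \<noteq> 0"
  shows "\<exists>u\<in>I. u dvd 1"
proof -
  have "\<exists>u\<in>I. u dvd 1" if "mfps_nth g m \<noteq> 0" "g \<in> I" "(\<Sum>i\<in>UNIV. m i) = N" for N m g
    using that
  proof (induction N arbitrary: m g)
    case 0
    then have "m = 0" by (simp add: fun_eq_iff)
    with 0(1) have "g dvd 1" by (simp only: mfps_unit_iff not_False_eq_True)
    with 0(2) show ?case by blast
  next
    case (Suc N)
    then obtain j where j: "m j > 0"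
      by (metis gr0I nat.simps(3) sum.neutral)
    let ?m = "m(j := m j - 1)"
    have "mfps_nth (mfps_deriv j g) ?m = of_nat (m j) * mfps_nth g m"
      using j by (simp add: mfps_nth_deriv)
    then have "mfps_nth (mfps_deriv j g) ?m \<noteq> 0"
      using j Suc.prems(1) by simp
    moreover have "(\<Sum>i\<in>UNIV. ?m i) = N"
    proof -
      have "(\<Sum>i\<in>UNIV. ?m i) = m j - 1 + (\<Sum>i\<in>UNIV - {j}. m i)"
        by (subst sum.remove[of UNIV j]) auto
      moreover have "(\<Sum>i\<in>UNIV. m i) = m j + (\<Sum>i\<in>UNIV - {j}. m i)"
        by (rule sum.remove) auto
      ultimately show ?thesis
        using Suc.prems(3) j by linarith
    qed
    ultimately show ?case
      by (rule Suc.IH[OF _ deriv[OF Suc.prems(2)]])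
  qed
  moreover obtain m where "mfps_nth g m \<noteq> 0"
    using \<open>g \<noteq> 0\<close> by (metis mfps_eqI mfps_nth_zero)
  ultimately show ?thesis using \<open>g \<in> I\<close> by blast
qed

lemma mfps_deriv_power: "mfps_deriv j (g ^ Suc k) = of_nat (Suc k) * g ^ k * mfps_deriv j g"
  for g :: "('a::comm_ring_1, 'n::finite) mfps"
proof (induction k)
  case (Suc k)
  have "mfps_deriv j (g ^ Suc (Suc k)) = mfps_deriv j g * g ^ Suc k + g * mfps_deriv j (g ^ Suc k)"
    by (simp only: power_Suc[of g "Suc k"] mfps_deriv_mult)
  with Suc show ?case by (simp add: algebra_simps)
qed simp

text \<open>
  The annihilators of the powers of \<open>b\<close> form an ideal that is stable under differentiation: if
  \<open>g b^k = 0\<close>, differentiate \<open>g b^(k+1) = 0\<close>. If this ideal is nonzero, it contains a unit.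
\<close>

lemma zero_divisor_nilpotent:
  fixes a b :: "('a::field_char_0, 'n::finite) mfps"
  assumes "a * b = 0" and "a \<noteq> 0"
  shows "\<exists>k. b ^ k = 0"
proof -
  define I where "I = {a. \<exists>k. a * b ^ k = 0}"
  have "mfps_deriv j g \<in> I" if "g \<in> I" for j g
  proof -
    from that obtain k where k: "g * b ^ k = 0" by (auto simp: I_def)
    have "0 = mfps_deriv j (g * b ^ Suc k)"
      using k by (metis mfps_deriv_const_mult mfps_const_0 mult_zero_left mult.assoc power_Suc2)
    also have "\<dots> = mfps_deriv j g * b ^ Suc k + of_nat (Suc k) * mfps_deriv j b * (g * b ^ k)"
      by (simp only: mfps_deriv_mult mfps_deriv_power) (simp add: algebra_simps)
    finally show ?thesis using k by (auto simp: I_def intro: exI[of _ "Suc k"])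
  qed
  moreover have "a \<in> I" using assms(1) by (auto simp: I_def intro: exI[of _ 1])
  ultimately obtain u where "u \<in> I" "u dvd 1"
    using differential_ideal_contains_unit[of I a] assms(2) by auto
  then obtain k v where "u * b ^ k = 0" "u * v = 1" by (auto simp: I_def elim: dvdE)
  then have "b ^ k = v * (u * b ^ k)" by (metis mult.assoc mult.commute mult_1)
  then have "b ^ k = 0" by (metis \<open>u * b ^ k = 0\<close> mult_zero_right)
  then show ?thesis ..
qed

text \<open>
  The nilradical is stable under differentiation: if \<open>k\<close> is the nilpotency index of \<open>g\<close>, the derivative
  of \<open>g ^ k = 0\<close> shows that a derivative of \<open>g\<close> annihilates the nonzero power \<open>g ^ (k - 1)\<close>, so it is
  a zero divisor and nilpotent in turn. If it were nonzero, the nilradical would contain a unit.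
\<close>

lemma mfps_nilpotent_zero:
  fixes b :: "('a::field_char_0, 'n::finite) mfps"
  assumes "b ^ k = 0"
  shows "b = 0"
proof (rule ccontr)
  assume "b \<noteq> 0"
  define I where "I = {a :: ('a, 'n) mfps. \<exists>k. a ^ k = 0}"
  have "mfps_deriv j g \<in> I" if "g \<in> I" for j g
  proof -
    define k where "k = (LEAST k. g ^ k = 0)"
    have k: "g ^ k = 0"
      using that unfolding k_def I_def by (auto intro: LeastI)
    then obtain l where l: "k = Suc l"
      by (metis not0_implies_Suc power_0 zero_neq_one)
    have "g ^ l \<noteq> 0"
      using not_less_Least[of l "\<lambda>k. g ^ k = 0"] l by (simp add: k_def)
    have "mfps_const (of_nat (Suc l)) * (g ^ l * mfps_deriv j g) = of_nat (Suc l) * g ^ l * mfps_deriv j g"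
    proof -
      have "of_nat n = (mfps_const (of_nat n) :: ('a, 'n) mfps)" for n
        by (induction n) (auto simp: mfps_const_add)
      then show ?thesis by (simp add: mult.assoc)
    qed
    also have "\<dots> = mfps_deriv j (g ^ k)"
      by (simp only: l mfps_deriv_power)
    also have "\<dots> = 0"
      unfolding k by (rule mfps_eqI) (simp add: mfps_nth_deriv)
    finally have "mfps_const (inverse (of_nat (Suc l))) * (mfps_const (of_nat (Suc l)) * (g ^ l * mfps_deriv j g)) = 0"
      by simp
    then have "g ^ l * mfps_deriv j g = 0"
      by (simp add: mult.assoc[symmetric] mfps_const_mult[symmetric] del: of_nat_Suc)
    with \<open>g ^ l \<noteq> 0\<close> show ?thesis
      by (auto simp: I_def dest: zero_divisor_nilpotent)
  qed
  moreover have "b \<in> I" using assms by (auto simp: I_def)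
  ultimately obtain u where "u \<in> I" "u dvd 1"
    using differential_ideal_contains_unit[of I b] \<open>b \<noteq> 0\<close> by auto
  then obtain k v where "u ^ k = 0" "u * v = 1" by (auto simp: I_def elim: dvdE)
  then have "1 = u ^ k * v ^ k" by (metis power_mult_distrib power_one)
  then show False by (metis \<open>u ^ k = 0\<close> mult_zero_left zero_neq_one)
qed

instance mfps :: (field_char_0, finite) idom
proof
  fix a b :: "('a, 'b) mfps"
  assume "a \<noteq> 0" "b \<noteq> 0"
  then show "a * b \<noteq> 0"
    using zero_divisor_nilpotent mfps_nilpotent_zero by blast
qed

text \<open>
  Every monomial other than 1 is assigned to one variable that divides it; \<open>h j\<close> collects the monomials
  assigned to \<open>j\<close>.
\<close>

lemma mfps_decompose:
  fixes g :: "('a::comm_ring_1, 'n::finite) mfps"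
  shows "\<exists>h. g = mfps_const (mfps_nth g 0) + (\<Sum>j\<in>UNIV. mfps_X j * h j)"
proof -
  have nth_X: "mfps_nth (mfps_X j * h) m = (if m j > 0 then mfps_nth h (m(j := m j - 1)) else 0)"
    for j m and h :: "('a, 'n) mfps"
  proof -
    let ?e = "\<lambda>i. if i = j then 1 else 0 :: nat"
    have "mfps_nth (mfps_X j * h) m
        = (\<Sum>q\<in>{(k, l). k + l = m}. if q = (?e, m(j := m j - 1)) then mfps_nth h (m(j := m j - 1)) else 0)"
      unfolding mfps_nth_mult
    proof (rule sum.cong[OF refl], clarify)
      fix k l :: "'n \<Rightarrow> nat"
      assume m: "m = k + l"
      have "l = (k + l)(j := (k + l) j - 1)" if "k = ?e"
        using that by (auto simp: fun_eq_iff)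
      then show "mfps_nth (mfps_X j) k * mfps_nth h l
          = (if (k, l) = (?e, (k + l)(j := (k + l) j - 1)) then mfps_nth h ((k + l)(j := (k + l) j - 1)) else 0)"
        by (auto simp: mfps_X_def)
    qed
    also have "\<dots> = (if (?e, m(j := m j - 1)) \<in> {(k, l). k + l = m} then mfps_nth h (m(j := m j - 1)) else 0)"
      by (subst sum.delta[OF finite_exponent_splits]) simp
    also have "(?e, m(j := m j - 1)) \<in> {(k, l). k + l = m} \<longleftrightarrow> m j > 0"
      by (auto simp: fun_eq_iff split: if_splits)
    finally show ?thesis by simp
  qed
  define ch where "ch m = (SOME j. m j > 0)" for m :: "'n \<Rightarrow> nat"
  have ch: "m (ch m) > 0" if "m \<noteq> 0" for m
  proof -
    have "\<exists>j. m j > 0" using that by (auto simp: fun_eq_iff)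
    then show ?thesis unfolding ch_def by (rule someI_ex)
  qed
  define h where "h j = Abs_mfps (\<lambda>m. if ch (m(j := Suc (m j))) = j then mfps_nth g (m(j := Suc (m j))) else 0)" for j
  have "g = mfps_const (mfps_nth g 0) + (\<Sum>j\<in>UNIV. mfps_X j * h j)"
  proof (rule mfps_eqI)
    fix m
    show "mfps_nth g m = mfps_nth (mfps_const (mfps_nth g 0) + (\<Sum>j\<in>UNIV. mfps_X j * h j)) m"
    proof (cases "m = 0")
      case True
      then show ?thesis by (simp add: nth_X mfps_nth_const)
    next
      case False
      have "(\<Sum>j\<in>UNIV. mfps_nth (mfps_X j * h j) m) = (\<Sum>j\<in>UNIV. if j = ch m then mfps_nth g m else 0)"
        using ch[OF False] by (intro sum.cong) (auto simp: nth_X h_def)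
      with False show ?thesis by (simp add: mfps_nth_const)
    qed
  qed
  then show ?thesis by blast
qed

section \<open>Formal vector fields\<close>

lemma Der_add: "\<delta> \<in> Der \<Longrightarrow> \<delta> (g + h) = \<delta> g + \<delta> h"
  and Der_const_mult: "\<delta> \<in> Der \<Longrightarrow> \<delta> (mfps_const c * g) = mfps_const c * \<delta> g"
  and Der_mult: "\<delta> \<in> Der \<Longrightarrow> \<delta> (g * h) = \<delta> g * h + g * \<delta> h"
  unfolding Der_def by blast+

lemma Der_0: "\<delta> \<in> Der \<Longrightarrow> \<delta> 0 = 0"
  using Der_add[of \<delta> 0 0] by (metis add.right_neutral add_left_cancel)

lemma Der_uminus: "\<delta> \<in> Der \<Longrightarrow> \<delta> (- g) = - \<delta> g"
  using Der_add[of \<delta> g "- g"] Der_0[of \<delta>] by (simp add: add_eq_0_iff)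

lemma Der_diff: "\<delta> \<in> Der \<Longrightarrow> \<delta> (g - h) = \<delta> g - \<delta> h"
  using Der_add[of \<delta> g "- h"] Der_uminus[of \<delta> h] by simp

lemma Der_sum: "\<delta> \<in> Der \<Longrightarrow> \<delta> (sum g A) = (\<Sum>x\<in>A. \<delta> (g x))"
  by (induction A rule: infinite_finite_induct) (auto simp: Der_0 Der_add)

lemma Der_const:
  assumes "\<delta> \<in> Der"
  shows "\<delta> (mfps_const c) = 0"
proof -
  have "\<delta> 1 = 0"
    using Der_mult[OF assms, of 1 1] by (metis add.right_neutral add_left_cancel mult_1 mult.right_neutral)
  then show ?thesis
    using Der_const_mult[OF assms, of c 1] by simp
qed

lemma mfps_deriv_Der: "mfps_deriv j \<in> Der"
  unfolding Der_def using mfps_deriv_add mfps_deriv_const_mult mfps_deriv_mult by blast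

lemma zero_Der: "0 \<in> Der"
  by (simp add: Der_def)

lemma add_Der: "\<delta> \<in> Der \<Longrightarrow> \<epsilon> \<in> Der \<Longrightarrow> \<delta> + \<epsilon> \<in> Der"
  by (auto simp: Der_def algebra_simps)

lemma scale_Der: "\<delta> \<in> Der \<Longrightarrow> vfield_scale a \<delta> \<in> Der"
  by (auto simp: Der_def vfield_scale_def algebra_simps)

lemma bracket_Der:
  assumes "\<delta> \<in> Der" and "\<epsilon> \<in> Der"
  shows "vfield_bracket \<delta> \<epsilon> \<in> Der"
  using assms
  by (subst Der_def, unfold mem_Collect_eq vfield_bracket_def)
    (simp add: Der_add Der_const_mult Der_mult Der_const Der_0 algebra_simps)

lemma vfield_module: "Modules.module (vfield_scale :: (complex, 'n::finite) mfps \<Rightarrow> 'n vfield \<Rightarrow> 'n vfield)"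
  by standard (auto simp: vfield_scale_def fun_eq_iff algebra_simps)

interpretation vfield: Modules.module "vfield_scale :: (complex, 'n::finite) mfps \<Rightarrow> 'n vfield \<Rightarrow> 'n vfield"
  by (rule vfield_module)

lemma Der_subspace: "vfield.subspace Der"
  by (auto simp: vfield.subspace_def zero_Der add_Der scale_Der)

lemma Der_log_subspace: "vfield.subspace (Der_log f)"
  by (auto simp: vfield.subspace_def Der_log_def zero_Der add_Der scale_Der)
    (auto simp: vfield_scale_def intro: dvd_add dvd_mult)

lemma bracket_Der_log:
  assumes "\<delta> \<in> Der_log f" "\<epsilon> \<in> Der_log f"
  shows "vfield_bracket \<delta> \<epsilon> \<in> Der_log f"
proof -
  from assms obtain a b where "\<delta> f = f * a" "\<epsilon> f = f * b" and D: "\<delta> \<in> Der" "\<epsilon> \<in> Der"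
    by (auto simp: Der_log_def elim!: dvdE)
  then have "vfield_bracket \<delta> \<epsilon> f = f * (\<delta> b - \<epsilon> a)"
    by (simp add: vfield_bracket_def Der_mult algebra_simps)
  then show ?thesis using D by (auto simp: Der_log_def bracket_Der)
qed

text \<open>
  Derivations are not assumed continuous. Writing \<open>g\<close> as a constant plus \<open>\<Sum>j. x_j h_j\<close> turns \<open>\<delta> g\<close> into
  \<open>\<Sum>j. x_j (\<delta> h_j)\<close>, so by induction its order exceeds every bound.
\<close>

lemma Der_zero_if_coordinates_zero:
  assumes D: "\<delta> \<in> Der" and X: "\<And>j. \<delta> (mfps_X j) = 0"
  shows "\<delta> g = 0"
proof -
  have "\<delta> g \<in> mfps_order_ge N" for N g
  proof (induction N arbitrary: g)
    case (Suc N)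
    obtain h where "g = mfps_const (mfps_nth g 0) + (\<Sum>j\<in>UNIV. mfps_X j * h j)"
      using mfps_decompose by blast
    then have "\<delta> g = \<delta> (mfps_const (mfps_nth g 0) + (\<Sum>j\<in>UNIV. mfps_X j * h j))"
      by simp
    also have "\<dots> = (\<Sum>j\<in>UNIV. mfps_X j * \<delta> (h j))"
      by (simp add: Der_add[OF D] Der_sum[OF D] Der_mult[OF D] Der_const[OF D] X)
    also have "\<dots> \<in> mfps_order_ge (Suc N)"
    proof (rule order_ge_sum)
      fix j
      have "mfps_X j \<in> (mfps_order_ge 1 :: (complex, 'a) mfps set)"
        by (auto simp only: order_ge_1_iff mfps_X_def mfps_nth_Abs) (auto simp: fun_eq_iff)
      from order_ge_mult[OF this Suc.IH] show "mfps_X j * \<delta> (h j) \<in> mfps_order_ge (Suc N)"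
        by simp
    qed
    finally show ?case .
  qed simp
  then show ?thesis by (rule zero_if_all_orders)
qed

text \<open>
  The difference of the two sides is a derivation that kills all variables. Thus \<open>Der\<close> is free with the
  partial derivatives as a basis.
\<close>

lemma Der_coordinates:
  assumes "\<delta> \<in> Der"
  shows "\<delta> g = (\<Sum>j\<in>UNIV. \<delta> (mfps_X j) * mfps_deriv j g)"
proof -
  have sum: "(\<Sum>j\<in>A. vfield_scale (\<delta> (mfps_X j)) (mfps_deriv j)) h
      = (\<Sum>j\<in>A. \<delta> (mfps_X j) * mfps_deriv j h)" for h A
    by (induction A rule: infinite_finite_induct) (auto simp: vfield_scale_def)
  let ?D = "\<delta> - (\<Sum>j\<in>UNIV. vfield_scale (\<delta> (mfps_X j)) (mfps_deriv j))"
  have "?D \<in> Der"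
    by (intro vfield.subspace_diff Der_subspace vfield.subspace_sum scale_Der mfps_deriv_Der assms)
  moreover have "?D (mfps_X j) = 0" for j
    by (simp add: sum mfps_deriv_X if_distrib cong: if_cong)
  ultimately have "?D g = 0" by (rule Der_zero_if_coordinates_zero)
  then show ?thesis by (simp add: sum)
qed

lemma Der_eqI:
  assumes "\<delta> \<in> Der" "\<epsilon> \<in> Der" "\<And>j. \<delta> (mfps_X j) = \<epsilon> (mfps_X j)"
  shows "\<delta> = \<epsilon>"
  using assms by (intro ext, subst (1 2) Der_coordinates) auto

lemma Der_order_ge:
  assumes "\<delta> \<in> Der" and "\<And>g. \<delta> g \<in> mfps_order_ge 1" and "g \<in> mfps_order_ge N"
  shows "\<delta> g \<in> mfps_order_ge N"
proof (cases N)
  case (Suc M)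
  have "\<delta> (mfps_X j) * mfps_deriv j g \<in> mfps_order_ge (1 + M)" for j
    using assms(2,3) Suc by (intro order_ge_mult order_ge_deriv) auto
  then show ?thesis
    unfolding Der_coordinates[OF assms(1), of g] Suc by (intro order_ge_sum) auto
qed simp

section \<open>Cramer's rule over commutative rings\<close>

lemma det_replace_row:
  fixes M :: "'a::comm_ring_1^'n^'n"
  shows "det (\<chi> i. if i = k then (\<Sum>j\<in>UNIV. x j *s M $ j) else M $ i) = x k * det M"
proof -
  have "det (\<chi> i. if i = k then (\<Sum>j\<in>UNIV. x j *s M $ j) else M $ i)
      = (\<Sum>j\<in>UNIV. det (\<chi> i. if i = k then x j *s M $ j else M $ i))"
    by (rule det_linear_row_sum) simp
  also have "\<dots> = (\<Sum>j\<in>UNIV. x j * det (\<chi> i. if i = k then M $ j else M $ i))"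
    by (simp add: det_row_mul)
  also have "\<dots> = (\<Sum>j\<in>UNIV. if j = k then x k * det M else 0)"
  proof (rule sum.cong[OF refl])
    fix j
    show "x j * det (\<chi> i. if i = k then M $ j else M $ i) = (if j = k then x k * det M else 0)"
    proof (cases "j = k")
      case True
      then have "(\<chi> i. if i = k then M $ j else M $ i) = M" by (simp add: vec_eq_iff)
      with True show ?thesis by simp
    next
      case False
      then have "det (\<chi> i. if i = k then M $ j else M $ i) = 0"
        by (intro det_identical_rows[of j k]) (auto simp: row_def vec_eq_iff)
      with False show ?thesis by simp
    qed
  qed
  finally show ?thesis by simp
qed

lemma det_replace_column:
  fixes M :: "'a::comm_ring_1^'n^'n"
  shows "det (\<chi> i j. if j = k then (M *v x) $ i else M $ i $ j) = x $ k * det M"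
proof -
  have "(\<chi> i. if i = k then (\<Sum>j\<in>UNIV. x $ j *s transpose M $ j) else transpose M $ i)
      = transpose (\<chi> i j. if j = k then (M *v x) $ i else M $ i $ j)"
    by (simp add: vec_eq_iff transpose_def matrix_vector_mult_def mult.commute)
  then show ?thesis
    using det_replace_row[of k "\<lambda>j. x $ j" "transpose M"] by (simp add: det_transpose)
qed

lemma dvd_det_column:
  fixes M :: "'a::comm_ring_1^'n^'n"
  assumes "\<And>i. f dvd v $ i"
  shows "f dvd det (\<chi> i j. if j = k then v $ i else M $ i $ j)"
proof -
  from assms have "\<forall>i. \<exists>b. v $ i = f * b"
    by (simp add: dvd_def)
  from choice[OF this] obtain b where b: "\<And>i. v $ i = f * b i" by blast
  have "(\<chi> i. if i = k then f *s (\<chi> j. b j) else transpose M $ i)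
      = transpose (\<chi> i j. if j = k then v $ i else M $ i $ j)"
    by (simp add: vec_eq_iff transpose_def b)
  then have "det (\<chi> i j. if j = k then v $ i else M $ i $ j)
      = f * det (\<chi> i. if i = k then (\<chi> j. b j) else transpose M $ i)"
    using det_row_mul[of k f "\<lambda>_. \<chi> j. b j" "\<lambda>i. transpose M $ i"] by (simp add: det_transpose)
  then show ?thesis by simp
qed

text \<open>
  Cramer's rule for a row vector \<open>r\<close> that need not lie in the row space. With the adjugate \<open>A\<close> this says
  \<open>r A M = det M r\<close>. Expansion along rows only yields \<open>M A = det M\<close>; the other order follows because
  \<open>M\<close> is injective on vectors over a domain if \<open>det M \<noteq> 0\<close>, so \<open>M (A M - det M) = 0\<close> can be cancelled.
\<close>

lemma det_smult_row_combination:
  fixes M :: "'a::idom^'n^'n"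
  assumes "det M \<noteq> 0"
  shows "det M * r $ j = (\<Sum>i\<in>UNIV. det (\<chi> k. if k = i then r else M $ k) * M $ i $ j)"
proof -
  let ?e = "\<lambda>j. (\<chi> l. if l = j then 1 else 0) :: 'a^'n"
  define A where "A = (\<chi> j i. det (\<chi> k. if k = i then ?e j else M $ k))"
  have A: "(\<Sum>j\<in>UNIV. s $ j * A $ j $ i) = det (\<chi> k. if k = i then s else M $ k)" for s i
  proof -
    have "s = (\<Sum>j\<in>UNIV. s $ j *s ?e j)"
      by (simp add: vec_eq_iff if_distrib cong: if_cong)
    then have "det (\<chi> k. if k = i then s else M $ k)
        = det (\<chi> k. if k = i then (\<Sum>j\<in>UNIV. s $ j *s ?e j) else M $ k)"
      by (rule arg_cong[where f = "\<lambda>v. det (\<chi> k. if k = i then v else M $ k)"])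
    also have "\<dots> = (\<Sum>j\<in>UNIV. det (\<chi> k. if k = i then s $ j *s ?e j else M $ k))"
      by (rule det_linear_row_sum) simp
    also have "\<dots> = (\<Sum>j\<in>UNIV. s $ j * A $ j $ i)"
      by (simp add: det_row_mul A_def)
    finally show ?thesis by simp
  qed
  have MA: "M ** A = mat (det M)"
  proof -
    have "det (\<chi> k. if k = i then M $ l else M $ k) = (if l = i then det M else 0)" for l i
    proof (cases "l = i")
      case True
      then have "(\<chi> k. if k = i then M $ l else M $ k) = M" by (simp add: vec_eq_iff)
      with True show ?thesis by simp
    next
      case False
      then show ?thesis
        by (simp, intro det_identical_rows[of l i]) (auto simp: row_def vec_eq_iff)
    qed
    then show ?thesis
      using A by (simp add: vec_eq_iff matrix_matrix_mult_def mat_def)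
  qed
  have inj: "v = 0" if "M *v v = 0" for v
  proof -
    have "v $ k * det M = 0" for k
    proof -
      have "v $ k * det M = det (\<chi> i j. if j = k then (0 :: 'a^'n) $ i else M $ i $ j)"
        using det_replace_column[of k M v] that by (simp cong: if_cong)
      also have "0 dvd \<dots>" by (rule dvd_det_column) simp
      finally show ?thesis by simp
    qed
    then show ?thesis using assms by (simp add: vec_eq_iff)
  qed
  have "M ** (A ** M) = M ** mat (det M)"
    unfolding matrix_mul_assoc MA by (simp add: vec_eq_iff matrix_matrix_mult_def mat_def if_distrib if_distribR cong: if_cong)
  then have "M *v ((A ** M) *v v - mat (det M) *v v) = 0" for v
    by (simp add: matrix_vector_mult_diff_distrib matrix_vector_mul_assoc)
  then have "(A ** M) *v v = mat (det M) *v v" for v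
    using inj by fastforce
  then have AM: "A ** M = mat (det M)"
    by (subst matrix_eq) auto
  have "(\<Sum>i\<in>UNIV. det (\<chi> k. if k = i then r else M $ k) * M $ i $ j)
      = (\<Sum>i\<in>UNIV. \<Sum>l\<in>UNIV. r $ l * (A $ l $ i * M $ i $ j))"
    unfolding A[symmetric] by (simp add: sum_distrib_right mult.assoc)
  also have "\<dots> = (\<Sum>l\<in>UNIV. r $ l * (A ** M) $ l $ j)"
    by (subst sum.swap) (simp add: matrix_matrix_mult_def sum_distrib_left)
  also have "\<dots> = det M * r $ j"
    unfolding AM by (simp add: mat_def if_distrib mult.commute cong: if_cong)
  finally show ?thesis by simp
qed

section \<open>Saito's criterion\<close>

text \<open>
  Geometrically: no component of the reduced hypersurface \<open>f = 0\<close> lies in its singular locus. The ideal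
  \<open>I\<close> of all \<open>a\<close> with \<open>f dvd a g\<close> is stable under differentiation. Indeed, if \<open>a g = f b\<close>, then \<open>f\<close>
  divides \<open>g\<close> times the derivative of \<open>a g\<close> by the hypothesis on \<open>g\<close>, hence it divides \<open>a' g^2\<close> and the
  square of \<open>a' g\<close>, and so \<open>a' g\<close> because \<open>f\<close> is reduced. As \<open>f\<close> lies in \<open>I\<close>, the ideal contains a unit.
\<close>

lemma reduced_dvd_if_dvd_all_derivs:
  fixes f g :: "('a::field_char_0, 'n::finite) mfps"
  assumes f: "f \<noteq> 0" "mfps_reduced f" and fg: "\<And>j. f dvd g * mfps_deriv j f"
  shows "f dvd g"
proof -
  define I where "I = {a. f dvd a * g}"
  have "mfps_deriv j a \<in> I" if "a \<in> I" for j a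
  proof -
    from that obtain b where b: "a * g = f * b" by (auto simp: I_def elim: dvdE)
    have "(mfps_deriv j a * g) ^ 2 = mfps_deriv j a * g * (mfps_deriv j a * g)"
      by (simp add: power2_eq_square)
    also have "\<dots> = mfps_deriv j a * (g * (mfps_deriv j (a * g) - a * mfps_deriv j g))"
      by (simp add: mfps_deriv_mult algebra_simps)
    also have "\<dots> = mfps_deriv j a * (g * mfps_deriv j f * b + f * (g * mfps_deriv j b - b * mfps_deriv j g))"
      by (simp add: b mfps_deriv_mult algebra_simps)
    also have "f dvd \<dots>"
      by (rule dvd_mult[OF dvd_add[OF dvd_mult2[OF fg] dvd_triv_left]])
    finally show ?thesis using f(2) by (auto simp: I_def mfps_reduced_def)
  qed
  moreover have "f \<in> I" by (simp add: I_def)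
  ultimately obtain u where "f dvd u * g" "u dvd 1"
    using differential_ideal_contains_unit[of I f] f(1) by (auto simp: I_def)
  then obtain v where "u * v = 1" by (metis dvdE)
  then have "g = v * (u * g)" by (metis mult.assoc mult.commute mult_1)
  then show ?thesis using \<open>f dvd u * g\<close> by (metis dvd_mult)
qed

text \<open>
  The matrix \<open>\<eta>_i(x_j)\<close> maps the gradient of \<open>g\<close> to the vector of the \<open>\<eta>_i g\<close>; this is Cramer's rule.
\<close>

lemma det_log_mult_deriv:
  fixes \<eta> :: "'n::finite \<Rightarrow> 'n vfield"
  assumes "\<And>i. \<eta> i \<in> Der"
  shows "mfps_deriv k g * det (\<chi> i j. \<eta> i (mfps_X j))
      = det (\<chi> i j. if j = k then \<eta> i g else \<eta> i (mfps_X j))"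
proof -
  have "((\<chi> i j. \<eta> i (mfps_X j)) *v (\<chi> j. mfps_deriv j g)) $ i = \<eta> i g" for i
    using Der_coordinates[OF assms, of i g] by (simp add: matrix_vector_mult_def)
  then show ?thesis
    using det_replace_column[of k "\<chi> i j. \<eta> i (mfps_X j)" "\<chi> j. mfps_deriv j g"] by (simp cong: if_cong)
qed

lemma Der_log_det_dvd:
  fixes \<eta> :: "'n::finite \<Rightarrow> 'n vfield"
  assumes f: "f \<noteq> 0" "mfps_reduced f" and \<eta>: "\<And>i. \<eta> i \<in> Der_log f"
  shows "f dvd det (\<chi> i j. \<eta> i (mfps_X j))"
proof (rule reduced_dvd_if_dvd_all_derivs[OF f])
  fix k
  have "f dvd det (\<chi> i j. if j = k then (\<chi> i. \<eta> i f) $ i else (\<chi> i j. \<eta> i (mfps_X j)) $ i $ j)"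
    by (rule dvd_det_column) (use \<eta> in \<open>auto simp: Der_log_def\<close>)
  then show "f dvd det (\<chi> i j. \<eta> i (mfps_X j)) * mfps_deriv k f"
    using det_log_mult_deriv[of \<eta> k f] \<eta> by (simp add: Der_log_def mult.commute cong: if_cong)
qed

text \<open>
  Saito's criterion. Replacing one of the fields by \<open>\<epsilon>\<close> gives a determinant that is still divisible by
  \<open>f\<close>; these determinants, divided by \<open>f\<close> and by the unit, are the coefficients of \<open>\<epsilon>\<close>.
\<close>

lemma Der_log_generators:
  fixes \<delta> :: "'n::finite \<Rightarrow> 'n vfield"
  assumes f: "f \<noteq> 0" "mfps_reduced f" and \<delta>: "\<And>i. \<delta> i \<in> Der_log f"
    and u: "u dvd 1" "det (\<chi> i j. \<delta> i (mfps_X j)) = u * f" and \<epsilon>: "\<epsilon> \<in> Der_log f"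
  shows "\<exists>a. \<epsilon> = (\<Sum>i\<in>UNIV. vfield_scale (a i) (\<delta> i))"
proof -
  let ?M = "\<chi> i j. \<delta> i (mfps_X j)"
  have "f dvd det (\<chi> k. if k = i then (\<chi> j. \<epsilon> (mfps_X j)) else ?M $ k)" for i
  proof -
    have "f dvd det (\<chi> k j. (\<delta>(i := \<epsilon>)) k (mfps_X j))"
      by (rule Der_log_det_dvd[OF f]) (use \<delta> \<epsilon> in auto)
    also have "(\<chi> k j. (\<delta>(i := \<epsilon>)) k (mfps_X j)) = (\<chi> k. if k = i then (\<chi> j. \<epsilon> (mfps_X j)) else ?M $ k)"
      by (simp add: vec_eq_iff)
    finally show ?thesis .
  qed
  then have "\<forall>i. \<exists>b. det (\<chi> k. if k = i then (\<chi> j. \<epsilon> (mfps_X j)) else ?M $ k) = f * b"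
    by (simp add: dvd_def)
  from choice[OF this] obtain b where b: "\<And>i. det (\<chi> k. if k = i then (\<chi> j. \<epsilon> (mfps_X j)) else ?M $ k) = f * b i"
    by blast
  obtain v where v: "u * v = 1" using u(1) by (metis dvdE)
  then have "u \<noteq> 0" by auto
  with f u(2) have M: "det ?M \<noteq> 0" by simp
  have coord: "\<epsilon> (mfps_X j) = (\<Sum>i\<in>UNIV. v * b i * \<delta> i (mfps_X j))" for j
  proof -
    have "u * f * \<epsilon> (mfps_X j) = (\<Sum>i\<in>UNIV. f * b i * \<delta> i (mfps_X j))"
      using det_smult_row_combination[OF M, of "\<chi> j. \<epsilon> (mfps_X j)" j] unfolding b u(2) by simp
    also have "\<dots> = u * f * (\<Sum>i\<in>UNIV. v * b i * \<delta> i (mfps_X j))"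
    proof -
      have "u * f * (v * b i * \<delta> i (mfps_X j)) = f * b i * \<delta> i (mfps_X j)" for i
      proof -
        have "u * f * (v * b i * \<delta> i (mfps_X j)) = u * v * (f * b i * \<delta> i (mfps_X j))"
          by (simp only: mult_ac)
        then show ?thesis by (simp only: v mult_1)
      qed
      then show ?thesis by (simp only: sum_distrib_left)
    qed
    finally show ?thesis using \<open>u \<noteq> 0\<close> f(1) by simp
  qed
  have sum: "(\<Sum>i\<in>A. vfield_scale (v * b i) (\<delta> i)) g = (\<Sum>i\<in>A. v * b i * \<delta> i g)" for A g
    by (induction A rule: infinite_finite_induct) (auto simp: vfield_scale_def)
  have "\<epsilon> = (\<Sum>i\<in>UNIV. vfield_scale (v * b i) (\<delta> i))"
  proof (rule Der_eqI)
    show "(\<Sum>i\<in>UNIV. vfield_scale (v * b i) (\<delta> i)) \<in> Der"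
      using \<delta> by (intro vfield.subspace_sum Der_subspace scale_Der) (auto simp: Der_log_def)
  qed (use \<epsilon> coord in \<open>auto simp: Der_log_def sum\<close>)
  then show ?thesis by (rule exI[of _ "\<lambda>i. v * b i"])
qed

section \<open>Invariant vectors in representations of sl(2)\<close>

locale complex_vector_space = vector_space scale
  for scale :: "complex \<Rightarrow> 'b::ab_group_add \<Rightarrow> 'b" (infixr "*c" 75)
begin

abbreviation lin :: "('b \<Rightarrow> 'b) \<Rightarrow> bool" where
  "lin T \<equiv> Vector_Spaces.linear scale scale T"

lemma linI: "(\<And>v w. T (v + w) = T v + T w) \<Longrightarrow> (\<And>c v. T (c *c v) = c *c T v) \<Longrightarrow> lin T"
  by unfold_locales

lemma lin_add: "lin T \<Longrightarrow> T (v + w) = T v + T w"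
  and lin_scale: "lin T \<Longrightarrow> T (c *c v) = c *c T v"
  by (simp_all add: Vector_Spaces.linear_def module_hom_iff)

lemma lin_0: "lin T \<Longrightarrow> T 0 = 0"
  using lin_scale[of T 0 0] by simp

lemma lin_uminus: "lin T \<Longrightarrow> T (- v) = - T v"
  using lin_add[of T v "- v"] lin_0[of T] by (simp add: add_eq_0_iff)

lemma lin_diff: "lin T \<Longrightarrow> T (v - w) = T v - T w"
  using lin_add[of T v "- w"] lin_uminus[of T w] by simp

lemma lin_sum: "lin T \<Longrightarrow> T (sum g A) = (\<Sum>x\<in>A. T (g x))"
  by (induction A rule: infinite_finite_induct) (auto simp: lin_0 lin_add)

lemma lin_funpow: "lin T \<Longrightarrow> lin (T ^^ n)"
  by (induction n) (auto intro!: linI simp: lin_add lin_scale)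

definition poly_op :: "('b \<Rightarrow> 'b) \<Rightarrow> complex poly \<Rightarrow> 'b \<Rightarrow> 'b" where
  "poly_op T p v = (\<Sum>i\<le>degree p. coeff p i *c (T ^^ i) v)"

lemma poly_op_0 [simp]: "poly_op T 0 v = 0"
  by (simp add: poly_op_def)

lemma poly_op_pCons:
  assumes "lin T"
  shows "poly_op T (pCons a p) v = a *c v + T (poly_op T p v)"
proof (cases "p = 0")
  case True
  then show ?thesis using assms by (simp add: poly_op_def lin_0)
next
  case False
  then show ?thesis
    by (simp add: poly_op_def sum.atMost_Suc_shift lin_sum[OF assms] lin_scale[OF assms] del: sum.atMost_Suc)
qed

lemma poly_op_add:
  assumes "lin T"
  shows "poly_op T (p + q) v = poly_op T p v + poly_op T q v"
  by (induction p q rule: poly_induct2)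
    (simp_all add: poly_op_pCons[OF assms] lin_add[OF assms] scale_left_distrib algebra_simps)

lemma poly_op_smult:
  assumes "lin T"
  shows "poly_op T (smult c p) v = c *c poly_op T p v"
  by (induction p)
    (simp_all add: poly_op_pCons[OF assms] lin_scale[OF assms] scale_right_distrib)

lemma poly_op_mult:
  assumes "lin T"
  shows "poly_op T (p * q) v = poly_op T p (poly_op T q v)"
  by (induction p)
    (simp_all add: poly_op_pCons[OF assms] poly_op_add[OF assms] poly_op_smult[OF assms])

lemma poly_op_sum:
  assumes "lin T"
  shows "poly_op T (sum f A) v = (\<Sum>x\<in>A. poly_op T (f x) v)"
  by (induction A rule: infinite_finite_induct) (simp_all add: poly_op_add[OF assms])

lemma poly_op_monom:
  assumes "lin T"
  shows "poly_op T (monom c i) v = c *c (T ^^ i) v"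
  by (induction i)
    (simp_all add: monom_0 monom_Suc poly_op_pCons[OF assms] lin_0[OF assms] lin_scale[OF assms])

lemma lin_poly_op:
  assumes "lin T"
  shows "lin (poly_op T p)"
proof (induction p)
  case 0
  then show ?case by (intro linI) auto
next
  case (pCons a p)
  then show ?case
    by (intro linI) (simp_all add: poly_op_pCons[OF assms] lin_add[OF assms] lin_scale[OF assms]
        lin_add[OF pCons(2)] lin_scale[OF pCons(2)] scale_right_distrib mult.commute algebra_simps)
qed

lemma poly_op_closed:
  assumes "lin T" "subspace S" "\<And>v. v \<in> S \<Longrightarrow> T v \<in> S" "v \<in> S"
  shows "poly_op T p v \<in> S"
  by (induction p) (use assms in \<open>auto simp: poly_op_pCons intro: subspace_0 subspace_add subspace_scale\<close>)

lemma poly_op_eigenvector: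
  assumes "lin T" "T v = \<mu> *c v"
  shows "poly_op T p v = poly p \<mu> *c v"
  by (induction p)
    (simp_all add: poly_op_pCons[OF assms(1)] lin_scale[OF assms(1)] assms(2) scale_left_distrib mult.commute)

text \<open>
  The iterates \<open>v, T v, T^2 v, ...\<close> lie in a finite-dimensional space, so they are linearly dependent.
\<close>

lemma annihilating_poly_vector:
  assumes T: "lin T" and S: "\<And>v. v \<in> S \<Longrightarrow> T v \<in> S" and B: "finite B" "S \<subseteq> span B" and v: "v \<in> S"
  shows "\<exists>p. p \<noteq> 0 \<and> poly_op T p v = 0"
proof (cases "inj_on (\<lambda>i. (T ^^ i) v) {..card B}")
  case inj: True
  let ?x = "\<lambda>i. (T ^^ i) v"
  have "?x i \<in> S" for i
    using S v by (induction i) auto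
  then have "?x ` {..card B} \<subseteq> span B" using B(2) by auto
  moreover have "card (?x ` {..card B}) = Suc (card B)"
    using card_image[OF inj] by simp
  ultimately have "dependent (?x ` {..card B})"
    using independent_span_bound[OF B(1), of "?x ` {..card B}"] by auto
  then obtain u w where u: "w \<in> ?x ` {..card B}" "u w \<noteq> 0" "(\<Sum>w\<in>?x ` {..card B}. u w *c w) = 0"
    by (subst (asm) dependent_finite) auto
  define p where "p = (\<Sum>i\<le>card B. monom (u (?x i)) i)"
  have "poly_op T p v = (\<Sum>i\<le>card B. u (?x i) *c ?x i)"
    by (simp add: p_def poly_op_sum[OF T] poly_op_monom[OF T])
  also have "\<dots> = 0"
    using u(3) by (simp add: sum.reindex[OF inj])
  finally have "poly_op T p v = 0" .
  moreover have "p \<noteq> 0"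
  proof -
    from u(1) obtain i where i: "i \<le> card B" "w = ?x i" by auto
    have "coeff p i = (\<Sum>k\<le>card B. if k = i then u (?x i) else 0)"
      unfolding p_def coeff_sum by (rule sum.cong) auto
    also have "\<dots> = u w" using i by simp
    finally show ?thesis using u(2) by auto
  qed
  ultimately show ?thesis by blast
next
  case False
  then obtain i j where ij: "i \<noteq> j" "(T ^^ i) v = (T ^^ j) v" by (auto simp: inj_on_def)
  let ?p = "monom 1 i + monom (-1) j :: complex poly"
  have "poly_op T ?p v = 0"
    using ij(2) by (simp add: poly_op_add[OF T] poly_op_monom[OF T])
  moreover have "coeff ?p i = 1" using ij(1) by simp
  then have "?p \<noteq> 0" by (metis coeff_0 zero_neq_one)
  ultimately show ?thesis by blast
qed

text \<open>
  The product of the annihilating polynomials of the vectors of a basis.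
\<close>

lemma annihilating_poly:
  assumes T: "lin T" and S: "\<And>v. v \<in> S \<Longrightarrow> T v \<in> S" and B: "finite B" "S \<subseteq> span B"
  shows "\<exists>p. p \<noteq> 0 \<and> (\<forall>v\<in>S. poly_op T p v = 0)"
proof -
  obtain A where A: "A \<subseteq> S" "independent A" "S \<subseteq> span A"
    using maximal_independent_subset[of S] by blast
  have "finite A"
    using independent_span_bound[OF B(1) A(2)] A(1) B(2) by auto
  have "\<forall>a\<in>A. \<exists>p. p \<noteq> 0 \<and> poly_op T p a = 0"
    using annihilating_poly_vector[OF T S B] A(1) by blast
  then obtain q where q: "\<And>a. a \<in> A \<Longrightarrow> q a \<noteq> 0 \<and> poly_op T (q a) a = 0" by metis
  let ?p = "\<Prod>a\<in>A. q a"
  have base: "poly_op T ?p a = 0" if "a \<in> A" for a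
  proof -
    have "?p = (\<Prod>a\<in>A - {a}. q a) * q a"
      using prod.remove[OF \<open>finite A\<close> that, of q] by (simp add: mult.commute)
    then show ?thesis
      using q[OF that] by (simp add: poly_op_mult[OF T] lin_0[OF lin_poly_op[OF T]])
  qed
  have "poly_op T ?p v = 0" if "v \<in> span A" for v
    using that
    by (induction rule: span_induct_alt)
      (simp_all add: base lin_0 lin_add lin_scale lin_poly_op[OF T])
  moreover have "?p \<noteq> 0" using q \<open>finite A\<close> by simp
  ultimately show ?thesis using A(3) by blast
qed

lemma scale_2: "2 *c v = v + v" and scale_4: "4 *c v = v + v + v + v"
  using scale_left_distrib[of 1 1 v] scale_left_distrib[of "1 + 1" "1 + 1" v]
  by (simp_all add: add.assoc)

end

text \<open>
  The operators are linear on the whole space, but satisfy the relations of \<open>sl(2)\<close> on the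
  finite-dimensional subspace \<open>S\<close> only.
\<close>

locale sl2_rep = complex_vector_space scale
  for scale :: "complex \<Rightarrow> 'b::ab_group_add \<Rightarrow> 'b" (infixr "*c" 75) +
  fixes S B :: "'b set" and H E F :: "'b \<Rightarrow> 'b"
  assumes S: "subspace S" and B: "finite B" "S \<subseteq> span B"
    and lin: "lin H" "lin E" "lin F"
    and closed [simp]: "v \<in> S \<Longrightarrow> H v \<in> S" "v \<in> S \<Longrightarrow> E v \<in> S" "v \<in> S \<Longrightarrow> F v \<in> S"
    and HE: "v \<in> S \<Longrightarrow> H (E v) - E (H v) = 2 *c E v"
    and HF: "v \<in> S \<Longrightarrow> H (F v) - F (H v) = - (2 *c F v)"
    and EF: "v \<in> S \<Longrightarrow> E (F v) - F (E v) = H v"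
begin

text \<open>
  The Weyl reflection exchanges \<open>E\<close> and \<open>F\<close>. It turns statements about raising into statements about
  lowering vectors.
\<close>

lemma opposite: "sl2_rep scale S B (\<lambda>v. - H v) F E"
proof (rule sl2_rep.intro[OF complex_vector_space_axioms sl2_rep_axioms.intro])
  show "lin (\<lambda>v. - H v)"
    by (intro linI) (simp_all add: lin_add[OF lin(1)] lin_scale[OF lin(1)])
  show "- H (F v) - F (- H v) = 2 *c F v" if "v \<in> S" for v
    using HF[OF that] by (simp add: lin_uminus[OF lin(3)] algebra_simps)
  show "- H (E v) - E (- H v) = - (2 *c E v)" if "v \<in> S" for v
    using HE[OF that] by (simp add: lin_uminus[OF lin(2)] algebra_simps)
  show "F (E v) - E (F v) = - H v" if "v \<in> S" for v
    using EF[OF that] by (simp add: algebra_simps)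
qed (use S B lin in \<open>auto intro: subspace_neg\<close>)

definition casimir :: "'b \<Rightarrow> 'b" where
  "casimir v = H (H v) + 2 *c H v + 4 *c F (E v)"

lemma lin_casimir: "lin casimir"
  by (intro linI)
    (simp_all add: casimir_def lin_add[OF lin(1)] lin_add[OF lin(2)] lin_add[OF lin(3)]
      lin_scale[OF lin(1)] lin_scale[OF lin(2)] lin_scale[OF lin(3)] scale_right_distrib mult.commute)

lemma casimir_closed [simp]: "v \<in> S \<Longrightarrow> casimir v \<in> S"
  by (simp add: casimir_def S subspace_add subspace_scale)

lemma normal_order:
  "v \<in> S \<Longrightarrow> H (E v) = E (H v) + 2 *c E v"
  "v \<in> S \<Longrightarrow> H (F v) = F (H v) - 2 *c F v"
  "v \<in> S \<Longrightarrow> F (E v) = E (F v) - H v"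
  using HE[of v] HF[of v] EF[of v] by (simp_all add: algebra_simps)

lemma casimir_commutes:
  assumes "v \<in> S"
  shows "casimir (E v) = E (casimir v)" "casimir (F v) = F (casimir v)" "casimir (H v) = H (casimir v)"
  using assms
  by (simp_all add: casimir_def normal_order lin_add[OF lin(1)] lin_add[OF lin(2)] lin_add[OF lin(3)]
      lin_diff[OF lin(1)] lin_diff[OF lin(2)] lin_diff[OF lin(3)] scale_2 scale_4 algebra_simps)

lemma casimir_opposite: "v \<in> S \<Longrightarrow> sl2_rep.casimir scale (\<lambda>v. - H v) F E v = casimir v"
  by (simp add: sl2_rep.casimir_def[OF opposite] casimir_def lin_uminus[OF lin(1)] normal_order
      lin_diff[OF lin(3)] scale_2 scale_4 algebra_simps)

text \<open>
  The Fitting null component of the Casimir operator.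
\<close>

definition null_part :: "'b set" where
  "null_part = {v \<in> S. \<exists>m. (casimir ^^ m) v = 0}"

lemma casimir_funpow_closed: "v \<in> S \<Longrightarrow> (casimir ^^ m) v \<in> S"
  by (induction m) auto

lemma casimir_funpow_commutes:
  assumes "v \<in> S"
  shows "(casimir ^^ m) (E v) = E ((casimir ^^ m) v)" "(casimir ^^ m) (F v) = F ((casimir ^^ m) v)"
    "(casimir ^^ m) (H v) = H ((casimir ^^ m) v)"
  by (induction m) (use assms in \<open>simp_all add: casimir_commutes casimir_funpow_closed\<close>)

lemma null_part_closed:
  assumes "v \<in> null_part"
  shows "E v \<in> null_part" "F v \<in> null_part" "H v \<in> null_part"
proof -
  obtain m where "v \<in> S" "(casimir ^^ m) v = 0" using assms by (auto simp: null_part_def)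
  then show "E v \<in> null_part" "F v \<in> null_part" "H v \<in> null_part"
    using casimir_funpow_commutes[of v m] lin_0[OF lin(1)] lin_0[OF lin(2)] lin_0[OF lin(3)]
    by (auto simp: null_part_def intro!: exI[of _ m])
qed

lemma subspace_null_part: "subspace null_part"
proof (rule subspaceI)
  show "0 \<in> null_part"
    by (auto simp: null_part_def S subspace_0 intro: exI[of _ 0])
  show "v + w \<in> null_part" if "v \<in> null_part" "w \<in> null_part" for v w
  proof -
    from that obtain m n where mn: "(casimir ^^ m) v = 0" "(casimir ^^ n) w = 0"
      by (auto simp: null_part_def)
    have "(casimir ^^ (n + m)) v = 0" "(casimir ^^ (m + n)) w = 0"
      unfolding funpow_add using mn by (simp_all add: lin_0[OF lin_funpow[OF lin_casimir]])
    then have "(casimir ^^ (m + n)) (v + w) = 0"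
      by (simp add: lin_add[OF lin_funpow[OF lin_casimir]] add.commute)
    then show ?thesis using that by (auto simp: null_part_def S subspace_add)
  qed
  show "c *c v \<in> null_part" if "v \<in> null_part" for c v
    using that by (auto simp: null_part_def S subspace_scale lin_scale[OF lin_funpow[OF lin_casimir]])
qed

lemma null_part_opposite: "sl2_rep.null_part scale S (\<lambda>v. - H v) F E = null_part"
proof -
  have "(sl2_rep.casimir scale (\<lambda>v. - H v) F E ^^ m) v = (casimir ^^ m) v" if "v \<in> S" for v m
    by (induction m) (simp_all add: casimir_opposite casimir_funpow_closed that)
  then show ?thesis
    by (auto simp: sl2_rep.null_part_def[OF opposite] null_part_def)
qed

text \<open>
  Since \<open>H\<close> has finitely many eigenvalues on \<open>S\<close>, raising \<open>x\<close> by powers of \<open>E\<close> ends with a highest weight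
  vector. If its weight is \<open>\<nu>\<close>, the Casimir operator acts on it by \<open>\<nu> (\<nu> + 2)\<close>, and nilpotency leaves
  \<open>\<nu> = 0\<close> or \<open>\<nu> = - 2\<close>.
\<close>

lemma null_part_eigenvalue_le:
  assumes x: "x \<in> null_part" "x \<noteq> 0" and H: "H x = \<mu> *c x"
  shows "\<exists>j::nat. \<mu> = - 2 * of_nat j"
proof -
  let ?y = "\<lambda>j. (E ^^ j) x"
  have yS: "?y j \<in> null_part" for j
    using x(1) null_part_closed(1) by (induction j) auto
  then have yS': "?y j \<in> S" for j by (auto simp: null_part_def)
  have eig: "H (?y j) = (\<mu> + 2 * of_nat j) *c ?y j" for j
  proof (induction j)
    case (Suc j)
    have "H (?y (Suc j)) = (\<mu> + 2 * of_nat j) *c ?y (Suc j) + 2 *c ?y (Suc j)"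
      using normal_order(1)[OF yS'[of j]] Suc by (simp add: lin_scale[OF lin(2)])
    also have "\<dots> = (\<mu> + 2 * of_nat j + 2) *c ?y (Suc j)"
      by (rule scale_left_distrib[symmetric])
    also have "\<mu> + 2 * of_nat j + 2 = \<mu> + 2 * of_nat (Suc j)"
      by simp
    finally show ?case .
  qed (use H in simp)
  obtain p where p: "p \<noteq> 0" "\<And>v. v \<in> S \<Longrightarrow> poly_op H p v = 0"
    using annihilating_poly[OF lin(1) closed(1) B] by blast
  have "\<exists>j. ?y j = 0"
  proof (rule ccontr)
    assume "\<nexists>j. ?y j = 0"
    then have "poly p (\<mu> + 2 * of_nat j) = 0" for j
      using p(2)[OF yS'[of j]] poly_op_eigenvector[OF lin(1) eig[of j], of p] by simp
    then have "range (\<lambda>j::nat. \<mu> + 2 * of_nat j) \<subseteq> {z. poly p z = 0}" by auto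
    then have "finite (range (\<lambda>j::nat. \<mu> + 2 * of_nat j))"
      using poly_roots_finite[OF p(1)] finite_subset by blast
    moreover have "inj (\<lambda>j::nat. \<mu> + 2 * of_nat j)"
      by (auto simp: inj_on_def)
    ultimately show False
      using finite_imageD infinite_UNIV_nat by blast
  qed
  define k where "k = (LEAST j. ?y j = 0)"
  have k: "?y k = 0" using \<open>\<exists>j. ?y j = 0\<close> unfolding k_def by (rule LeastI_ex)
  with x(2) obtain l where l: "k = Suc l" by (cases k) auto
  have yl: "?y l \<noteq> 0"
    using not_less_Least[of l "\<lambda>j. ?y j = 0"] l by (simp add: k_def)
  define \<nu> where "\<nu> = \<mu> + 2 * of_nat l"
  have "casimir (?y l) = \<nu> *c \<nu> *c ?y l + 2 *c \<nu> *c ?y l"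
    using eig[of l] k l
    by (simp add: casimir_def \<nu>_def lin_scale[OF lin(1)] lin_0[OF lin(3)])
  then have "casimir (?y l) = (\<nu> * (\<nu> + 2)) *c ?y l"
    by (simp only: scale_scale scale_left_distrib[symmetric] distrib_left mult.commute)
  then have cas: "(casimir ^^ m) (?y l) = (\<nu> * (\<nu> + 2)) ^ m *c ?y l" for m
    by (induction m) (simp_all add: lin_scale[OF lin_casimir] mult.commute)
  obtain m where "(casimir ^^ m) (?y l) = 0"
    using yS[of l] by (auto simp: null_part_def)
  then have "\<nu> * (\<nu> + 2) = 0"
    unfolding cas using yl by auto
  then consider "\<nu> = 0" | "\<nu> = - 2"
    by (metis add_eq_0_iff2 mult_eq_0_iff)
  then show ?thesis
  proof cases
    case 1
    then have "\<mu> = - 2 * of_nat l" by (simp add: \<nu>_def add_eq_0_iff2)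
    then show ?thesis ..
  next
    case 2
    then have "\<mu> = - 2 - 2 * of_nat l" by (simp add: \<nu>_def eq_diff_eq)
    then have "\<mu> = - 2 * of_nat (Suc l)" by (simp add: algebra_simps)
    then show ?thesis ..
  qed
qed

text \<open>
  By the Weyl reflection the weight is both a nonpositive and a nonnegative even integer.
\<close>

lemma null_part_eigenvalue_0:
  assumes "x \<in> null_part" "x \<noteq> 0" and "H x = \<mu> *c x"
  shows "\<mu> = 0"
proof -
  have "\<exists>j::nat. - \<mu> = - 2 * of_nat j"
    using sl2_rep.null_part_eigenvalue_le[OF opposite, of x "- \<mu>"] assms
    by (simp add: null_part_opposite)
  then obtain j :: nat where "- \<mu> = - 2 * of_nat j" ..
  moreover obtain i :: nat where "\<mu> = - 2 * of_nat i"
    using null_part_eigenvalue_le[OF assms] ..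
  ultimately have "of_nat (2 * i + 2 * j) = (0 :: complex)"
    by (simp add: algebra_simps)
  then have "i = 0" unfolding of_nat_eq_0_iff by simp
  with \<open>\<mu> = - 2 * of_nat i\<close> show ?thesis by simp
qed

text \<open>
  A linear factor \<open>H - r\<close> with \<open>r \<noteq> 0\<close> is injective on the null part and can be dropped from \<open>p\<close>; only
  powers of \<open>H\<close> remain.
\<close>

lemma null_part_H_nilpotent:
  assumes "p \<noteq> 0" "v \<in> null_part" "poly_op H p v = 0"
  shows "\<exists>m. (H ^^ m) v = 0"
  using assms
proof (induction "degree p" arbitrary: p v)
  case 0
  then obtain c where "p = [:c:]" by (metis degree_0_id)
  with 0 have "v = 0" by (simp add: poly_op_pCons[OF lin(1)] lin_0[OF lin(1)])
  then show ?case by (intro exI[of _ 0]) simp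
next
  case (Suc n)
  then have "\<not> constant (poly p)" by (simp add: constant_degree)
  then obtain r where r: "poly p r = 0"
    using fundamental_theorem_of_algebra by blast
  then obtain q where q: "p = [:- r, 1:] * q"
    by (metis dvdE poly_eq_0_iff_dvd)
  have q0: "q \<noteq> 0" using q Suc.prems(1) by auto
  have dq: "n = degree q"
    using Suc.hyps(2) q0 unfolding q by (subst (asm) degree_mult_eq) auto
  show ?case
  proof (cases "r = 0")
    case True
    have "poly_op H q (H v) = poly_op H (q * [:- r, 1:]) v"
      unfolding poly_op_mult[OF lin(1)] by (simp add: True poly_op_pCons[OF lin(1)] lin_0[OF lin(1)])
    also have "\<dots> = 0" using Suc.prems(3) q by (simp add: mult.commute)
    finally have "\<exists>m. (H ^^ m) (H v) = 0"
      using Suc.hyps(1)[OF dq q0 null_part_closed(3)[OF Suc.prems(2)]] by blast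
    then obtain m where "(H ^^ m) (H v) = 0" ..
    then show ?thesis by (intro exI[of _ "Suc m"]) (simp add: funpow_swap1)
  next
    case False
    let ?w = "poly_op H q v"
    have w: "?w \<in> null_part"
      using poly_op_closed[OF lin(1) subspace_null_part null_part_closed(3) Suc.prems(2)] .
    have "H ?w = r *c ?w"
      using Suc.prems(3) unfolding q poly_op_mult[OF lin(1)]
      by (simp add: poly_op_pCons[OF lin(1)] lin_0[OF lin(1)] add_eq_0_iff2 lin_add[OF lin(1)] eq_neg_iff_add_eq_0)
    then have "?w = 0" using null_part_eigenvalue_0[OF w] False by blast
    then show ?thesis using Suc.hyps(1)[OF dq q0 Suc.prems(2)] by blast
  qed
qed

text \<open>
  If \<open>H v = 0\<close>, then \<open>E v\<close> has weight 2, which does not occur in the null part. The general case follows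
  by induction on the exponent of the power of \<open>H\<close> that kills \<open>v\<close>.
\<close>

lemma null_part_E_trivial:
  assumes "v \<in> null_part"
  shows "E v = 0"
proof -
  have "E v = 0" if "v \<in> null_part" "(H ^^ m) v = 0" for m v
    using that
  proof (induction m arbitrary: v)
    case 0
    then show ?case by (simp add: lin_0[OF lin(2)])
  next
    case (Suc m)
    have "E (H v) = 0"
      using Suc by (intro Suc.IH null_part_closed) (simp_all add: funpow_swap1)
    then have "H (E v) = 2 *c E v"
      using normal_order(1)[of v] Suc.prems(1) by (simp add: null_part_def)
    then show ?case
      using null_part_eigenvalue_0[of "E v" 2] null_part_closed(1)[OF Suc.prems(1)] by auto
  qed
  moreover obtain p where "p \<noteq> 0" "\<And>v. v \<in> S \<Longrightarrow> poly_op H p v = 0"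
    using annihilating_poly[OF lin(1) closed(1) B] by blast
  ultimately show ?thesis
    using null_part_H_nilpotent[of p v] assms by (auto simp: null_part_def)
qed

lemma null_part_trivial:
  assumes "v \<in> null_part"
  shows "E v = 0" "F v = 0" "H v = 0"
proof -
  show E: "E v = 0" by (rule null_part_E_trivial[OF assms])
  show F: "F v = 0"
    using sl2_rep.null_part_E_trivial[OF opposite, of v] assms by (simp add: null_part_opposite)
  show "H v = 0"
    using EF[of v] E F assms by (simp add: null_part_def lin_0[OF lin(2)] lin_0[OF lin(3)])
qed

text \<open>
  A form of Whitehead's first lemma: \<open>W\<close> contains the image of the action, so \<open>S / W\<close> is a trivial module,
  and the extension has an invariant vector outside \<open>W\<close>. Let \<open>p = t^m q\<close> with \<open>q(0) \<noteq> 0\<close> be a polynomial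
  for which \<open>p(C) v = 0\<close>, where \<open>C\<close> is the Casimir operator. Then \<open>q(C) v\<close> is killed by \<open>C^m\<close>, so it lies
  in the null part and is invariant, and it differs from \<open>q(0) v\<close> by an element of \<open>W\<close>.
\<close>

lemma invariant_vector_outside:
  assumes W: "subspace W" "W \<subseteq> S"
    and maps: "\<And>v. v \<in> S \<Longrightarrow> H v \<in> W" "\<And>v. v \<in> S \<Longrightarrow> E v \<in> W" "\<And>v. v \<in> S \<Longrightarrow> F v \<in> W"
    and v: "v \<in> S" "v \<notin> W"
  shows "\<exists>w. w \<in> S \<and> w \<notin> W \<and> H w = 0 \<and> E w = 0 \<and> F w = 0"
proof -
  obtain p where p: "p \<noteq> 0" "poly_op casimir p v = 0"
    using annihilating_poly_vector[OF lin_casimir casimir_closed B v(1)] by blast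
  obtain q where q: "p = [:0, 1:] ^ order 0 p * q" "\<not> [:0, 1:] dvd q"
    using order_decomp[OF p(1), of 0] by auto
  obtain c r where cr: "q = pCons c r" by (cases q) auto
  have "c \<noteq> 0"
  proof
    assume "c = 0"
    then have "q = [:0, 1:] * r" by (simp add: cr)
    then have "[:0, 1:] dvd q" by (rule dvdI)
    with q(2) show False by contradiction
  qed
  let ?w = "poly_op casimir q v"
  have rS: "poly_op casimir r v \<in> S"
    by (rule poly_op_closed[OF lin_casimir S casimir_closed v(1)])
  have cW: "casimir (poly_op casimir r v) \<in> W"
    unfolding casimir_def[of "poly_op casimir r v"] using rS maps by (intro subspace_add subspace_scale W) auto
  have w: "?w = c *c v + casimir (poly_op casimir r v)"
    by (simp add: cr poly_op_pCons[OF lin_casimir])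
  have wS: "?w \<in> S"
    by (rule poly_op_closed[OF lin_casimir S casimir_closed v(1)])
  have "?w \<notin> W"
  proof
    assume "?w \<in> W"
    then have "c *c v \<in> W"
      using subspace_diff[OF W(1) _ cW, of ?w] by (simp add: w)
    then have "inverse c *c (c *c v) \<in> W" by (rule subspace_scale[OF W(1)])
    then show False using \<open>c \<noteq> 0\<close> v(2) by simp
  qed
  moreover have "(casimir ^^ order 0 p) ?w = 0"
  proof -
    have "[:0, 1:] ^ order 0 p = monom (1 :: complex) (order 0 p)"
      by (simp add: monom_altdef)
    then show ?thesis
      using p(2) q(1) poly_op_mult[OF lin_casimir, of "monom 1 (order 0 p)" q v]
      by (simp add: poly_op_monom[OF lin_casimir])
  qed
  then have "?w \<in> null_part" using wS by (auto simp: null_part_def)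
  ultimately show ?thesis using null_part_trivial wS by blast
qed

end

section \<open>Perfect Lie algebras of dimension three\<close>

text \<open>
  A Lie bracket on a three-dimensional space is an alternating bilinear map, so it has the form
  \<open>B *v cross v w\<close> for a unique matrix \<open>B\<close>. The algebra is perfect if and only if \<open>B\<close> is invertible, and
  in that case the Jacobi identity holds if and only if \<open>B\<close> is symmetric.
\<close>

definition cross :: "complex^3 \<Rightarrow> complex^3 \<Rightarrow> complex^3" where
  "cross v w = vector [v$2 * w$3 - v$3 * w$2, v$3 * w$1 - v$1 * w$3, v$1 * w$2 - v$2 * w$1]"

lemma cross_nth:
  "cross v w $ 1 = v$2 * w$3 - v$3 * w$2"
  "cross v w $ 2 = v$3 * w$1 - v$1 * w$3"
  "cross v w $ 3 = v$1 * w$2 - v$2 * w$1"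
  by (simp_all add: cross_def)

lemma mult_vec_nth: "((B :: complex^3^3) *v v) $ i = B$i$1 * v$1 + B$i$2 * v$2 + B$i$3 * v$3"
  by (simp add: matrix_vector_mult_def sum_3)

definition triple_form :: "complex^3 \<Rightarrow> complex^3 \<Rightarrow> complex^3 \<Rightarrow> complex" where
  "triple_form u v w = cross u v $ 1 * w$1 + cross u v $ 2 * w$2 + cross u v $ 3 * w$3"

text \<open>
  Cramer's rule: the coordinates of \<open>x\<close> in terms of \<open>u\<close>, \<open>v\<close>, \<open>w\<close>.
\<close>

lemma triple_form_expand:
  "triple_form u v w *s x = triple_form x v w *s u + triple_form u x w *s v + triple_form u v x *s w"
  by (simp add: vec_eq_iff forall_3 triple_form_def cross_nth algebra_simps)

text \<open>
  The quadratic form of the adjugate of the symmetric matrix \<open>B\<close>. Up to the factor \<open>- 2\<close> it is the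
  Killing form of the bracket \<open>B *v cross v w\<close>.
\<close>

definition cofactor_form :: "complex^3^3 \<Rightarrow> complex^3 \<Rightarrow> complex^3 \<Rightarrow> complex" where
  "cofactor_form B v w =
     (B$2$2 * B$3$3 - B$2$3 ^ 2) * v$1 * w$1
     + (B$1$1 * B$3$3 - B$1$3 ^ 2) * v$2 * w$2
     + (B$1$1 * B$2$2 - B$1$2 ^ 2) * v$3 * w$3
     + (B$1$3 * B$2$3 - B$1$2 * B$3$3) * (v$1 * w$2 + v$2 * w$1)
     + (B$1$2 * B$2$3 - B$1$3 * B$2$2) * (v$1 * w$3 + v$3 * w$1)
     + (B$1$2 * B$1$3 - B$1$1 * B$2$3) * (v$2 * w$3 + v$3 * w$2)"

lemma cofactor_form_commute: "cofactor_form B v w = cofactor_form B w v"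
  by (simp add: cofactor_form_def algebra_simps)

lemma cofactor_form_add_right: "cofactor_form B u (v + w) = cofactor_form B u v + cofactor_form B u w"
  and cofactor_form_scale_right: "cofactor_form B u (c *s v) = c * cofactor_form B u v"
  by (simp_all add: cofactor_form_def algebra_simps)

lemma cofactor_form_add_left: "cofactor_form B (v + w) u = cofactor_form B v u + cofactor_form B w u"
  and cofactor_form_scale_left: "cofactor_form B (c *s v) u = c * cofactor_form B v u"
  by (simp_all add: cofactor_form_commute[of B _ u] cofactor_form_add_right cofactor_form_scale_right)

lemma symmetric_3:
  assumes "transpose B = (B :: complex^3^3)"
  shows "B$2$1 = B$1$2" "B$3$1 = B$1$3" "B$3$2 = B$2$3"
proof -
  have "B$j$i = B$i$j" for i j
    using arg_cong[OF assms, of "\<lambda>M. M$i$j"] by (simp add: transpose_def)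
  then show "B$2$1 = B$1$2" "B$3$1 = B$1$3" "B$3$2 = B$2$3" by blast+
qed

text \<open>
  For \<open>B = 1\<close> this is the rule \<open>u \<times> (v \<times> w) = (u \<bullet> w) v - (u \<bullet> v) w\<close> for the cross product.
\<close>

lemma double_bracket:
  assumes "transpose B = (B :: complex^3^3)"
  shows "B *v cross u (B *v cross v w) = cofactor_form B u w *s v - cofactor_form B u v *s w"
  by (simp add: vec_eq_iff forall_3 mult_vec_nth cross_nth cofactor_form_def symmetric_3[OF assms]
      power2_eq_square algebra_simps)

text \<open>
  The Gram determinant of two vectors for a ternary quadratic form is the value of the cofactor form at
  their cross product.
\<close>

lemma gram_determinant_ternary:
  fixes a b c d e g v1 v2 v3 w1 w2 w3 :: complex
  shows "(a * v1 * v1 + b * v2 * v2 + c * v3 * v3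
      + d * (v1 * v2 + v2 * v1) + e * (v1 * v3 + v3 * v1) + g * (v2 * v3 + v3 * v2))
    * (a * w1 * w1 + b * w2 * w2 + c * w3 * w3
      + d * (w1 * w2 + w2 * w1) + e * (w1 * w3 + w3 * w1) + g * (w2 * w3 + w3 * w2))
    - (a * v1 * w1 + b * v2 * w2 + c * v3 * w3
      + d * (v1 * w2 + v2 * w1) + e * (v1 * w3 + v3 * w1) + g * (v2 * w3 + v3 * w2)) ^ 2
    = (b * c - g ^ 2) * (v2 * w3 - v3 * w2) ^ 2 + (a * c - e ^ 2) * (v3 * w1 - v1 * w3) ^ 2
    + (a * b - d ^ 2) * (v1 * w2 - v2 * w1) ^ 2
    + 2 * (e * g - d * c) * (v2 * w3 - v3 * w2) * (v3 * w1 - v1 * w3)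
    + 2 * (d * g - e * b) * (v2 * w3 - v3 * w2) * (v1 * w2 - v2 * w1)
    + 2 * (d * e - a * g) * (v3 * w1 - v1 * w3) * (v1 * w2 - v2 * w1)"
  by (simp add: power2_eq_square algebra_simps)

lemma gram_triple_form:
  assumes "transpose B = (B :: complex^3^3)"
  shows "det B * triple_form v w (B *v cross v w)
    = cofactor_form B v v * cofactor_form B w w - cofactor_form B v w ^ 2"
proof -
  \<comment> \<open>The cofactor matrix of the cofactor matrix of \<open>B\<close> is \<open>det B\<close> times \<open>B\<close>.\<close>
  have D: "det B = B$1$1 * B$2$2 * B$3$3 + 2 * B$1$2 * B$1$3 * B$2$3
      - B$1$1 * B$2$3 ^ 2 - B$2$2 * B$1$3 ^ 2 - B$3$3 * B$1$2 ^ 2"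
    by (simp add: det_3 symmetric_3[OF assms] power2_eq_square algebra_simps)
  define a b c d e g where abc: "a = B$1$1" "b = B$2$2" "c = B$3$3" "d = B$1$2" "e = B$1$3" "g = B$2$3"
  define x1 x2 x3 where x: "x1 = v$2 * w$3 - v$3 * w$2" "x2 = v$3 * w$1 - v$1 * w$3"
    "x3 = v$1 * w$2 - v$2 * w$1"
  have "cofactor_form B v v * cofactor_form B w w - cofactor_form B v w ^ 2
      = ((a * c - e ^ 2) * (a * b - d ^ 2) - (d * e - a * g) ^ 2) * x1 ^ 2
      + ((b * c - g ^ 2) * (a * b - d ^ 2) - (d * g - e * b) ^ 2) * x2 ^ 2
      + ((b * c - g ^ 2) * (a * c - e ^ 2) - (e * g - d * c) ^ 2) * x3 ^ 2
      + 2 * ((d * g - e * b) * (d * e - a * g) - (e * g - d * c) * (a * b - d ^ 2)) * x1 * x2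
      + 2 * ((e * g - d * c) * (d * e - a * g) - (d * g - e * b) * (a * c - e ^ 2)) * x1 * x3
      + 2 * ((e * g - d * c) * (d * g - e * b) - (b * c - g ^ 2) * (d * e - a * g)) * x2 * x3"
    unfolding cofactor_form_def abc[symmetric] x by (rule gram_determinant_ternary)
  also have "\<dots> = (a * b * c + 2 * d * e * g - a * g ^ 2 - b * e ^ 2 - c * d ^ 2)
      * (x1 * (a * x1 + d * x2 + e * x3) + x2 * (d * x1 + b * x2 + g * x3) + x3 * (e * x1 + g * x2 + c * x3))"
    by (simp add: power2_eq_square algebra_simps)
  also have "\<dots> = det B * triple_form v w (B *v cross v w)"
    unfolding D triple_form_def mult_vec_nth cross_nth symmetric_3[OF assms] abc[symmetric] x[symmetric]
    by (simp add: algebra_simps)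
  finally show ?thesis by simp
qed

lemma cofactor_form_nondegenerate:
  assumes B: "transpose B = (B :: complex^3^3)" "det B \<noteq> 0" and v: "v \<noteq> 0"
  shows "\<exists>w. cofactor_form B v w \<noteq> 0"
proof (rule ccontr)
  assume "\<nexists>w. cofactor_form B v w \<noteq> 0"
  then have *: "cofactor_form B v w = 0" for w by blast
  have "det B * v$i = B$i$1 * cofactor_form B v (vector [1, 0, 0])
      + B$i$2 * cofactor_form B v (vector [0, 1, 0]) + B$i$3 * cofactor_form B v (vector [0, 0, 1])" for i
    using exhaust_3[of i]
    by (elim disjE) (simp_all add: det_3 cofactor_form_def symmetric_3[OF B(1)] power2_eq_square algebra_simps)
  then have "v $ i = 0" for i using B(2) * by simp
  then show False using v by (simp add: vec_eq_iff)
qed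

text \<open>
  A quadratic form has a zero on every complex plane; here the plane is spanned by the first two axes.
\<close>

lemma isotropic_vector:
  "\<exists>e. e \<noteq> 0 \<and> cofactor_form B e e = 0"
proof -
  let ?e1 = "vector [1, 0, 0] :: complex^3" and ?e2 = "vector [0, 1, 0] :: complex^3"
  let ?a = "cofactor_form B ?e1 ?e1" and ?b = "cofactor_form B ?e1 ?e2" and ?c = "cofactor_form B ?e2 ?e2"
  show ?thesis
  proof (cases "?c = 0")
    case True
    moreover have "?e2 \<noteq> 0" by (simp add: vec_eq_iff forall_3)
    ultimately show ?thesis by blast
  next
    case False
    define t where "t = (- ?b + csqrt (?b ^ 2 - ?a * ?c)) / ?c"
    have "t * ?c + ?b = csqrt (?b ^ 2 - ?a * ?c)" using False by (simp add: t_def)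
    then have "(t * ?c + ?b) ^ 2 = ?b ^ 2 - ?a * ?c" by simp
    then have "?c * (t * t * ?c + 2 * t * ?b + ?a) = 0"
      by (simp add: power2_eq_square algebra_simps)
    then have "t * t * ?c + 2 * t * ?b + ?a = 0" using False by simp
    moreover have "cofactor_form B (?e1 + t *s ?e2) (?e1 + t *s ?e2) = t * t * ?c + 2 * t * ?b + ?a"
      by (simp add: cofactor_form_add_left cofactor_form_scale_left cofactor_form_add_right
          cofactor_form_scale_right cofactor_form_commute[of B ?e2 ?e1] algebra_simps)
    moreover have "(?e1 + t *s ?e2) $ 1 \<noteq> 0" by simp
    then have "?e1 + t *s ?e2 \<noteq> 0" by (metis zero_index)
    ultimately show ?thesis by metis
  qed
qed

text \<open>
  A hyperbolic pair \<open>e\<close>, \<open>f\<close> for the cofactor form, with \<open>cofactor_form B e f = - 2\<close>, and its bracket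
  \<open>h\<close> are the required triple: the rule for double brackets reads \<open>[h, e] = 2 e\<close> and \<open>[h, f] = - 2 f\<close>. The
  three vectors span because the Gram determinant of \<open>e\<close> and \<open>f\<close> is nonzero.
\<close>

lemma sl2_triple_exists:
  assumes B: "transpose B = (B :: complex^3^3)" "det B \<noteq> 0"
  obtains h e f where "B *v cross h e = 2 *s e" "B *v cross h f = (- 2) *s f" "B *v cross e f = h"
    "\<And>u. \<exists>a b c. u = a *s e + b *s f + c *s h"
proof -
  let ?k = "cofactor_form B"
  note lin = cofactor_form_add_left cofactor_form_scale_left cofactor_form_add_right cofactor_form_scale_right
  obtain e where e: "e \<noteq> 0" "?k e e = 0" using isotropic_vector by blast
  obtain w where w: "?k e w \<noteq> 0" using cofactor_form_nondegenerate[OF B e(1)] by blast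
  \<comment> \<open>Moving \<open>w\<close> along \<open>e\<close> makes it isotropic and keeps its pairing with \<open>e\<close>.\<close>
  define c where "c = - ?k w w / (2 * ?k e w)"
  define f where "f = (- 2 / ?k e w) *s (w + c *s e)"
  have "?k (w + c *s e) (w + c *s e) = ?k w w + 2 * c * ?k e w"
    using e(2) by (simp add: lin cofactor_form_commute[of B w e] algebra_simps)
  also have "\<dots> = 0" using w by (simp add: c_def)
  finally have ff: "?k f f = 0"
    unfolding f_def cofactor_form_scale_left cofactor_form_scale_right by simp
  have ef: "?k e f = - 2"
    unfolding f_def cofactor_form_add_right cofactor_form_scale_right using w e(2) by simp
  define h where "h = B *v cross e f"
  have anti: "B *v cross v w = - (B *v cross w v)" for v w
    by (simp add: vec_eq_iff forall_3 mult_vec_nth cross_nth algebra_simps)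
  have he: "B *v cross h e = 2 *s e"
    using double_bracket[OF B(1), of e e f] anti[of h e] by (simp add: h_def ef e(2))
  have hf: "B *v cross h f = (- 2) *s f"
    using double_bracket[OF B(1), of f e f] anti[of h f]
    by (simp add: h_def ef ff cofactor_form_commute[of B f e])
  have "det B * triple_form e f h = - 4"
    using gram_triple_form[OF B(1), of e f] by (simp add: h_def ef e(2) ff)
  then have D: "triple_form e f h \<noteq> 0" by auto
  have "\<exists>a b c. u = a *s e + b *s f + c *s h" for u
  proof -
    let ?D = "triple_form e f h"
    have "u = inverse ?D *s (?D *s u)" using D by (simp add: vector_smult_assoc)
    also have "\<dots> = (inverse ?D * triple_form u f h) *s e + (inverse ?D * triple_form e u h) *s f
        + (inverse ?D * triple_form e f u) *s h"
      unfolding triple_form_expand[of e f h u] by (simp add: vector_add_ldistrib vector_smult_assoc)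
    finally show ?thesis by blast
  qed
  with that he hf h_def show thesis by metis
qed

section \<open>Semi-invariants of vector fields that vanish at the origin\<close>

interpretation mfps_vs: complex_vector_space "\<lambda>c (w :: (complex, 'n::finite) mfps). mfps_const c * w"
  by standard (simp_all add: algebra_simps mfps_const_add mfps_const_mult)

definition mfps_hom_part :: "nat \<Rightarrow> ('a::comm_ring_1, 'n::finite) mfps \<Rightarrow> ('a, 'n) mfps" where
  "mfps_hom_part N g = Abs_mfps (\<lambda>m. if (\<Sum>i\<in>UNIV. m i) = N then mfps_nth g m else 0)"

lemma hom_part_add: "mfps_hom_part N (g + h) = mfps_hom_part N g + mfps_hom_part N h"
  and hom_part_diff: "mfps_hom_part N (g - h) = mfps_hom_part N g - mfps_hom_part N h"
  and hom_part_const_mult: "mfps_hom_part N (mfps_const c * g) = mfps_const c * mfps_hom_part N g"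
  for g h :: "('a::comm_ring_1, 'n::finite) mfps"
  by (rule mfps_eqI, simp add: mfps_hom_part_def)+

lemma hom_part_eq_0: "g \<in> mfps_order_ge (Suc N) \<Longrightarrow> mfps_hom_part N g = 0"
  by (rule mfps_eqI) (simp add: mfps_hom_part_def order_geD)

lemma diff_hom_part_order_ge: "g \<in> mfps_order_ge N \<Longrightarrow> g - mfps_hom_part N g \<in> mfps_order_ge (Suc N)"
  by (auto simp: mfps_order_ge_def mfps_hom_part_def)

definition mfps_hom :: "nat \<Rightarrow> ('a::comm_ring_1, 'n::finite) mfps set" where
  "mfps_hom N = {g. \<forall>m. mfps_nth g m \<noteq> 0 \<longrightarrow> (\<Sum>i\<in>UNIV. m i) = N}"

text \<open>
  The sums of a constant and a homogeneous polynomial of degree \<open>N\<close>.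
\<close>

definition mfps_const_hom :: "nat \<Rightarrow> ('a::comm_ring_1, 'n::finite) mfps set" where
  "mfps_const_hom N = {g. \<forall>m. mfps_nth g m \<noteq> 0 \<longrightarrow> m = 0 \<or> (\<Sum>i\<in>UNIV. m i) = N}"

lemma hom_subset: "mfps_hom N \<subseteq> mfps_const_hom N"
  by (auto simp: mfps_hom_def mfps_const_hom_def)

lemma hom_part_in_hom: "mfps_hom_part N g \<in> mfps_hom N"
  by (auto simp: mfps_hom_def mfps_hom_part_def split: if_splits)

lemma const_hom_unit:
  fixes g :: "('a::field, 'n::finite) mfps"
  assumes "g \<in> mfps_const_hom N" "g \<notin> mfps_hom N"
  shows "g dvd 1"
proof -
  from assms(2) obtain m where m: "mfps_nth g m \<noteq> 0" "(\<Sum>i\<in>UNIV. m i) \<noteq> N"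
    by (auto simp: mfps_hom_def)
  with assms(1) have "m = 0" unfolding mfps_const_hom_def by blast
  with m(1) show ?thesis by (simp only: mfps_unit_iff not_False_eq_True)
qed

lemma subspace_hom: "mfps_vs.subspace (mfps_hom N)"
  and subspace_const_hom: "mfps_vs.subspace (mfps_const_hom N)"
  by (rule mfps_vs.subspaceI; simp add: mfps_hom_def mfps_const_hom_def; metis add.right_neutral)+

lemma const_hom_finite_dim:
  "\<exists>B. finite B \<and> mfps_const_hom N \<subseteq> mfps_vs.span (B :: (complex, 'n::finite) mfps set)"
proof -
  let ?M = "{m :: 'n \<Rightarrow> nat. (\<Sum>i\<in>UNIV. m i) \<le> N}"
  let ?x = "\<lambda>m. Abs_mfps (\<lambda>k. if k = m then 1 else 0) :: (complex, 'n) mfps"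
  have "finite (Pi\<^sub>E (UNIV :: 'n set) (\<lambda>i. {..N}))"
    by (intro finite_PiE) auto
  moreover have "?M \<subseteq> Pi\<^sub>E UNIV (\<lambda>i. {..N})"
  proof
    fix m :: "'n \<Rightarrow> nat" assume "m \<in> ?M"
    then have "m i \<le> N" for i
      using member_le_sum[of i UNIV m] by auto
    then show "m \<in> Pi\<^sub>E UNIV (\<lambda>i. {..N})" by auto
  qed
  ultimately have fin: "finite ?M" by (rule finite_subset[rotated])
  have "g \<in> mfps_vs.span (?x ` ?M)" if "g \<in> mfps_const_hom N" for g
  proof -
    have "g = (\<Sum>m\<in>?M. mfps_const (mfps_nth g m) * ?x m)"
    proof (rule mfps_eqI)
      fix k
      have "k \<in> ?M" if "mfps_nth g k \<noteq> 0"
        using that \<open>g \<in> mfps_const_hom N\<close> by (auto simp: mfps_const_hom_def)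
      then show "mfps_nth g k = mfps_nth (\<Sum>m\<in>?M. mfps_const (mfps_nth g m) * ?x m) k"
        using fin by (auto simp: if_distrib cong: if_cong)
    qed
    also have "\<dots> \<in> mfps_vs.span (?x ` ?M)"
      by (intro mfps_vs.span_sum mfps_vs.span_scale mfps_vs.span_base) auto
    finally show ?thesis .
  qed
  then show ?thesis using fin by (intro exI[of _ "?x ` ?M"]) auto
qed

lemma bracket_add_right:
  "\<delta> \<in> Der \<Longrightarrow> vfield_bracket \<delta> (\<epsilon> + \<eta>) = vfield_bracket \<delta> \<epsilon> + vfield_bracket \<delta> \<eta>"
  by (simp add: vfield_bracket_def fun_eq_iff Der_add)

lemma bracket_scale_right:
  "\<delta> \<in> Der \<Longrightarrow> vfield_bracket \<delta> (vfield_scale a \<epsilon>)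
    = vfield_scale (\<delta> a) \<epsilon> + vfield_scale a (vfield_bracket \<delta> \<epsilon>)"
  by (simp add: vfield_bracket_def vfield_scale_def fun_eq_iff Der_mult algebra_simps)

lemma bracket_swap: "vfield_bracket \<delta> \<epsilon> = - vfield_bracket \<epsilon> \<delta>"
  by (simp add: vfield_bracket_def fun_eq_iff)

lemma bracket_add_left:
  "\<eta> \<in> Der \<Longrightarrow> vfield_bracket (\<delta> + \<epsilon>) \<eta> = vfield_bracket \<delta> \<eta> + vfield_bracket \<epsilon> \<eta>"
  by (simp add: vfield_bracket_def fun_eq_iff Der_add)

lemma bracket_const_right:
  "\<delta> \<in> Der \<Longrightarrow> vfield_bracket \<delta> (vfield_scale (mfps_const c) \<epsilon>) = vfield_scale (mfps_const c) (vfield_bracket \<delta> \<epsilon>)"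
  by (simp add: bracket_scale_right Der_const)

lemma bracket_const_left:
  "\<delta> \<in> Der \<Longrightarrow> vfield_bracket (vfield_scale (mfps_const c) \<epsilon>) \<delta> = vfield_scale (mfps_const c) (vfield_bracket \<epsilon> \<delta>)"
  by (simp add: bracket_swap[of _ \<delta>] bracket_const_right)

text \<open>
  The module \<open>D\<close> of logarithmic fields enters the argument only through these properties.
\<close>

locale singular_fields =
  fixes D :: "'n::finite vfield set"
  assumes subspace_D: "vfield.subspace D"
    and D_Der: "\<delta> \<in> D \<Longrightarrow> \<delta> \<in> Der"
    and D_bracket: "\<delta> \<in> D \<Longrightarrow> \<epsilon> \<in> D \<Longrightarrow> vfield_bracket \<delta> \<epsilon> \<in> D"
    and D_vanish: "\<delta> \<in> D \<Longrightarrow> \<delta> g \<in> mfps_order_ge 1"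
begin

abbreviation mD :: "'n vfield set" where
  "mD \<equiv> ideal_smult vfield_scale mfps_max_ideal D"

lemma mD_induct [consumes 1, case_names zero add]:
  assumes "\<delta> \<in> mD" and "P 0"
    and "\<And>a \<epsilon> \<eta>. a \<in> mfps_order_ge 1 \<Longrightarrow> \<epsilon> \<in> D \<Longrightarrow> \<eta> \<in> mD \<Longrightarrow> P \<eta> \<Longrightarrow> P (vfield_scale a \<epsilon> + \<eta>)"
  shows "P \<delta>"
proof -
  have "\<delta> \<in> mD \<and> P \<delta>"
    using assms(1) unfolding ideal_smult_def
  proof (induction rule: vfield.span_induct_alt)
    case base
    then show ?case using assms(2) vfield.span_zero by blast
  next
    case (step c x y)
    then obtain a s where x: "x = vfield_scale a s" "a \<in> mfps_max_ideal" "s \<in> D" by blast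
    then have cx: "vfield_scale c x = vfield_scale (c * a) s"
      by simp
    have "c * a \<in> mfps_order_ge 1"
      using x(2) unfolding order_ge_1_eq_max_ideal[symmetric] by (rule order_ge_mult_right)
    then have "P (vfield_scale c x + y)"
      unfolding cx using x(3) step by (intro assms(3)) (auto simp: ideal_smult_def)
    moreover have "vfield_scale c x + y \<in> mD"
      unfolding ideal_smult_def
      by (rule vfield.span_add[OF vfield.span_scale[OF vfield.span_base[OF step(1)]] conjunct1[OF step(2)]])
    ultimately show ?case unfolding ideal_smult_def by blast
  qed
  then show ?thesis ..
qed

lemma subspace_mD: "vfield.subspace mD"
  unfolding ideal_smult_def by (rule vfield.subspace_span)

lemma scale_in_mD: "a \<in> mfps_order_ge 1 \<Longrightarrow> \<delta> \<in> D \<Longrightarrow> vfield_scale a \<delta> \<in> mD"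
  unfolding ideal_smult_def order_ge_1_eq_max_ideal by (rule vfield.span_base) blast

lemma mD_subset: "\<delta> \<in> mD \<Longrightarrow> \<delta> \<in> D"
  by (induction rule: mD_induct)
    (blast intro: vfield.subspace_0 vfield.subspace_add vfield.subspace_scale subspace_D)+

text \<open>
  \<open>[\<delta>, a \<epsilon>] = \<delta>(a) \<epsilon> + a [\<delta>, \<epsilon>]\<close>, and \<open>\<delta>(a)\<close> lies in the maximal ideal as \<open>\<delta>\<close> vanishes at the origin.
\<close>

lemma bracket_mD:
  assumes "\<delta> \<in> D" "\<epsilon> \<in> mD"
  shows "vfield_bracket \<delta> \<epsilon> \<in> mD"
  using assms(2)
proof (induction rule: mD_induct)
  case zero
  have "vfield_bracket \<delta> 0 = 0"
    using D_Der[OF assms(1)] by (simp add: vfield_bracket_def fun_eq_iff Der_0)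
  then show ?case using vfield.subspace_0[OF subspace_mD] by (simp only:)
next
  case (add a \<epsilon> \<eta>)
  show ?case
    unfolding bracket_add_right[OF D_Der[OF assms(1)]] bracket_scale_right[OF D_Der[OF assms(1)]]
    by (rule vfield.subspace_add[OF subspace_mD vfield.subspace_add[OF subspace_mD
          scale_in_mD[OF D_vanish[OF assms(1)] add(2)] scale_in_mD[OF add(1) D_bracket[OF assms(1) add(2)]]] add(4)])
qed

definition semi_invariant :: "nat \<Rightarrow> (complex, 'n) mfps \<Rightarrow> bool" where
  "semi_invariant N g \<longleftrightarrow> (\<forall>\<delta>\<in>D. \<exists>a\<in>mfps_order_ge N. \<delta> g = a * g)"

text \<open>
  Representatives in \<open>D\<close> of vectors that span \<open>D / mD\<close> and satisfy the relations of \<open>sl(2)\<close>.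
\<close>

definition sl2_triple :: "'n vfield \<Rightarrow> 'n vfield \<Rightarrow> 'n vfield \<Rightarrow> bool" where
  "sl2_triple h e f \<longleftrightarrow> h \<in> D \<and> e \<in> D \<and> f \<in> D
     \<and> vfield_bracket h e - vfield_scale (mfps_const 2) e \<in> mD
     \<and> vfield_bracket h f - vfield_scale (mfps_const (- 2)) f \<in> mD
     \<and> vfield_bracket e f - h \<in> mD
     \<and> (\<forall>\<delta>\<in>D. \<exists>a b c. \<delta> - (vfield_scale (mfps_const a) e + vfield_scale (mfps_const b) f
          + vfield_scale (mfps_const c) h) \<in> mD)"

end

locale semi_invariant_series = singular_fields D
  for D :: "'n::finite vfield set" +
  fixes g :: "(complex, 'n) mfps" and N :: nat
  assumes g0: "g \<noteq> 0" and semi: "semi_invariant N g"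
begin

definition cofactor :: "'n vfield \<Rightarrow> (complex, 'n) mfps" where
  "cofactor \<delta> = (SOME a. \<delta> g = a * g)"

text \<open>
  The action of \<open>\<delta>\<close> on the module generated by \<open>g\<close>, transported to the ring along \<open>w \<mapsto> g w\<close>.
\<close>

definition twist :: "'n vfield \<Rightarrow> (complex, 'n) mfps \<Rightarrow> (complex, 'n) mfps" where
  "twist \<delta> w = \<delta> w + cofactor \<delta> * w"

lemma cofactor_eq: "\<delta> \<in> D \<Longrightarrow> \<delta> g = cofactor \<delta> * g"
  using semi unfolding semi_invariant_def cofactor_def by (metis (mono_tags, lifting) someI)

lemma cofactor_unique: "\<delta> \<in> D \<Longrightarrow> \<delta> g = a * g \<Longrightarrow> cofactor \<delta> = a"
  using cofactor_eq[of \<delta>] g0 by simp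

lemma cofactor_order: "\<delta> \<in> D \<Longrightarrow> cofactor \<delta> \<in> mfps_order_ge N"
  using semi cofactor_unique unfolding semi_invariant_def by metis

lemma twist_eq: "\<delta> \<in> D \<Longrightarrow> g * twist \<delta> w = \<delta> (g * w)"
  by (simp add: twist_def Der_mult[OF D_Der] cofactor_eq algebra_simps)

lemma twist_eqI: "g * u = g * v \<Longrightarrow> u = v"
  using g0 by simp

lemma twist_add_field:
  assumes "\<delta> \<in> D" "\<epsilon> \<in> D"
  shows "twist (\<delta> + \<epsilon>) w = twist \<delta> w + twist \<epsilon> w"
proof (rule twist_eqI)
  show "g * twist (\<delta> + \<epsilon>) w = g * (twist \<delta> w + twist \<epsilon> w)"
    by (simp only: twist_eq[OF vfield.subspace_add[OF subspace_D assms]] distrib_left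
        twist_eq[OF assms(1)] twist_eq[OF assms(2)] plus_fun_apply)
qed

lemma twist_scale_field:
  assumes "\<delta> \<in> D"
  shows "twist (vfield_scale a \<delta>) w = a * twist \<delta> w"
proof (rule twist_eqI)
  show "g * twist (vfield_scale a \<delta>) w = g * (a * twist \<delta> w)"
    by (simp only: twist_eq[OF vfield.subspace_scale[OF subspace_D assms]] mult.left_commute[of g]
        twist_eq[OF assms]) (simp only: vfield_scale_def)
qed

lemma twist_bracket:
  assumes "\<delta> \<in> D" "\<epsilon> \<in> D"
  shows "twist (vfield_bracket \<delta> \<epsilon>) w = twist \<delta> (twist \<epsilon> w) - twist \<epsilon> (twist \<delta> w)"
proof (rule twist_eqI)
  show "g * twist (vfield_bracket \<delta> \<epsilon>) w = g * (twist \<delta> (twist \<epsilon> w) - twist \<epsilon> (twist \<delta> w))"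
    by (simp only: twist_eq[OF D_bracket[OF assms]] right_diff_distrib twist_eq[OF assms(1)]
        twist_eq[OF assms(2)]) (simp only: vfield_bracket_def)
qed

lemma twist_add: "\<delta> \<in> D \<Longrightarrow> twist \<delta> (v + w) = twist \<delta> v + twist \<delta> w"
  and twist_diff: "\<delta> \<in> D \<Longrightarrow> twist \<delta> (v - w) = twist \<delta> v - twist \<delta> w"
  and twist_const_mult: "\<delta> \<in> D \<Longrightarrow> twist \<delta> (mfps_const c * w) = mfps_const c * twist \<delta> w"
  by (simp_all add: twist_def Der_add[OF D_Der] Der_diff[OF D_Der] Der_const_mult[OF D_Der] distrib_left
      right_diff_distrib mult.left_commute)

lemma twist_order:
  assumes "\<delta> \<in> D" "w \<in> mfps_order_ge K"
  shows "twist \<delta> w \<in> mfps_order_ge K"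
  unfolding twist_def
  by (rule order_ge_add[OF Der_order_ge[OF D_Der[OF assms(1)] D_vanish[OF assms(1)] assms(2)]
        order_ge_mult_right[OF assms(2)]])

text \<open>
  The constant term of \<open>w\<close> is killed by \<open>\<delta>\<close> and contributes only through the cofactor.
\<close>

lemma twist_const_hom:
  assumes "\<delta> \<in> D" "w \<in> mfps_const_hom N"
  shows "twist \<delta> w \<in> mfps_order_ge N"
proof -
  let ?w = "w - mfps_const (mfps_nth w 0)"
  have "?w \<in> mfps_order_ge N"
    using assms(2) by (auto simp: mfps_order_ge_def mfps_const_hom_def mfps_nth_const)
  then have "\<delta> ?w \<in> mfps_order_ge N"
    by (rule Der_order_ge[OF D_Der[OF assms(1)] D_vanish[OF assms(1)]])
  then have "\<delta> w \<in> mfps_order_ge N"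
    by (simp add: Der_diff Der_const D_Der assms(1))
  then show ?thesis
    unfolding twist_def using cofactor_order[OF assms(1)] by (rule order_ge_add[OF _ order_ge_mult_left])
qed

lemma twist_mD:
  assumes "\<delta> \<in> mD" "w \<in> mfps_const_hom N"
  shows "twist \<delta> w \<in> mfps_order_ge (Suc N)"
  using assms(1)
proof (induction rule: mD_induct)
  case zero
  have "g * twist 0 w = 0"
    by (simp only: twist_eq[OF vfield.subspace_0[OF subspace_D]] zero_fun_apply)
  then have "twist 0 w = 0" using g0 by simp
  then show ?case by (simp only: order_ge_zero)
next
  case (add a \<epsilon> \<eta>)
  have "a * twist \<epsilon> w \<in> mfps_order_ge (1 + N)"
    by (rule order_ge_mult[OF add(1) twist_const_hom[OF add(2) assms(2)]])
  then have "a * twist \<epsilon> w + twist \<eta> w \<in> mfps_order_ge (Suc N)"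
    using add(4) by (simp add: order_ge_add)
  then show ?case
    by (simp only: twist_add_field[OF vfield.subspace_scale[OF subspace_D add(2)] mD_subset[OF add(3)]]
        twist_scale_field[OF add(2)])
qed

text \<open>
  On the sums of a constant and a form of degree \<open>N\<close>, the fields in \<open>mD\<close> act as zero, so that the Lie
  algebra \<open>D / mD\<close> acts there.
\<close>

definition graded_twist :: "'n vfield \<Rightarrow> (complex, 'n) mfps \<Rightarrow> (complex, 'n) mfps" where
  "graded_twist \<delta> w = mfps_hom_part N (twist \<delta> w)"

lemma graded_twist_hom: "graded_twist \<delta> w \<in> mfps_hom N"
  by (simp add: graded_twist_def hom_part_in_hom)

lemma graded_twist_bracket:
  assumes "\<delta> \<in> D" "\<epsilon> \<in> D" "w \<in> mfps_const_hom N"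
  shows "graded_twist \<delta> (graded_twist \<epsilon> w) - graded_twist \<epsilon> (graded_twist \<delta> w)
    = graded_twist (vfield_bracket \<delta> \<epsilon>) w"
proof -
  have "graded_twist \<delta> (graded_twist \<epsilon> w) = mfps_hom_part N (twist \<delta> (twist \<epsilon> w))"
    if "\<delta> \<in> D" "\<epsilon> \<in> D" for \<delta> \<epsilon>
  proof -
    have "twist \<epsilon> w - graded_twist \<epsilon> w \<in> mfps_order_ge (Suc N)"
      unfolding graded_twist_def by (intro diff_hom_part_order_ge twist_const_hom that assms)
    then have "mfps_hom_part N (twist \<delta> (twist \<epsilon> w - graded_twist \<epsilon> w)) = 0"
      by (intro hom_part_eq_0 twist_order that)
    then show ?thesis
      by (simp add: twist_diff[OF that(1)] hom_part_diff graded_twist_def[of \<delta>])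
  qed
  then show ?thesis
    using assms by (simp add: graded_twist_def[of "vfield_bracket \<delta> \<epsilon>"] twist_bracket hom_part_diff)
qed

lemma graded_twist_cong:
  assumes "\<delta> \<in> D" "\<epsilon> \<in> D" "\<delta> - \<epsilon> \<in> mD" "w \<in> mfps_const_hom N"
  shows "graded_twist \<delta> w = graded_twist \<epsilon> w"
proof -
  have "twist \<delta> w = twist \<epsilon> w + twist (\<delta> - \<epsilon>) w"
    using twist_add_field[of \<epsilon> "\<delta> - \<epsilon>" w] mD_subset[OF assms(3)] assms by simp
  then show ?thesis
    using hom_part_eq_0[OF twist_mD[OF assms(3,4)]] by (simp add: graded_twist_def hom_part_add)
qed

lemma graded_twist_const_scale:
  "\<delta> \<in> D \<Longrightarrow> graded_twist (vfield_scale (mfps_const c) \<delta>) w = mfps_const c * graded_twist \<delta> w"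
  by (simp add: graded_twist_def twist_scale_field hom_part_const_mult)

lemma graded_twist_add_field:
  "\<delta> \<in> D \<Longrightarrow> \<epsilon> \<in> D \<Longrightarrow> graded_twist (\<delta> + \<epsilon>) w = graded_twist \<delta> w + graded_twist \<epsilon> w"
  by (simp add: graded_twist_def twist_add_field hom_part_add)

text \<open>
  A sum of a nonzero constant and a form of degree \<open>N\<close> that is killed by the graded action is the factor
  that raises the order of all cofactors.
\<close>

lemma improve_semi_invariant:
  assumes N: "N > 0" and triple: "sl2_triple h e f"
  shows "\<exists>w. w dvd 1 \<and> semi_invariant (Suc N) (w * g)"
proof -
  have D: "h \<in> D" "e \<in> D" "f \<in> D"
    and rel: "vfield_bracket h e - vfield_scale (mfps_const 2) e \<in> mD"
      "vfield_bracket h f - vfield_scale (mfps_const (- 2)) f \<in> mD"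
      "vfield_bracket e f - h \<in> mD"
    and span: "\<And>\<delta>. \<delta> \<in> D \<Longrightarrow> \<exists>a b c. \<delta> - (vfield_scale (mfps_const a) e + vfield_scale (mfps_const b) f
          + vfield_scale (mfps_const c) h) \<in> mD"
    using triple by (auto simp: sl2_triple_def)
  note cD = vfield.subspace_scale[OF subspace_D] and aD = vfield.subspace_add[OF subspace_D]
  obtain B :: "(complex, 'n) mfps set" where B: "finite B" "mfps_const_hom N \<subseteq> mfps_vs.span B"
    using const_hom_finite_dim by blast
  interpret rep: sl2_rep "\<lambda>c w. mfps_const c * w" "mfps_const_hom N" B
    "graded_twist h" "graded_twist e" "graded_twist f"
  proof (rule sl2_rep.intro[OF mfps_vs.complex_vector_space_axioms sl2_rep_axioms.intro])
    show "mfps_vs.lin (graded_twist h)" "mfps_vs.lin (graded_twist e)" "mfps_vs.lin (graded_twist f)"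
      by (rule mfps_vs.linI; use D in \<open>simp add: graded_twist_def twist_add twist_const_mult hom_part_add hom_part_const_mult\<close>)+
  next
    fix v :: "(complex, 'n) mfps"
    assume v: "v \<in> mfps_const_hom N"
    show "graded_twist h v \<in> mfps_const_hom N" "graded_twist e v \<in> mfps_const_hom N"
      "graded_twist f v \<in> mfps_const_hom N"
      using graded_twist_hom hom_subset by blast+
    show "graded_twist h (graded_twist e v) - graded_twist e (graded_twist h v) = mfps_const 2 * graded_twist e v"
      using graded_twist_bracket[OF D(1,2) v] graded_twist_cong[OF D_bracket[OF D(1,2)] cD[OF D(2)] rel(1) v]
      by (simp add: graded_twist_const_scale D)
    show "graded_twist h (graded_twist f v) - graded_twist f (graded_twist h v) = - (mfps_const 2 * graded_twist f v)"
      using graded_twist_bracket[OF D(1,3) v] graded_twist_cong[OF D_bracket[OF D(1,3)] cD[OF D(3)] rel(2) v]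
      by (simp only: graded_twist_const_scale[OF D(3)]) (simp only: mfps_const_uminus mult_minus_left)
    show "graded_twist e (graded_twist f v) - graded_twist f (graded_twist e v) = graded_twist h v"
      using graded_twist_bracket[OF D(2,3) v] graded_twist_cong[OF D_bracket[OF D(2,3)] D(1) rel(3) v]
      by simp
  qed (use B subspace_const_hom in auto)
  have one: "1 \<in> (mfps_const_hom N :: (complex, 'n) mfps set)" "1 \<notin> (mfps_hom N :: (complex, 'n) mfps set)"
  proof -
    show "1 \<in> (mfps_const_hom N :: (complex, 'n) mfps set)"
      by (simp add: mfps_const_hom_def mfps_nth_one)
    have "mfps_nth (1 :: (complex, 'n) mfps) 0 \<noteq> 0" "(\<Sum>i\<in>UNIV. (0 :: 'n \<Rightarrow> nat) i) \<noteq> N"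
      using N by (simp_all add: mfps_nth_one)
    then show "1 \<notin> (mfps_hom N :: (complex, 'n) mfps set)"
      unfolding mfps_hom_def by blast
  qed
  obtain w where w: "w \<in> mfps_const_hom N" "w \<notin> mfps_hom N"
    and kill: "graded_twist h w = 0" "graded_twist e w = 0" "graded_twist f w = 0"
    using rep.invariant_vector_outside[OF subspace_hom hom_subset graded_twist_hom graded_twist_hom graded_twist_hom one]
    by blast
  have w1: "w dvd 1" by (rule const_hom_unit[OF w])
  then obtain w' where w': "w * w' = 1" by (metis dvdE)
  have "\<exists>a\<in>mfps_order_ge (Suc N). \<delta> (w * g) = a * (w * g)" if dD: "\<delta> \<in> D" for \<delta>
  proof
    obtain a b c where abc: "\<delta> - (vfield_scale (mfps_const a) e + vfield_scale (mfps_const b) f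
          + vfield_scale (mfps_const c) h) \<in> mD" using span[OF dD] by blast
    have "graded_twist \<delta> w = 0"
      using graded_twist_cong[OF that _ abc w(1)]
      by (simp add: graded_twist_add_field graded_twist_const_scale D cD aD kill)
    then have "twist \<delta> w \<in> mfps_order_ge (Suc N)"
      using diff_hom_part_order_ge[OF twist_const_hom[OF that w(1)]] by (simp add: graded_twist_def)
    then show "w' * twist \<delta> w \<in> mfps_order_ge (Suc N)"
      by (rule order_ge_mult_right)
    have "w' * twist \<delta> w * (w * g) = (w * w') * (g * twist \<delta> w)" by (simp only: mult_ac)
    also have "\<dots> = \<delta> (w * g)" by (simp only: w' mult_1 twist_eq[OF that] mult.commute[of w g])
    finally show "\<delta> (w * g) = w' * twist \<delta> w * (w * g)" by simp
  qed
  with w1 show ?thesis unfolding semi_invariant_def by blast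
qed

end

context singular_fields
begin

text \<open>
  The induction starts at order 1: the constant terms of the cofactors define a linear form on \<open>D / mD\<close>
  that vanishes on brackets, and \<open>e\<close>, \<open>f\<close>, \<open>h\<close> are multiples of brackets.
\<close>

lemma semi_invariant_of_order:
  assumes triple: "sl2_triple h e f" and g: "g \<noteq> 0" "semi_invariant 0 g"
  shows "\<exists>w. w dvd 1 \<and> semi_invariant (Suc N) (w * g)"
proof (induction N)
  case 0
  interpret semi_invariant_series D g 0
    by standard (use g in auto)
  have D: "h \<in> D" "e \<in> D" "f \<in> D"
    and rel: "vfield_bracket h e - vfield_scale (mfps_const 2) e \<in> mD"
      "vfield_bracket h f - vfield_scale (mfps_const (- 2)) f \<in> mD"
      "vfield_bracket e f - h \<in> mD"
    and span: "\<And>\<delta>. \<delta> \<in> D \<Longrightarrow> \<exists>a b c. \<delta> - (vfield_scale (mfps_const a) e + vfield_scale (mfps_const b) f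
          + vfield_scale (mfps_const c) h) \<in> mD"
    using triple by (auto simp: sl2_triple_def)
  note cD = vfield.subspace_scale[OF subspace_D] and aD = vfield.subspace_add[OF subspace_D]
  have one: "1 \<in> (mfps_const_hom 0 :: (complex, 'n) mfps set)"
    by (simp add: mfps_const_hom_def mfps_nth_one)
  have tw0: "twist \<delta> 1 \<in> mfps_order_ge 1" if "\<delta> \<in> mD" for \<delta>
    using twist_mD[OF that one] by simp
  have twb: "twist (vfield_bracket \<delta> \<epsilon>) 1 \<in> mfps_order_ge 1" if "\<delta> \<in> D" "\<epsilon> \<in> D" for \<delta> \<epsilon>
  proof -
    have "twist \<delta> 1 = cofactor \<delta>" if "\<delta> \<in> D" for \<delta>
      using Der_const[OF D_Der[OF that], of 1] by (simp add: twist_def)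
    then have "twist (vfield_bracket \<delta> \<epsilon>) 1 = \<delta> (cofactor \<epsilon>) - \<epsilon> (cofactor \<delta>)"
      using that by (simp add: twist_bracket) (simp add: twist_def mult.commute)
    then show ?thesis using that by (simp add: order_ge_diff D_vanish del: One_nat_def)
  qed
  have cong: "twist \<delta> 1 \<in> mfps_order_ge 1"
    if "\<epsilon> - \<delta> \<in> mD" "\<epsilon> \<in> D" "\<delta> \<in> D" "twist \<epsilon> 1 \<in> mfps_order_ge 1" for \<delta> \<epsilon>
  proof -
    have "twist \<epsilon> 1 = twist \<delta> 1 + twist (\<epsilon> - \<delta>) 1"
      using twist_add_field[of \<delta> "\<epsilon> - \<delta>" 1] mD_subset[OF that(1)] that by simp
    then have "twist \<delta> 1 = twist \<epsilon> 1 - twist (\<epsilon> - \<delta>) 1" by simp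
    then show ?thesis using order_ge_diff[OF that(4) tw0[OF that(1)]] by simp
  qed
  have cancel: "x \<in> mfps_order_ge 1" if "mfps_const c * x \<in> mfps_order_ge 1" "c \<noteq> 0"
    for c and x :: "(complex, 'n) mfps"
    using that by (auto simp: mfps_order_ge_def)
  have "twist h 1 \<in> mfps_order_ge 1"
    by (rule cong[OF rel(3) D_bracket[OF D(2,3)] D(1) twb[OF D(2,3)]])
  moreover have "twist e 1 \<in> mfps_order_ge 1"
  proof (rule cancel)
    show "mfps_const (2) * twist e 1 \<in> mfps_order_ge 1"
      using cong[OF rel(1) D_bracket[OF D(1,2)] cD[OF D(2)] twb[OF D(1,2)]]
      by (simp only: twist_scale_field[OF D(2)])
  qed simp
  moreover have "twist f 1 \<in> mfps_order_ge 1"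
  proof (rule cancel)
    show "mfps_const (- 2) * twist f 1 \<in> mfps_order_ge 1"
      using cong[OF rel(2) D_bracket[OF D(1,3)] cD[OF D(3)] twb[OF D(1,3)]]
      by (simp only: twist_scale_field[OF D(3)])
  qed simp
  ultimately have tw: "twist \<delta> 1 \<in> mfps_order_ge 1" if dD: "\<delta> \<in> D" for \<delta>
  proof -
    obtain a b c where abc: "\<delta> - (vfield_scale (mfps_const a) e + vfield_scale (mfps_const b) f
          + vfield_scale (mfps_const c) h) \<in> mD" using span[OF dD] by blast
    let ?x = "vfield_scale (mfps_const a) e + vfield_scale (mfps_const b) f + vfield_scale (mfps_const c) h"
    have "?x \<in> D" by (intro aD cD D)
    moreover have "twist ?x 1 \<in> mfps_order_ge 1"
      using \<open>twist h 1 \<in> mfps_order_ge 1\<close> \<open>twist e 1 \<in> mfps_order_ge 1\<close> \<open>twist f 1 \<in> mfps_order_ge 1\<close>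
      by (simp only: twist_add_field twist_scale_field D cD aD order_ge_add order_ge_mult_right)
    moreover have "?x - \<delta> \<in> mD"
      using vfield.subspace_neg[OF subspace_mD abc] by simp
    ultimately show ?thesis using cong that by blast
  qed
  have "semi_invariant 1 g"
    unfolding semi_invariant_def
  proof
    \<comment> \<open>The twisted action of \<open>\<delta>\<close> maps 1 to the cofactor of \<open>\<delta>\<close>.\<close>
    fix \<delta> assume "\<delta> \<in> D"
    then have "cofactor \<delta> \<in> mfps_order_ge 1"
      using tw[of \<delta>] Der_const[OF D_Der, of \<delta> 1] by (simp add: twist_def)
    then show "\<exists>a\<in>mfps_order_ge 1. \<delta> g = a * g"
      using cofactor_eq[OF \<open>\<delta> \<in> D\<close>] by blast
  qed
  then show ?case by (intro exI[of _ 1]) simp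
next
  case (Suc N)
  then obtain w where w: "w dvd 1" "semi_invariant (Suc N) (w * g)" by blast
  then have "w \<noteq> 0" by auto
  interpret semi_invariant_series D "w * g" "Suc N"
    by standard (use g \<open>w \<noteq> 0\<close> w in auto)
  obtain v where "v dvd 1" "semi_invariant (Suc (Suc N)) (v * (w * g))"
    using improve_semi_invariant[OF _ triple] by auto
  then show ?case using mult_dvd_mono[of v 1 w 1] w(1) by (intro exI[of _ "v * w"]) (simp add: mult.assoc)
qed

end

section \<open>Free series that are not products\<close>

lemma order_ge_if_derivs:
  fixes g :: "('a::field_char_0, 'n::finite) mfps"
  assumes "\<And>j. mfps_deriv j g \<in> mfps_order_ge N" and "mfps_nth g 0 = 0"
  shows "g \<in> mfps_order_ge (Suc N)"
proof -
  have "mfps_nth g m = 0" if m: "(\<Sum>i\<in>UNIV. m i) < Suc N" for m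
  proof (cases "m = 0")
    case True
    then show ?thesis using assms(2) by simp
  next
    case False
    then obtain j where j: "m j > 0" by (auto simp: fun_eq_iff)
    let ?m = "m(j := m j - 1)"
    have "(\<Sum>i\<in>UNIV. ?m i) = m j - 1 + (\<Sum>i\<in>UNIV - {j}. m i)"
      by (subst sum.remove[of UNIV j]) auto
    moreover have "(\<Sum>i\<in>UNIV. m i) = m j + (\<Sum>i\<in>UNIV - {j}. m i)"
      by (rule sum.remove) auto
    ultimately have "(\<Sum>i\<in>UNIV. ?m i) < N" using m j by linarith
    then have "mfps_nth (mfps_deriv j g) ?m = 0"
      by (rule order_geD[OF assms(1)])
    moreover have "mfps_nth (mfps_deriv j g) ?m = of_nat (m j) * mfps_nth g m"
      using j by (simp add: mfps_nth_deriv)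
    ultimately show ?thesis using j by simp
  qed
  then show ?thesis by (simp add: mfps_order_ge_def)
qed

lemma det_column_order_ge:
  fixes M :: "('a::comm_ring_1, 'n::finite) mfps ^ 'm ^ 'm"
  assumes "\<And>i. a i \<in> mfps_order_ge N"
  shows "det (\<chi> i j. if j = k then a i else M $ i $ j) \<in> mfps_order_ge N"
  unfolding det_def
proof (rule order_ge_sum, rule order_ge_mult_right)
  fix p assume "p \<in> {p. p permutes (UNIV :: 'm set)}"
  then obtain i where i: "p i = k" by (metis mem_Collect_eq permutes_surj surjD)
  let ?A = "\<chi> i j. if j = k then a i else M $ i $ j"
  have "(\<Prod>i\<in>UNIV. ?A $ i $ p i) = a i * (\<Prod>i\<in>UNIV - {i}. ?A $ i $ p i)"
    by (subst prod.remove[of UNIV i]) (simp_all add: i)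
  then show "(\<Prod>i\<in>UNIV. ?A $ i $ p i) \<in> mfps_order_ge N"
    using order_ge_mult_left[OF assms] by simp
qed

lemma ideal_smult_vanish:
  assumes "\<delta> \<in> ideal_smult vfield_scale mfps_max_ideal A"
  shows "\<delta> g \<in> mfps_order_ge 1"
  using assms unfolding ideal_smult_def
proof (induction rule: vfield.span_induct_alt)
  case base
  then show ?case by simp
next
  case (step c x y)
  then obtain a s where "x = vfield_scale a s" "a \<in> mfps_order_ge 1"
    unfolding order_ge_1_eq_max_ideal by blast
  then have "vfield_scale c x g \<in> mfps_order_ge 1"
    by (simp add: vfield_scale_def order_ge_mult_left order_ge_mult_right del: One_nat_def)
  with step show ?case by (simp add: order_ge_add del: One_nat_def)
qed

lemma not_product_singular_fields:
  fixes f :: "(complex, 'n::finite) mfps"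
  assumes "\<not> is_product f"
  shows "singular_fields (Der_log f)"
proof
  show "vfield.subspace (Der_log f)" by (rule Der_log_subspace)
  show "\<delta> g \<in> mfps_order_ge 1" if "\<delta> \<in> Der_log f" for \<delta> g
    using assms that unfolding is_product_def by (blast intro: ideal_smult_vanish)
  show "\<delta> \<in> Der" if "\<delta> \<in> Der_log f" for \<delta>
    using that by (simp add: Der_log_def)
qed (rule bracket_Der_log)

text \<open>
  If \<open>f\<close> is a unit, all derivations are logarithmic, but partial derivatives do not vanish at the origin.
\<close>

lemma not_product_not_unit:
  fixes f :: "(complex, 'n::finite) mfps"
  assumes "\<not> is_product f"
  shows "mfps_nth f 0 = 0"
proof (rule ccontr)
  interpret singular_fields "Der_log f" by (rule not_product_singular_fields[OF assms])
  fix j :: 'n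
  assume "mfps_nth f 0 \<noteq> 0"
  then have "f dvd 1" by (simp add: mfps_unit_iff)
  then have "f dvd mfps_deriv j f" using dvd_trans one_dvd by blast
  then have "mfps_deriv j \<in> Der_log f" by (simp add: Der_log_def mfps_deriv_Der)
  from D_vanish[OF this, of "mfps_X j"] have "mfps_nth (1 :: (complex, 'n) mfps) 0 = 0"
    unfolding order_ge_1_iff mfps_deriv_X by simp
  then show False by (simp add: mfps_nth_one)
qed

text \<open>
  Let \<open>g\<close> be a unit multiple of \<open>f\<close> such that \<open>\<delta>_i g = a_i g\<close> with \<open>a_i\<close> of order at least \<open>N + 1\<close>. By
  Cramer's rule a partial derivative of \<open>g\<close> times \<open>det(\<delta>_i(x_j))\<close> is \<open>g\<close> times a determinant with the
  column \<open>a_i\<close>. As \<open>det(\<delta>_i(x_j))\<close> is a unit times \<open>g\<close>, the factor \<open>g\<close> cancels, and the gradient of \<open>g\<close>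
  has order at least \<open>N + 1\<close>. The argument works for all \<open>N\<close>, so \<open>f\<close> would be zero.
\<close>

lemma free_no_sl2_triple:
  fixes f :: "(complex, 'n::finite) mfps"
  assumes free: "is_free f" and prod: "\<not> is_product f"
  shows "\<not> singular_fields.sl2_triple (Der_log f) h e k"
proof
  interpret singular_fields "Der_log f" by (rule not_product_singular_fields[OF prod])
  assume triple: "sl2_triple h e k"
  from free obtain \<delta> :: "'n \<Rightarrow> 'n vfield" and u where
    f: "f \<noteq> 0" and \<delta>: "\<And>i. \<delta> i \<in> Der_log f" and u: "u dvd 1" "det (\<chi> i j. \<delta> i (mfps_X j)) = u * f"
    unfolding is_free_def by blast
  have "semi_invariant 0 f"
    unfolding semi_invariant_def by (auto simp: Der_log_def mult.commute elim!: dvdE)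
  note step = semi_invariant_of_order[OF triple f this]
  have "f \<in> mfps_order_ge (Suc N)" for N
  proof -
    obtain v where v: "v dvd 1" "semi_invariant (Suc N) (v * f)" using step by blast
    define g where "g = v * f"
    obtain v' where v': "v * v' = 1" using v(1) by (metis dvdE)
    obtain u' where u': "u * u' = 1" using u(1) by (metis dvdE)
    have fg: "f = v' * g"
    proof -
      have "v' * g = (v * v') * f" by (simp only: g_def mult_ac)
      then show ?thesis by (simp add: v')
    qed
    have g0: "g \<noteq> 0" using f fg by auto
    have "\<forall>i. \<exists>a. a \<in> mfps_order_ge (Suc N) \<and> \<delta> i g = a * g"
      using v(2) \<delta> unfolding semi_invariant_def g_def by blast
    from choice[OF this] obtain a where a: "\<And>i. a i \<in> mfps_order_ge (Suc N)" "\<And>i. \<delta> i g = a i * g"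
      by blast
    have der: "mfps_deriv k g \<in> mfps_order_ge (Suc N)" for k
    proof -
      let ?M = "\<chi> i j. \<delta> i (mfps_X j)"
      let ?d = "det (\<chi> i j. if j = k then a i else ?M $ i $ j)"
      have "mfps_deriv k g * det ?M = det (\<chi> i j. if j = k then \<delta> i g else \<delta> i (mfps_X j))"
        using \<delta> by (intro det_log_mult_deriv) (simp add: Der_log_def)
      also have "(\<chi> i j. if j = k then \<delta> i g else \<delta> i (mfps_X j))
          = transpose (\<chi> j. if j = k then g *s (\<chi> i. a i) else transpose ?M $ j)"
        by (simp add: vec_eq_iff transpose_def a(2) mult.commute)
      also have "det \<dots> = g * det (\<chi> j. if j = k then (\<chi> i. a i) else transpose ?M $ j)"
        unfolding det_transpose by (rule det_row_mul)
      also have "(\<chi> j. if j = k then (\<chi> i. a i) else transpose ?M $ j)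
          = transpose (\<chi> i j. if j = k then a i else ?M $ i $ j)"
        by (simp add: vec_eq_iff transpose_def)
      also have "det \<dots> = ?d" by (rule det_transpose)
      finally have "g * (mfps_deriv k g * u * v') = g * ?d"
        unfolding u(2) fg by (simp only: mult_ac)
      then have d: "mfps_deriv k g * u * v' = ?d" using g0 by simp
      have "mfps_deriv k g = (u * u') * (v * v') * mfps_deriv k g"
        by (simp add: u' v')
      also have "\<dots> = u' * v * (mfps_deriv k g * u * v')" by (simp only: mult_ac)
      also have "\<dots> = u' * v * ?d" by (simp only: d)
      also have "\<dots> \<in> mfps_order_ge (Suc N)"
        by (intro order_ge_mult_right det_column_order_ge a)
      finally show ?thesis .
    qed
    have "mfps_nth g 0 = 0"
      using not_product_not_unit[OF prod] by (simp add: g_def mfps_nth_mult_0)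
    from order_ge_if_derivs[OF der this] have "g \<in> mfps_order_ge (Suc N)"
      using order_ge_mono[of "Suc N" "Suc (Suc N)"] by auto
    then show ?thesis unfolding fg by (rule order_ge_mult_right)
  qed
  then have "f \<in> mfps_order_ge N" for N
    using order_ge_mono[of N "Suc N"] by auto
  then have "f = 0" by (rule zero_if_all_orders)
  with f show False by contradiction
qed

context singular_fields
begin

definition const_comb :: "(3 \<Rightarrow> 'n vfield) \<Rightarrow> complex^3 \<Rightarrow> 'n vfield" where
  "const_comb x v = (\<Sum>i\<in>UNIV. vfield_scale (mfps_const (v $ i)) (x i))"

text \<open>
  The brackets are indexed as in the cross product, so that bracketing two combinations of the \<open>x i\<close>
  gives the combination of these brackets with the cross product as its coefficients.
\<close>

definition cyclic_brackets :: "(3 \<Rightarrow> 'n vfield) \<Rightarrow> 3 \<Rightarrow> 'n vfield" where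
  "cyclic_brackets x i = (if i = 1 then vfield_bracket (x 2) (x 3)
     else if i = 2 then vfield_bracket (x 3) (x 1) else vfield_bracket (x 1) (x 2))"

lemma const_comb_add: "const_comb x (v + w) = const_comb x v + const_comb x w"
  by (simp add: const_comb_def mfps_const_add vfield.scale_left_distrib sum.distrib)

lemma const_comb_scale: "const_comb x (c *s v) = vfield_scale (mfps_const c) (const_comb x v)"
  by (simp add: const_comb_def mfps_const_mult vfield.scale_sum_right)

lemma const_comb_in_D: "(\<And>i. x i \<in> D) \<Longrightarrow> const_comb x v \<in> D"
  unfolding const_comb_def by (intro vfield.subspace_sum[OF subspace_D] vfield.subspace_scale[OF subspace_D])

lemma bracket_const_comb:
  assumes "\<And>i. x i \<in> D"
  shows "vfield_bracket (const_comb x v) (const_comb x w) = const_comb (cyclic_brackets x) (cross v w)"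
proof -
  have D: "x i \<in> Der" for i using assms D_Der by blast
  have cc: "const_comb x v g = mfps_const (v$1) * x 1 g + mfps_const (v$2) * x 2 g + mfps_const (v$3) * x 3 g"
    for x v g
    by (simp add: const_comb_def sum_3 vfield_scale_def)
  show ?thesis
  proof
    fix g
    let ?y = "\<lambda>i j. x i (x j g)"
    have xx: "x i (const_comb x w g) = mfps_const (w$1) * ?y i 1 + mfps_const (w$2) * ?y i 2 + mfps_const (w$3) * ?y i 3"
      for i w
      by (simp only: cc Der_add[OF D] Der_const_mult[OF D])
    have y: "cyclic_brackets x 1 g = ?y 2 3 - ?y 3 2" "cyclic_brackets x 2 g = ?y 3 1 - ?y 1 3"
      "cyclic_brackets x 3 g = ?y 1 2 - ?y 2 1"
      by (simp_all add: cyclic_brackets_def vfield_bracket_def)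
    show "vfield_bracket (const_comb x v) (const_comb x w) g = const_comb (cyclic_brackets x) (cross v w) g"
      unfolding vfield_bracket_def cc[of x v] cc[of x w] cc[of "cyclic_brackets x"] xx[unfolded cc]
        y cross_nth mfps_const_diff mfps_const_mult
      by (simp only: algebra_simps)
  qed
qed

end

section \<open>Subspaces that bound the derived series\<close>

abbreviation const_scale :: "complex \<Rightarrow> 'n::finite vfield \<Rightarrow> 'n vfield" where
  "const_scale c \<equiv> vfield_scale (mfps_const c)"

context singular_fields
begin

lemmas mD_add = vfield.subspace_add[OF subspace_mD]
  and mD_diff = vfield.subspace_diff[OF subspace_mD]
  and mD_scale = vfield.subspace_scale[OF subspace_mD]
  and mD_zero = vfield.subspace_0[OF subspace_mD]

lemma mD_trans: "\<delta> - \<epsilon> \<in> mD \<Longrightarrow> \<epsilon> - \<eta> \<in> mD \<Longrightarrow> \<delta> - \<eta> \<in> mD"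
  using mD_add[of "\<delta> - \<epsilon>" "\<epsilon> - \<eta>"] by (simp only: diff_add_cancel add_diff_eq)

lemma bracket_cong_mD:
  assumes "\<delta> \<in> D" "\<epsilon> \<in> D" "\<delta>' \<in> D" "\<epsilon>' \<in> D" "\<delta> - \<delta>' \<in> mD" "\<epsilon> - \<epsilon>' \<in> mD"
  shows "vfield_bracket \<delta> \<epsilon> - vfield_bracket \<delta>' \<epsilon>' \<in> mD"
proof -
  have "vfield_bracket \<delta> \<epsilon> - vfield_bracket \<delta>' \<epsilon>' = vfield_bracket \<delta> (\<epsilon> - \<epsilon>') - vfield_bracket \<epsilon>' (\<delta> - \<delta>')"
    using D_Der[OF assms(1)] D_Der[OF assms(4)]
    by (simp add: fun_eq_iff vfield_bracket_def Der_diff)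
  then show ?thesis using bracket_mD mD_diff assms by simp
qed

lemma cyclic_brackets_in_D: "(\<And>i. x i \<in> D) \<Longrightarrow> cyclic_brackets x i \<in> D"
  by (simp add: cyclic_brackets_def D_bracket)

lemma const_comb_sum: "const_comb x (\<Sum>i\<in>A. v i) = (\<Sum>i\<in>A. const_comb x (v i))"
proof (induction A rule: infinite_finite_induct)
  case (insert a A)
  show ?case by (simp only: sum.insert[OF insert(1,2)] const_comb_add insert(3))
next
  case empty
  show ?case using const_comb_scale[of x 0 0] by simp
next
  case (infinite A)
  then show ?case using const_comb_scale[of x 0 0] by simp
qed

lemma jacobi_cyclic:
  assumes "\<And>i. x i \<in> Der"
  shows "(\<Sum>i\<in>UNIV. vfield_bracket (x i) (cyclic_brackets x i)) = 0"
  by (simp add: sum_3 cyclic_brackets_def fun_eq_iff vfield_bracket_def Der_diff[OF assms] algebra_simps)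

lemma const_comb_axis: "const_comb x (axis i 1) = x i"
proof -
  have "vfield_scale (mfps_const (axis i 1 $ j)) (x j) = (if j = i then x i else 0)" for j
    by (simp add: axis_def vfield_scale_def fun_eq_iff)
  then show ?thesis by (simp add: const_comb_def)
qed

text \<open>
  Express the brackets of the generators through the generators by a matrix \<open>B\<close> of constants, modulo \<open>mD\<close>.
  Independence of the brackets makes \<open>B\<close> invertible. The Jacobi identity is a linear relation between
  the brackets whose coefficients are the differences \<open>B i j - B j i\<close>, so independence also makes \<open>B\<close>
  symmetric.
\<close>

lemma sl2_triple_if_independent_brackets:
  assumes x: "\<And>i. x i \<in> D" and span: "\<And>\<delta>. \<delta> \<in> D \<Longrightarrow> \<exists>v. \<delta> - const_comb x v \<in> mD"
    and indep: "\<And>c. const_comb (cyclic_brackets x) c \<in> mD \<Longrightarrow> c = 0"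
  shows "\<exists>h e f. sl2_triple h e f"
proof -
  let ?X = "const_comb x" and ?y = "cyclic_brackets x"
  note XD = const_comb_in_D[of x, OF x]
  have "\<forall>i. \<exists>v. ?y i - ?X v \<in> mD"
    using span cyclic_brackets_in_D[of x] x by blast
  from choice[OF this] obtain b where b: "\<And>i. ?y i - ?X (b i) \<in> mD" by blast
  define B where "B = (\<chi> j i. b i $ j)"
  have yB: "const_comb ?y c - ?X (B *v c) \<in> mD" for c
  proof -
    have "B *v c = (\<Sum>i\<in>UNIV. c $ i *s b i)"
      by (simp add: vec_eq_iff B_def matrix_vector_mult_def mult.commute)
    then have "const_comb ?y c - ?X (B *v c) = (\<Sum>i\<in>UNIV. const_scale (c $ i) (?y i - ?X (b i)))"
      by (simp only: const_comb_sum const_comb_scale const_comb_def[of ?y] vfield.scale_right_diff_distrib sum_subtractf)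
    also have "\<dots> \<in> mD"
      by (intro vfield.subspace_sum[OF subspace_mD] mD_scale b)
    finally show ?thesis .
  qed
  have bracket: "vfield_bracket (?X v) (?X w) - ?X (B *v cross v w) \<in> mD" for v w
    unfolding bracket_const_comb[OF x] by (rule yB)
  have det: "det B \<noteq> 0"
  proof
    assume "det B = 0"
    then have "\<not> invertible B" by (simp add: invertible_det_nz)
    then obtain c where c: "B *v c = 0" "c \<noteq> 0"
      using matrix_left_invertible_ker[of B] by (auto simp: invertible_left_inverse)
    have "?X 0 = 0" using const_comb_scale[of x 0 0] by simp
    then have "const_comb ?y c \<in> mD" using yB[of c] c(1) by simp
    with indep c(2) show False by blast
  qed
  have sym: "Finite_Cartesian_Product.transpose B = B"
  proof -
    have "const_comb ?y (\<Sum>i\<in>UNIV. cross (axis i 1) (b i)) = (\<Sum>i\<in>UNIV. vfield_bracket (x i) (?X (b i)))"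
      by (simp only: const_comb_sum bracket_const_comb[OF x, symmetric] const_comb_axis)
    also have "\<dots> = (\<Sum>i\<in>UNIV. vfield_bracket (x i) (?y i)) - (\<Sum>i\<in>UNIV. vfield_bracket (x i) (?y i - ?X (b i)))"
    proof -
      have "vfield_bracket (x i) (?X (b i)) = vfield_bracket (x i) (?y i) - vfield_bracket (x i) (?y i - ?X (b i))" for i
        using D_Der[OF x[of i]] by (simp add: fun_eq_iff vfield_bracket_def Der_diff)
      then show ?thesis by (simp only: sum_subtractf)
    qed
    also have "\<dots> = 0 - (\<Sum>i\<in>UNIV. vfield_bracket (x i) (?y i - ?X (b i)))"
      using jacobi_cyclic[of x] x D_Der by simp
    also have "\<dots> \<in> mD"
      by (intro mD_diff mD_zero vfield.subspace_sum[OF subspace_mD] bracket_mD x b)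
    finally have "(\<Sum>i\<in>UNIV. cross (axis i 1) (b i)) = 0" by (rule indep)
    then have "b 2 $ 3 = b 3 $ 2" "b 1 $ 3 = b 3 $ 1" "b 1 $ 2 = b 2 $ 1"
      by (simp_all add: vec_eq_iff forall_3 sum_3 cross_nth axis_def)
    then show ?thesis
      by (simp add: vec_eq_iff forall_3 B_def transpose_def)
  qed
  obtain h e f where hef: "B *v cross h e = 2 *s e" "B *v cross h f = (- 2) *s f" "B *v cross e f = h"
    and all: "\<And>u. \<exists>a b c. u = a *s e + b *s f + c *s h"
    using sl2_triple_exists[OF sym det] by metis
  have "sl2_triple (?X h) (?X e) (?X f)"
    unfolding sl2_triple_def
  proof (intro conjI XD ballI)
    show "vfield_bracket (?X h) (?X e) - const_scale 2 (?X e) \<in> mD"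
      using bracket[of h e] by (simp only: hef const_comb_scale)
    show "vfield_bracket (?X h) (?X f) - const_scale (- 2) (?X f) \<in> mD"
      using bracket[of h f] by (simp only: hef const_comb_scale)
    show "vfield_bracket (?X e) (?X f) - ?X h \<in> mD"
      using bracket[of e f] by (simp only: hef)
    fix \<delta> assume "\<delta> \<in> D"
    then obtain u where u: "\<delta> - ?X u \<in> mD" using span by blast
    obtain a b c where "u = a *s e + b *s f + c *s h" using all by blast
    with u show "\<exists>a b c. \<delta> - (const_scale a (?X e) + const_scale b (?X f) + const_scale c (?X h)) \<in> mD"
      by (auto simp only: const_comb_add const_comb_scale)
  qed
  then show ?thesis by blast
qed

text \<open>
  A linear relation between the three brackets of the generators eliminates one of them.
\<close>

lemma brackets_two_dimensional:
  assumes x: "\<And>i. x i \<in> D" and span: "\<And>\<delta>. \<delta> \<in> D \<Longrightarrow> \<exists>v. \<delta> - const_comb x v \<in> mD"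
    and dep: "const_comb (cyclic_brackets x) c \<in> mD" "c \<noteq> 0"
  shows "\<exists>p q. p \<in> D \<and> q \<in> D \<and>
    (\<forall>\<delta>\<in>D. \<forall>\<epsilon>\<in>D. \<exists>a b. vfield_bracket \<delta> \<epsilon> - (const_scale a p + const_scale b q) \<in> mD)"
proof -
  let ?X = "const_comb x" and ?y = "cyclic_brackets x"
  obtain k where k: "c $ k \<noteq> 0" using dep(2) by (auto simp: vec_eq_iff)
  have "\<exists>i j. UNIV = {k, i, j} \<and> k \<noteq> i \<and> k \<noteq> j \<and> i \<noteq> j"
  proof -
    have "(1 :: 3) \<noteq> 2" "(1 :: 3) \<noteq> 3" "(2 :: 3) \<noteq> 3" by simp_all
    moreover have "(UNIV :: 3 set) = {2, 1, 3}" "(UNIV :: 3 set) = {3, 1, 2}"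
      unfolding UNIV_3 by blast+
    ultimately show ?thesis
      using exhaust_3[of k] UNIV_3 by metis
  qed
  then obtain i j where ij: "UNIV = {k, i, j}" "k \<noteq> i" "k \<noteq> j" "i \<noteq> j" by blast
  have "\<exists>a b. vfield_bracket \<delta> \<epsilon> - (const_scale a (?y i) + const_scale b (?y j)) \<in> mD"
    if \<delta>: "\<delta> \<in> D" and \<epsilon>: "\<epsilon> \<in> D" for \<delta> \<epsilon>
  proof -
    obtain v where v: "\<delta> - ?X v \<in> mD" using span[OF \<delta>] by blast
    obtain w where w: "\<epsilon> - ?X w \<in> mD" using span[OF \<epsilon>] by blast
    define d where "d = cross v w"
    have XD: "?X u \<in> D" for u by (rule const_comb_in_D[OF x])
    have 1: "vfield_bracket \<delta> \<epsilon> - const_comb ?y d \<in> mD"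
      using bracket_cong_mD[OF \<delta> \<epsilon> XD XD v w] unfolding bracket_const_comb[OF x] d_def .
    define d' where "d' = d + (- (d $ k / c $ k)) *s c"
    have "const_comb ?y d' = const_comb ?y d + const_scale (- (d $ k / c $ k)) (const_comb ?y c)"
      unfolding d'_def by (simp only: const_comb_add const_comb_scale)
    then have "const_comb ?y d - const_comb ?y d' = - const_scale (- (d $ k / c $ k)) (const_comb ?y c)"
      by (simp only: diff_add_eq_diff_diff_swap diff_self) simp
    then have 2: "const_comb ?y d - const_comb ?y d' \<in> mD"
      using vfield.subspace_neg[OF subspace_mD mD_scale[OF dep(1)]] by simp
    have "d' $ k = 0" using k by (simp add: d'_def)
    then have "const_comb ?y d' = const_scale (d' $ i) (?y i) + const_scale (d' $ j) (?y j)"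
      using ij(2-) unfolding const_comb_def ij(1) by (simp add: fun_eq_iff vfield_scale_def)
    then have "vfield_bracket \<delta> \<epsilon> - (const_scale (d' $ i) (?y i) + const_scale (d' $ j) (?y j)) \<in> mD"
      using mD_trans[OF 1 2] by simp
    then show ?thesis by blast
  qed
  then show ?thesis using cyclic_brackets_in_D[of x] x by blast
qed

end

lemma mult_module: "Modules.module ((*) :: 'a::comm_ring_1 \<Rightarrow> 'a \<Rightarrow> 'a)"
  by standard (simp_all add: algebra_simps)

interpretation mult_mod: Modules.module "(*) :: 'a::comm_ring_1 \<Rightarrow> 'a \<Rightarrow> 'a"
  by (rule mult_module)

lemma max_ideal_power_subspace: "mult_mod.subspace (mfps_max_ideal_power d)"
  by (cases d) (auto simp: ideal_smult_def mult_mod.subspace_def mult_mod.span_zero intro: mult_mod.span_add mult_mod.span_scale)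

lemma max_ideal_power_SucI:
  "a \<in> mfps_max_ideal \<Longrightarrow> b \<in> mfps_max_ideal_power d \<Longrightarrow> a * b \<in> mfps_max_ideal_power (Suc d)"
  unfolding mfps_max_ideal_power.simps ideal_smult_def by (rule mult_mod.span_base) blast

lemma max_ideal_power_induct [consumes 1, case_names zero add]:
  assumes "g \<in> mfps_max_ideal_power (Suc d)" and "P 0"
    and "\<And>a b h. a \<in> mfps_max_ideal \<Longrightarrow> b \<in> mfps_max_ideal_power d \<Longrightarrow> P h \<Longrightarrow> P (a * b + h)"
  shows "P g"
  using assms(1) unfolding mfps_max_ideal_power.simps ideal_smult_def
proof (induction rule: mult_mod.span_induct_alt)
  case base
  show ?case by (rule assms(2))
next
  case (step c x y)
  then obtain a b where ab: "x = a * b" "a \<in> mfps_max_ideal" "b \<in> mfps_max_ideal_power d" by blast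
  have "c * b \<in> mfps_max_ideal_power d"
    using mult_mod.subspace_scale[OF max_ideal_power_subspace ab(3)] .
  then have "P (a * (c * b) + y)" using step ab by (intro assms(3)) auto
  then show ?case by (simp only: ab(1) mult.left_commute[of c])
qed

lemma max_ideal_power_Suc_subset: "mfps_max_ideal_power (Suc d) \<subseteq> mfps_max_ideal_power d"
proof
  fix g :: "('a, 'b) mfps" assume "g \<in> mfps_max_ideal_power (Suc d)"
  then show "g \<in> mfps_max_ideal_power d"
    by (induction rule: max_ideal_power_induct)
      (simp_all add: mult_mod.subspace_0 mult_mod.subspace_add mult_mod.subspace_scale max_ideal_power_subspace)
qed

lemma max_ideal_power_1: "mfps_max_ideal_power (Suc 0) = (mfps_max_ideal :: ('a::field, 'n::finite) mfps set)"
proof (intro equalityI subsetI)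
  fix g :: "('a, 'n) mfps"
  show "g \<in> mfps_max_ideal" if "g \<in> mfps_max_ideal_power (Suc 0)"
    using that by (induction rule: max_ideal_power_induct)
      (simp_all add: mfps_max_ideal_def mfps_nth_mult_0)
  show "g \<in> mfps_max_ideal_power (Suc 0)" if "g \<in> mfps_max_ideal"
    using max_ideal_power_SucI[OF that, of 1 0] by simp
qed

context singular_fields
begin

definition power_D :: "nat \<Rightarrow> 'n vfield set" where
  "power_D d = ideal_smult vfield_scale (mfps_max_ideal_power d) D"

lemma power_D_1: "power_D (Suc 0) = mD"
  by (simp only: power_D_def max_ideal_power_1)

lemma power_D_subspace: "vfield.subspace (power_D d)"
  unfolding power_D_def ideal_smult_def by (rule vfield.subspace_span)

lemma power_DI: "a \<in> mfps_max_ideal_power d \<Longrightarrow> \<delta> \<in> D \<Longrightarrow> vfield_scale a \<delta> \<in> power_D d"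
  unfolding power_D_def ideal_smult_def by (rule vfield.span_base) blast

lemma power_D_induct [consumes 1, case_names zero add]:
  assumes "\<delta> \<in> power_D d" and "P 0"
    and "\<And>a \<epsilon> \<eta>. a \<in> mfps_max_ideal_power d \<Longrightarrow> \<epsilon> \<in> D \<Longrightarrow> P \<eta> \<Longrightarrow> P (vfield_scale a \<epsilon> + \<eta>)"
  shows "P \<delta>"
  using assms(1) unfolding power_D_def ideal_smult_def
proof (induction rule: vfield.span_induct_alt)
  case base
  show ?case by (rule assms(2))
next
  case (step c x y)
  then obtain a s where x: "x = vfield_scale a s" "a \<in> mfps_max_ideal_power d" "s \<in> D" by blast
  have "c * a \<in> mfps_max_ideal_power d"
    using mult_mod.subspace_scale[OF max_ideal_power_subspace x(2)] .
  then have "P (vfield_scale (c * a) s + y)" using step x by (intro assms(3)) auto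
  then show ?case by (simp only: x(1) vfield.scale_scale)
qed

lemma power_D_subset: "power_D d \<subseteq> D"
proof
  fix \<delta> assume "\<delta> \<in> power_D d"
  then show "\<delta> \<in> D"
    by (induction rule: power_D_induct)
      (blast intro: vfield.subspace_0 vfield.subspace_add vfield.subspace_scale subspace_D)+
qed

lemma power_D_Suc_subset: "power_D (Suc d) \<subseteq> power_D d"
proof
  fix \<delta> assume "\<delta> \<in> power_D (Suc d)"
  then show "\<delta> \<in> power_D d"
  proof (induction rule: power_D_induct)
    case (add a \<epsilon> \<eta>)
    then show ?case
      using max_ideal_power_Suc_subset by (intro vfield.subspace_add[OF power_D_subspace] power_DI) blast+
  qed (rule vfield.subspace_0[OF power_D_subspace])
qed

lemma power_D_decreasing: "d \<le> e \<Longrightarrow> power_D e \<subseteq> power_D d"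
  by (rule lift_Suc_antimono_le[of power_D]) (rule power_D_Suc_subset)

lemma D_max_ideal_power:
  assumes "\<delta> \<in> D" "g \<in> mfps_max_ideal_power d"
  shows "\<delta> g \<in> mfps_max_ideal_power d"
  using assms(2)
proof (induction d arbitrary: g)
  case (Suc d)
  have v: "\<delta> a \<in> mfps_max_ideal" for a
    using D_vanish[OF assms(1)] unfolding order_ge_1_eq_max_ideal .
  from Suc.prems show ?case
  proof (induction rule: max_ideal_power_induct)
    case zero
    then show ?case
      using Der_0[OF D_Der[OF assms(1)]] mult_mod.subspace_0[OF max_ideal_power_subspace] by metis
  next
    case (add a b h)
    have "\<delta> (a * b + h) = \<delta> a * b + a * \<delta> b + \<delta> h"
      by (simp only: Der_add[OF D_Der[OF assms(1)]] Der_mult[OF D_Der[OF assms(1)]])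
    also have "\<dots> \<in> mfps_max_ideal_power (Suc d)"
      by (intro mult_mod.subspace_add[OF max_ideal_power_subspace] max_ideal_power_SucI add v Suc.IH)
    finally show ?case .
  qed
qed simp

lemma power_D_apply:
  assumes "\<epsilon> \<in> power_D d"
  shows "\<epsilon> g \<in> mfps_max_ideal_power (Suc d)"
  using assms
proof (induction rule: power_D_induct)
  case zero
  show ?case unfolding zero_fun_apply by (rule mult_mod.subspace_0[OF max_ideal_power_subspace])
next
  case (add a \<epsilon> \<eta>)
  have "\<epsilon> g \<in> mfps_max_ideal"
    using D_vanish[OF add(2)] unfolding order_ge_1_eq_max_ideal .
  then have "\<epsilon> g * a + \<eta> g \<in> mfps_max_ideal_power (Suc d)"
    by (intro mult_mod.subspace_add[OF max_ideal_power_subspace] max_ideal_power_SucI add)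
  then show ?case unfolding plus_fun_apply vfield_scale_def by (simp only: mult.commute)
qed

lemma bracket_zero_right: "\<delta> \<in> D \<Longrightarrow> vfield_bracket \<delta> 0 = 0"
  using bracket_const_right[OF D_Der, of \<delta> 0 0] by (simp only: mfps_const_0 vfield.scale_zero_left)

lemma bracket_power_D:
  assumes "\<delta> \<in> D" "\<epsilon> \<in> power_D d"
  shows "vfield_bracket \<delta> \<epsilon> \<in> power_D d"
  using assms(2)
proof (induction rule: power_D_induct)
  case zero
  show ?case unfolding bracket_zero_right[OF assms(1)] by (rule vfield.subspace_0[OF power_D_subspace])
next
  case (add a \<epsilon> \<eta>)
  show ?case
    unfolding bracket_add_right[OF D_Der[OF assms(1)]] bracket_scale_right[OF D_Der[OF assms(1)]]
    by (intro vfield.subspace_add[OF power_D_subspace] add(3)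
        power_DI[OF D_max_ideal_power[OF assms(1) add(1)] add(2)] power_DI[OF add(1) D_bracket[OF assms(1) add(2)]])
qed

lemma scale_power_D:
  assumes "a \<in> mfps_max_ideal" "\<delta> \<in> power_D d"
  shows "vfield_scale a \<delta> \<in> power_D (Suc d)"
  using assms(2)
proof (induction rule: power_D_induct)
  case zero
  show ?case unfolding vfield.scale_zero_right by (rule vfield.subspace_0[OF power_D_subspace])
next
  case (add b \<epsilon> \<eta>)
  show ?case
    unfolding vfield.scale_right_distrib vfield.scale_scale
    by (intro vfield.subspace_add[OF power_D_subspace] add(3) power_DI max_ideal_power_SucI add(1,2) assms(1))
qed

text \<open>
  \<open>[\<epsilon>, a \<eta>] = \<epsilon>(a) \<eta> + a [\<epsilon>, \<eta>]\<close>, and both \<open>\<epsilon>(a)\<close> and \<open>a\<close> contribute a factor from the maximal ideal.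
\<close>

lemma bracket_mD_power_D:
  assumes "\<delta> \<in> mD" "\<epsilon> \<in> power_D d"
  shows "vfield_bracket \<delta> \<epsilon> \<in> power_D (Suc d)"
proof -
  have \<epsilon>: "\<epsilon> \<in> D" "\<epsilon> \<in> Der" using assms(2) power_D_subset D_Der by blast+
  have "vfield_bracket \<epsilon> \<delta> \<in> power_D (Suc d)"
    using assms(1)
  proof (induction rule: mD_induct)
    case zero
    show ?case unfolding bracket_zero_right[OF \<epsilon>(1)] by (rule vfield.subspace_0[OF power_D_subspace])
  next
    case (add a \<eta> \<theta>)
    have a: "a \<in> mfps_max_ideal" using add(1) unfolding order_ge_1_eq_max_ideal .
    have "vfield_bracket \<epsilon> \<eta> = - vfield_bracket \<eta> \<epsilon>" by (rule bracket_swap)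
    then have "vfield_bracket \<epsilon> \<eta> \<in> power_D d"
      using vfield.subspace_neg[OF power_D_subspace bracket_power_D[OF add(2) assms(2)]] by simp
    then show ?case
      unfolding bracket_add_right[OF \<epsilon>(2)] bracket_scale_right[OF \<epsilon>(2)]
      by (intro vfield.subspace_add[OF power_D_subspace] add(4) scale_power_D[OF a]
          power_DI[OF power_D_apply[OF assms(2)] add(2)])
  qed
  then show ?thesis
    using vfield.subspace_neg[OF power_D_subspace] bracket_swap[of \<delta> \<epsilon>] by simp
qed

definition const_subspace :: "'n vfield set \<Rightarrow> bool" where
  "const_subspace A \<longleftrightarrow> 0 \<in> A \<and> (\<forall>\<delta>\<in>A. \<forall>\<epsilon>\<in>A. \<delta> + \<epsilon> \<in> A) \<and> (\<forall>c. \<forall>\<delta>\<in>A. const_scale c \<delta> \<in> A)"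

lemma subspace_const_subspace: "vfield.subspace A \<Longrightarrow> const_subspace A"
  unfolding const_subspace_def vfield.subspace_def by blast

lemma const_subspace_pullback:
  fixes \<phi> :: "complex \<Rightarrow> complex \<Rightarrow> 'n vfield"
  assumes "\<phi> 0 0 = 0" "\<And>a b a' b'. \<phi> (a + a') (b + b') = \<phi> a b + \<phi> a' b'"
    "\<And>c a b. \<phi> (c * a) (c * b) = const_scale c (\<phi> a b)"
  shows "const_subspace {\<delta> \<in> D. \<exists>a b. \<delta> - \<phi> a b \<in> mD}"
  unfolding const_subspace_def
proof (intro conjI ballI allI)
  have "0 - \<phi> 0 0 \<in> mD" using mD_zero unfolding assms(1) diff_zero .
  then show "0 \<in> {\<delta> \<in> D. \<exists>a b. \<delta> - \<phi> a b \<in> mD}"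
    using vfield.subspace_0[OF subspace_D] by blast
next
  fix \<delta> \<epsilon>
  assume "\<delta> \<in> {\<delta> \<in> D. \<exists>a b. \<delta> - \<phi> a b \<in> mD}" "\<epsilon> \<in> {\<delta> \<in> D. \<exists>a b. \<delta> - \<phi> a b \<in> mD}"
  then obtain a b a' b' where *: "\<delta> \<in> D" "\<epsilon> \<in> D" "\<delta> - \<phi> a b \<in> mD" "\<epsilon> - \<phi> a' b' \<in> mD" by blast
  have "(\<delta> + \<epsilon>) - \<phi> (a + a') (b + b') = (\<delta> - \<phi> a b) + (\<epsilon> - \<phi> a' b')"
    by (simp only: assms(2) add_diff_add)
  then have "(\<delta> + \<epsilon>) - \<phi> (a + a') (b + b') \<in> mD" using mD_add[OF *(3,4)] by (simp only:)
  then show "\<delta> + \<epsilon> \<in> {\<delta> \<in> D. \<exists>a b. \<delta> - \<phi> a b \<in> mD}"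
    using vfield.subspace_add[OF subspace_D *(1,2)] by blast
next
  fix c \<delta>
  assume "\<delta> \<in> {\<delta> \<in> D. \<exists>a b. \<delta> - \<phi> a b \<in> mD}"
  then obtain a b where *: "\<delta> \<in> D" "\<delta> - \<phi> a b \<in> mD" by blast
  have "const_scale c \<delta> - \<phi> (c * a) (c * b) \<in> mD"
    using mD_scale[OF *(2)] by (simp only: assms(3) vfield.scale_right_diff_distrib)
  then show "const_scale c \<delta> \<in> {\<delta> \<in> D. \<exists>a b. \<delta> - \<phi> a b \<in> mD}"
    using vfield.subspace_scale[OF subspace_D *(1)] by blast
qed

text \<open>
  The chain is \<open>D\<close>, then \<open>\<complex> p + \<complex> q + mD\<close>, then \<open>\<complex> [p, q] + mD\<close>, and from there on the powers of the
  maximal ideal times \<open>D\<close>, beginning with \<open>mD\<close> itself. The bracket of two elements of the plane is a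
  multiple of \<open>[p, q]\<close>, and a line is abelian.
\<close>

lemma derived_chain:
  assumes p: "p \<in> D" and q: "q \<in> D"
    and pq: "\<And>\<delta> \<epsilon>. \<delta> \<in> D \<Longrightarrow> \<epsilon> \<in> D \<Longrightarrow> \<exists>a b. vfield_bracket \<delta> \<epsilon> - (const_scale a p + const_scale b q) \<in> mD"
  shows "\<exists>T. T 0 = D \<and> (\<forall>i. const_subspace (T i) \<and> T i \<subseteq> D) \<and>
    (\<forall>i. \<forall>\<delta>\<in>T i. \<forall>\<epsilon>\<in>T i. vfield_bracket \<delta> \<epsilon> \<in> T (Suc i)) \<and> (\<forall>i\<ge>d + 3. T i \<subseteq> power_D d)"
proof -
  let ?r = "vfield_bracket p q"
  define T1 where "T1 = {\<delta> \<in> D. \<exists>a b. \<delta> - (const_scale a p + const_scale b q) \<in> mD}"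
  \<comment> \<open>A line is written as a degenerate plane, so that \<open>const_subspace_pullback\<close> covers both.\<close>
  define T2 where "T2 = {\<delta> \<in> D. \<exists>a (b :: complex). \<delta> - const_scale a ?r \<in> mD}"
  have T1D: "\<exists>a b. \<delta> - (const_scale a p + const_scale b q) \<in> mD" if "\<delta> \<in> T1" for \<delta>
    using that unfolding T1_def mem_Collect_eq by (rule conjunct2)
  have T2D: "\<exists>a (b :: complex). \<delta> - const_scale a ?r \<in> mD" if "\<delta> \<in> T2" for \<delta>
    using that unfolding T2_def mem_Collect_eq by (rule conjunct2)
  have T1I: "\<delta> \<in> T1" if "\<delta> \<in> D" "\<exists>a b. \<delta> - (const_scale a p + const_scale b q) \<in> mD" for \<delta>
    using that unfolding T1_def mem_Collect_eq by (rule conjI)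
  have T2I: "\<delta> \<in> T2" if "\<delta> \<in> D" "\<delta> - const_scale a ?r \<in> mD" for \<delta> a
    unfolding T2_def mem_Collect_eq by (rule conjI[OF that(1)], rule exI, rule exI, rule that(2))
  define T where "T i = (if i = 0 then D else if i = 1 then T1 else if i = 2 then T2 else power_D (i - 2))" for i :: nat
  note cD = vfield.subspace_scale[OF subspace_D] and aD = vfield.subspace_add[OF subspace_D]
  have rD: "?r \<in> D" by (rule D_bracket[OF p q])
  have "const_subspace T1"
    unfolding T1_def
  proof (rule const_subspace_pullback[where \<phi> = "\<lambda>a b. const_scale a p + const_scale b q"])
    show "const_scale 0 p + const_scale 0 q = 0"
      by (simp only: mfps_const_0 vfield.scale_zero_left add_0_left)
    show "const_scale (a + a') p + const_scale (b + b') q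
        = const_scale a p + const_scale b q + (const_scale a' p + const_scale b' q)" for a b a' b'
      by (simp only: mfps_const_add vfield.scale_left_distrib add_ac)
    show "const_scale (c * a) p + const_scale (c * b) q = const_scale c (const_scale a p + const_scale b q)" for c a b
      by (simp only: mfps_const_mult vfield.scale_scale vfield.scale_right_distrib)
  qed
  moreover have "const_subspace T2"
    unfolding T2_def
  proof (rule const_subspace_pullback[where \<phi> = "\<lambda>a b. const_scale a ?r"])
    show "const_scale 0 ?r = 0"
      by (simp only: mfps_const_0 vfield.scale_zero_left)
    show "const_scale (a + a') ?r = const_scale a ?r + const_scale a' ?r" for a a'
      by (simp only: mfps_const_add vfield.scale_left_distrib)
    show "const_scale (c * a) ?r = const_scale c (const_scale a ?r)" for c a
      by (simp only: mfps_const_mult vfield.scale_scale)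
  qed
  ultimately have sub: "const_subspace (T i)" for i
    by (simp add: T_def subspace_const_subspace subspace_D power_D_subspace)
  have TD: "T i \<subseteq> D" for i
    using power_D_subset by (auto simp: T_def T1_def T2_def)
  have br: "vfield_bracket \<delta> \<epsilon> \<in> T (Suc i)" if \<delta>: "\<delta> \<in> T i" and \<epsilon>: "\<epsilon> \<in> T i" for i \<delta> \<epsilon>
  proof -
    have D: "\<delta> \<in> D" "\<epsilon> \<in> D" using \<delta> \<epsilon> TD by blast+
    note Der = D_Der[OF p] D_Der[OF q] D_Der[OF rD]
    consider "i = 0" | "i = 1" | "i = 2" | j where "i = Suc (Suc (Suc j))"
      by (metis One_nat_def Suc_1 not0_implies_Suc)
    then show ?thesis
    proof cases
      case 1
      have "vfield_bracket \<delta> \<epsilon> \<in> T1"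
        by (rule T1I[OF D_bracket[OF D] pq[OF D]])
      then show ?thesis using 1 by (simp add: T_def)
    next
      case 2
      then have "\<delta> \<in> T1" "\<epsilon> \<in> T1" using \<delta> \<epsilon> by (simp_all add: T_def)
      then obtain a b a' b' where
        1: "\<delta> - (const_scale a p + const_scale b q) \<in> mD" and 2: "\<epsilon> - (const_scale a' p + const_scale b' q) \<in> mD"
        by (elim T1D[THEN exE] exE)
      have "vfield_bracket (const_scale a p + const_scale b q) (const_scale a' p + const_scale b' q)
          = const_scale (a * b' - b * a') ?r"
        by (rule ext, simp only: vfield_bracket_def vfield_scale_def plus_fun_apply Der_add[OF Der(1)]
            Der_add[OF Der(2)] Der_const_mult[OF Der(1)] Der_const_mult[OF Der(2)] mfps_const_diff
            mfps_const_mult) (simp only: algebra_simps)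
      then have "vfield_bracket \<delta> \<epsilon> - const_scale (a * b' - b * a') ?r \<in> mD"
        using bracket_cong_mD[OF D aD[OF cD[OF p] cD[OF q]] aD[OF cD[OF p] cD[OF q]] 1 2] by (simp only:)
      then have "vfield_bracket \<delta> \<epsilon> \<in> T2" by (rule T2I[OF D_bracket[OF D]])
      then show ?thesis using \<open>i = 1\<close> by (simp add: T_def)
    next
      case 3
      then have "\<delta> \<in> T2" "\<epsilon> \<in> T2" using \<delta> \<epsilon> by (simp_all add: T_def)
      then obtain a b where 1: "\<delta> - const_scale a ?r \<in> mD" and 2: "\<epsilon> - const_scale b ?r \<in> mD"
        by (elim T2D[THEN exE] exE)
      have "vfield_bracket (const_scale a ?r) (const_scale b ?r) = 0"
      proof -
        have "vfield_bracket ?r ?r = 0"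
          unfolding vfield_bracket_def[of ?r ?r] by (simp only: diff_self zero_fun_def)
        then show ?thesis
          by (simp only: bracket_const_left[OF scale_Der[OF Der(3)]] bracket_const_right[OF Der(3)]
              vfield.scale_zero_right)
      qed
      then have "vfield_bracket \<delta> \<epsilon> \<in> mD"
        using bracket_cong_mD[OF D cD[OF rD] cD[OF rD] 1 2] by (simp only: diff_zero)
      then show ?thesis using 3 by (simp add: T_def power_D_1)
    next
      case 4
      then have T: "T i = power_D (Suc j)" "T (Suc i) = power_D (Suc (Suc j))" by (simp_all add: T_def)
      have "\<delta> \<in> mD"
        using \<delta> power_D_decreasing[of "Suc 0" "Suc j"] unfolding T power_D_1[symmetric] by auto
      then show ?thesis using bracket_mD_power_D \<epsilon> unfolding T by blast
    qed
  qed
  have "T i \<subseteq> power_D d" if "i \<ge> d + 3" for i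
    using power_D_decreasing[of d "i - 2"] that by (auto simp: T_def)
  with sub TD br show ?thesis
    by (intro exI[of _ T]) (auto simp: T_def[of 0])
qed

end

section \<open>The quotient Lie algebra\<close>

context singular_fields
begin

definition lie_D :: "(complex, 'n vfield) module" where
  "lie_D = \<lparr>carrier = D, mult = vfield_bracket, one = undefined, zero = 0, add = (+),
     module.smult = const_scale\<rparr>"

definition coset :: "nat \<Rightarrow> 'n vfield \<Rightarrow> 'n vfield set" where
  "coset d \<delta> = {\<eta> + \<delta> | \<eta>. \<eta> \<in> power_D d}"

definition quotient :: "nat \<Rightarrow> (complex, 'n vfield set) module" where
  "quotient d = lie_quotient lie_D (power_D d)"

lemma a_r_coset_lie_D: "power_D d +>\<^bsub>lie_D\<^esub> \<delta> = coset d \<delta>"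
  by (auto simp: a_r_coset_def' lie_D_def coset_def simp del: plus_fun_def)

lemma coset_eq_iff: "coset d \<delta> = coset d \<epsilon> \<longleftrightarrow> \<delta> - \<epsilon> \<in> power_D d"
proof
  assume "coset d \<delta> = coset d \<epsilon>"
  moreover have "0 + \<delta> \<in> coset d \<delta>"
    unfolding coset_def using vfield.subspace_0[OF power_D_subspace] by blast
  ultimately have "\<delta> \<in> coset d \<epsilon>" by (simp only: add_0_left)
  then obtain \<eta> where "\<delta> = \<eta> + \<epsilon>" "\<eta> \<in> power_D d" unfolding coset_def by blast
  then show "\<delta> - \<epsilon> \<in> power_D d" by (simp only: add_diff_cancel_right')
next
  have sub: "coset d \<delta> \<subseteq> coset d \<epsilon>" if "\<delta> - \<epsilon> \<in> power_D d" for \<delta> \<epsilon>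
  proof
    fix \<theta> assume "\<theta> \<in> coset d \<delta>"
    then obtain \<eta> where \<eta>: "\<theta> = \<eta> + \<delta>" "\<eta> \<in> power_D d" unfolding coset_def by blast
    have "\<theta> = (\<eta> + (\<delta> - \<epsilon>)) + \<epsilon>" by (simp only: \<eta>(1) add.assoc diff_add_cancel)
    then show "\<theta> \<in> coset d \<epsilon>"
      unfolding coset_def using vfield.subspace_add[OF power_D_subspace \<eta>(2) that] by blast
  qed
  assume 1: "\<delta> - \<epsilon> \<in> power_D d"
  have "\<epsilon> - \<delta> \<in> power_D d"
    using vfield.subspace_neg[OF power_D_subspace 1] by (simp only: minus_diff_eq)
  with 1 show "coset d \<delta> = coset d \<epsilon>" using sub by blast
qed

lemma mem_coset: "\<theta> \<in> coset d \<delta> \<longleftrightarrow> \<theta> - \<delta> \<in> power_D d"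
proof
  assume "\<theta> \<in> coset d \<delta>"
  then show "\<theta> - \<delta> \<in> power_D d"
    unfolding coset_def by (elim CollectE exE conjE) (simp only: add_diff_cancel_right')
next
  assume 1: "\<theta> - \<delta> \<in> power_D d"
  have "\<theta> = (\<theta> - \<delta>) + \<delta>" by (simp only: diff_add_cancel)
  with 1 show "\<theta> \<in> coset d \<delta>" unfolding coset_def by blast
qed

lemma coset_self: "\<delta> \<in> coset d \<delta>"
  using vfield.subspace_0[OF power_D_subspace] by (simp only: mem_coset diff_self)

lemma coset_subset_D: "\<delta> \<in> D \<Longrightarrow> coset d \<delta> \<subseteq> D"
  using power_D_subset vfield.subspace_add[OF subspace_D] unfolding coset_def by blast

lemma carrier_quotient: "carrier (quotient d) = coset d ` D"
  by (auto simp: quotient_def lie_quotient_def A_RCOSETS_def' a_r_coset_lie_D) (auto simp: lie_D_def)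

lemma zero_quotient: "\<zero>\<^bsub>quotient d\<^esub> = coset d 0"
proof -
  have "\<theta> \<in> coset d 0 \<longleftrightarrow> \<theta> \<in> power_D d" for \<theta>
    by (simp only: mem_coset diff_zero)
  then show ?thesis by (auto simp: quotient_def lie_quotient_def)
qed

lemma add_quotient: "coset d \<delta> \<oplus>\<^bsub>quotient d\<^esub> coset d \<epsilon> = coset d (\<delta> + \<epsilon>)"
proof -
  have "coset d \<delta> \<oplus>\<^bsub>quotient d\<^esub> coset d \<epsilon> = (\<Union>\<alpha>\<in>coset d \<delta>. \<Union>\<beta>\<in>coset d \<epsilon>. {\<alpha> + \<beta>})"
    by (simp only: quotient_def lie_quotient_def set_add_def' ring.simps monoid.simps partial_object.simps module.simps)
      (simp only: lie_D_def ring.simps)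
  also have "\<dots> = coset d (\<delta> + \<epsilon>)"
  proof (intro equalityI subsetI)
    fix \<theta> assume "\<theta> \<in> (\<Union>\<alpha>\<in>coset d \<delta>. \<Union>\<beta>\<in>coset d \<epsilon>. {\<alpha> + \<beta>})"
    then obtain \<alpha> \<beta> where ab: "\<theta> = \<alpha> + \<beta>" "\<alpha> - \<delta> \<in> power_D d" "\<beta> - \<epsilon> \<in> power_D d"
      by (auto simp only: mem_coset UN_iff singleton_iff)
    have "\<theta> - (\<delta> + \<epsilon>) = (\<alpha> - \<delta>) + (\<beta> - \<epsilon>)" by (simp only: ab(1) add_diff_add)
    then show "\<theta> \<in> coset d (\<delta> + \<epsilon>)"
      using vfield.subspace_add[OF power_D_subspace ab(2,3)] by (simp only: mem_coset)
  next
    fix \<theta> assume 1: "\<theta> \<in> coset d (\<delta> + \<epsilon>)"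
    have "\<theta> = (\<theta> - \<epsilon>) + \<epsilon>" by (simp only: diff_add_cancel)
    moreover have "\<theta> - \<epsilon> - \<delta> = \<theta> - (\<delta> + \<epsilon>)" by (simp only: diff_diff_eq add.commute)
    then have "\<theta> - \<epsilon> \<in> coset d \<delta>" using 1 by (simp only: mem_coset)
    ultimately show "\<theta> \<in> (\<Union>\<alpha>\<in>coset d \<delta>. \<Union>\<beta>\<in>coset d \<epsilon>. {\<alpha> + \<beta>})"
      using coset_self[of \<epsilon> d] by blast
  qed
  finally show ?thesis .
qed

lemma bracket_cong_power_D:
  assumes "\<delta> \<in> D" "\<epsilon>' \<in> D" "\<delta> - \<delta>' \<in> power_D d" "\<epsilon> - \<epsilon>' \<in> power_D d"
  shows "vfield_bracket \<delta> \<epsilon> - vfield_bracket \<delta>' \<epsilon>' \<in> power_D d"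
proof -
  have "vfield_bracket \<delta> \<epsilon> - vfield_bracket \<delta>' \<epsilon>' = vfield_bracket \<delta> (\<epsilon> - \<epsilon>') - vfield_bracket \<epsilon>' (\<delta> - \<delta>')"
    using D_Der[OF assms(1)] D_Der[OF assms(2)]
    by (simp add: fun_eq_iff vfield_bracket_def Der_diff)
  then show ?thesis
    using vfield.subspace_diff[OF power_D_subspace bracket_power_D[OF assms(1,4)] bracket_power_D[OF assms(2,3)]]
    by (simp only:)
qed

lemma mult_quotient:
  assumes "\<delta> \<in> D" "\<epsilon> \<in> D"
  shows "coset d \<delta> \<otimes>\<^bsub>quotient d\<^esub> coset d \<epsilon> = coset d (vfield_bracket \<delta> \<epsilon>)"
proof -
  have "coset d \<delta> \<otimes>\<^bsub>quotient d\<^esub> coset d \<epsilon>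
      = (\<Union>\<alpha>\<in>coset d \<delta>. \<Union>\<beta>\<in>coset d \<epsilon>. coset d (vfield_bracket \<alpha> \<beta>))"
    by (simp only: quotient_def lie_quotient_def rcoset_mult_def monoid.simps a_r_coset_lie_D)
      (simp only: lie_D_def monoid.simps)
  also have "\<dots> = (\<Union>\<alpha>\<in>coset d \<delta>. \<Union>\<beta>\<in>coset d \<epsilon>. coset d (vfield_bracket \<delta> \<epsilon>))"
  proof (intro SUP_cong refl)
    fix \<alpha> \<beta> assume ab: "\<alpha> \<in> coset d \<delta>" "\<beta> \<in> coset d \<epsilon>"
    then have "\<alpha> \<in> D" using coset_subset_D[OF assms(1)] by blast
    with ab show "coset d (vfield_bracket \<alpha> \<beta>) = coset d (vfield_bracket \<delta> \<epsilon>)"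
      unfolding coset_eq_iff mem_coset by (intro bracket_cong_power_D assms(2))
  qed
  also have "\<dots> = coset d (vfield_bracket \<delta> \<epsilon>)"
    using coset_self by (auto simp only: UN_constant split: if_splits)
  finally show ?thesis .
qed

lemma smult_quotient: "c \<odot>\<^bsub>quotient d\<^esub> coset d \<delta> = coset d (const_scale c \<delta>)"
proof -
  have "c \<odot>\<^bsub>quotient d\<^esub> coset d \<delta> = (\<Union>\<alpha>\<in>coset d \<delta>. coset d (const_scale c \<alpha>))"
    by (simp only: quotient_def lie_quotient_def module.simps a_r_coset_lie_D) (simp only: lie_D_def module.simps)
  also have "\<dots> = (\<Union>\<alpha>\<in>coset d \<delta>. coset d (const_scale c \<delta>))"
  proof (intro SUP_cong refl)
    fix \<alpha> assume "\<alpha> \<in> coset d \<delta>"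
    then have "const_scale c (\<alpha> - \<delta>) \<in> power_D d"
      unfolding mem_coset by (rule vfield.subspace_scale[OF power_D_subspace])
    then show "coset d (const_scale c \<alpha>) = coset d (const_scale c \<delta>)"
      unfolding coset_eq_iff vfield.scale_right_diff_distrib .
  qed
  also have "\<dots> = coset d (const_scale c \<delta>)"
    using coset_self by (auto simp only: UN_constant split: if_splits)
  finally show ?thesis .
qed

lemmas quotient_ops = add_quotient mult_quotient smult_quotient zero_quotient

lemma complex_lie_algebra_quotient: "complex_lie_algebra (quotient d)"
proof -
  note aD = vfield.subspace_add[OF subspace_D] and cD = vfield.subspace_scale[OF subspace_D]
    and zD = vfield.subspace_0[OF subspace_D]
  have C: "\<exists>\<delta>\<in>D. A = coset d \<delta>" if "A \<in> carrier (quotient d)" for A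
    using that unfolding carrier_quotient by blast
  have in_C: "coset d \<delta> \<in> carrier (quotient d)" if "\<delta> \<in> D" for \<delta>
    using that unfolding carrier_quotient by blast
  have ring: "carrier (ring_of_type_algebra :: complex ring) = UNIV"
    "a \<oplus>\<^bsub>ring_of_type_algebra\<^esub> b = a + b" "a \<otimes>\<^bsub>ring_of_type_algebra\<^esub> b = a * b"
    "\<one>\<^bsub>ring_of_type_algebra\<^esub> = (1 :: complex)" for a b :: complex
    by (simp_all add: ring_of_type_algebra_def)
  have "abelian_group (quotient d)"
  proof (rule abelian_groupI)
    show "\<zero>\<^bsub>quotient d\<^esub> \<in> carrier (quotient d)" unfolding zero_quotient by (rule in_C[OF zD])
  next
    fix A A' assume "A \<in> carrier (quotient d)" "A' \<in> carrier (quotient d)"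
    then obtain \<delta> \<epsilon> where *: "\<delta> \<in> D" "\<epsilon> \<in> D" "A = coset d \<delta>" "A' = coset d \<epsilon>" using C by metis
    show "A \<oplus>\<^bsub>quotient d\<^esub> A' \<in> carrier (quotient d)"
      unfolding * quotient_ops by (rule in_C[OF aD[OF *(1,2)]])
    show "A \<oplus>\<^bsub>quotient d\<^esub> A' = A' \<oplus>\<^bsub>quotient d\<^esub> A"
      unfolding * quotient_ops by (simp only: add.commute)
  next
    fix A A' A'' assume "A \<in> carrier (quotient d)" "A' \<in> carrier (quotient d)" "A'' \<in> carrier (quotient d)"
    then obtain \<delta> \<epsilon> \<eta> where *: "A = coset d \<delta>" "A' = coset d \<epsilon>" "A'' = coset d \<eta>" using C by metis
    show "A \<oplus>\<^bsub>quotient d\<^esub> A' \<oplus>\<^bsub>quotient d\<^esub> A'' = A \<oplus>\<^bsub>quotient d\<^esub> (A' \<oplus>\<^bsub>quotient d\<^esub> A'')"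
      unfolding * quotient_ops by (simp only: add.assoc)
  next
    fix A assume "A \<in> carrier (quotient d)"
    then obtain \<delta> where *: "\<delta> \<in> D" "A = coset d \<delta>" using C by metis
    show "\<zero>\<^bsub>quotient d\<^esub> \<oplus>\<^bsub>quotient d\<^esub> A = A"
      unfolding * quotient_ops by (simp only: add_0_left)
    show "\<exists>B\<in>carrier (quotient d). B \<oplus>\<^bsub>quotient d\<^esub> A = \<zero>\<^bsub>quotient d\<^esub>"
    proof
      show "coset d (- \<delta>) \<oplus>\<^bsub>quotient d\<^esub> A = \<zero>\<^bsub>quotient d\<^esub>"
        unfolding * quotient_ops by (simp only: left_minus)
      show "coset d (- \<delta>) \<in> carrier (quotient d)"
        by (rule in_C[OF vfield.subspace_neg[OF subspace_D *(1)]])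
    qed
  qed
  then have module: "Module.module (ring_of_type_algebra :: complex ring) (quotient d)"
  proof (rule module.intro[OF cring_from_type_algebra _ module_axioms.intro], unfold ring)
    fix a b :: complex and A A' assume A: "A \<in> carrier (quotient d)"
    then obtain \<delta> where *: "\<delta> \<in> D" "A = coset d \<delta>" using C by metis
    show "a \<odot>\<^bsub>quotient d\<^esub> A \<in> carrier (quotient d)"
      unfolding * quotient_ops by (rule in_C[OF cD[OF *(1)]])
    show "(a + b) \<odot>\<^bsub>quotient d\<^esub> A = a \<odot>\<^bsub>quotient d\<^esub> A \<oplus>\<^bsub>quotient d\<^esub> b \<odot>\<^bsub>quotient d\<^esub> A"
      unfolding * quotient_ops by (simp only: mfps_const_add vfield.scale_left_distrib)
    show "(a * b) \<odot>\<^bsub>quotient d\<^esub> A = a \<odot>\<^bsub>quotient d\<^esub> (b \<odot>\<^bsub>quotient d\<^esub> A)"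
      unfolding * quotient_ops by (simp only: mfps_const_mult vfield.scale_scale)
    show "1 \<odot>\<^bsub>quotient d\<^esub> A = A"
      unfolding * quotient_ops by (simp only: mfps_const_1 vfield.scale_one)
    assume "A' \<in> carrier (quotient d)"
    then obtain \<epsilon> where **: "A' = coset d \<epsilon>" using C by metis
    show "a \<odot>\<^bsub>quotient d\<^esub> (A \<oplus>\<^bsub>quotient d\<^esub> A') = a \<odot>\<^bsub>quotient d\<^esub> A \<oplus>\<^bsub>quotient d\<^esub> a \<odot>\<^bsub>quotient d\<^esub> A'"
      unfolding * ** quotient_ops by (simp only: vfield.scale_right_distrib)
  qed
  show ?thesis
  proof (rule complex_lie_algebra.intro[OF module complex_lie_algebra_axioms.intro])
    fix A A' assume "A \<in> carrier (quotient d)" "A' \<in> carrier (quotient d)"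
    then obtain \<delta> \<epsilon> where *: "\<delta> \<in> D" "\<epsilon> \<in> D" "A = coset d \<delta>" "A' = coset d \<epsilon>" using C by metis
    note Der = D_Der[OF *(1)] D_Der[OF *(2)]
    show "A \<otimes>\<^bsub>quotient d\<^esub> A' \<in> carrier (quotient d)"
      unfolding *(3,4) mult_quotient[OF *(1,2)] by (rule in_C[OF D_bracket[OF *(1,2)]])
    show "c \<odot>\<^bsub>quotient d\<^esub> A \<otimes>\<^bsub>quotient d\<^esub> A' = c \<odot>\<^bsub>quotient d\<^esub> (A \<otimes>\<^bsub>quotient d\<^esub> A')" for c
      unfolding *(3,4) smult_quotient mult_quotient[OF *(1,2)] mult_quotient[OF cD[OF *(1)] *(2)]
      by (simp only: bracket_const_left[OF Der(2)])
    show "A \<otimes>\<^bsub>quotient d\<^esub> (c \<odot>\<^bsub>quotient d\<^esub> A') = c \<odot>\<^bsub>quotient d\<^esub> (A \<otimes>\<^bsub>quotient d\<^esub> A')" for c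
      unfolding *(3,4) smult_quotient mult_quotient[OF *(1,2)] mult_quotient[OF *(1) cD[OF *(2)]]
      by (simp only: bracket_const_right[OF Der(1)])
    show "A \<otimes>\<^bsub>quotient d\<^esub> A = \<zero>\<^bsub>quotient d\<^esub>"
      unfolding *(3) zero_quotient mult_quotient[OF *(1,1)] vfield_bracket_def
      by (simp only: diff_self zero_fun_def)
  next
    fix A A' A'' assume "A \<in> carrier (quotient d)" "A' \<in> carrier (quotient d)" "A'' \<in> carrier (quotient d)"
    then obtain \<delta> \<epsilon> \<eta> where *: "\<delta> \<in> D" "\<epsilon> \<in> D" "\<eta> \<in> D"
      and **: "A = coset d \<delta>" "A' = coset d \<epsilon>" "A'' = coset d \<eta>" using C by metis
    note Der = D_Der[OF *(1)] D_Der[OF *(2)] D_Der[OF *(3)]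
    note m = mult_quotient[OF *(1,2)] mult_quotient[OF *(2,3)] mult_quotient[OF *(3,1)] mult_quotient[OF *(1,3)]
      mult_quotient[OF aD[OF *(1,2)] *(3)] mult_quotient[OF *(1) aD[OF *(2,3)]]
      mult_quotient[OF *(1) D_bracket[OF *(2,3)]] mult_quotient[OF *(2) D_bracket[OF *(3,1)]]
      mult_quotient[OF *(3) D_bracket[OF *(1,2)]]
    show "(A \<oplus>\<^bsub>quotient d\<^esub> A') \<otimes>\<^bsub>quotient d\<^esub> A'' = A \<otimes>\<^bsub>quotient d\<^esub> A'' \<oplus>\<^bsub>quotient d\<^esub> A' \<otimes>\<^bsub>quotient d\<^esub> A''"
      unfolding ** add_quotient m by (simp only: bracket_add_left[OF Der(3)])
    show "A \<otimes>\<^bsub>quotient d\<^esub> (A' \<oplus>\<^bsub>quotient d\<^esub> A'') = A \<otimes>\<^bsub>quotient d\<^esub> A' \<oplus>\<^bsub>quotient d\<^esub> A \<otimes>\<^bsub>quotient d\<^esub> A''"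
      unfolding ** add_quotient m by (simp only: bracket_add_right[OF Der(1)])
    have "vfield_bracket \<delta> (vfield_bracket \<epsilon> \<eta>) + vfield_bracket \<epsilon> (vfield_bracket \<eta> \<delta>)
        + vfield_bracket \<eta> (vfield_bracket \<delta> \<epsilon>) = 0"
      by (simp add: fun_eq_iff vfield_bracket_def Der_diff[OF Der(1)] Der_diff[OF Der(2)] Der_diff[OF Der(3)])
    then show "A \<otimes>\<^bsub>quotient d\<^esub> (A' \<otimes>\<^bsub>quotient d\<^esub> A'') \<oplus>\<^bsub>quotient d\<^esub> A' \<otimes>\<^bsub>quotient d\<^esub> (A'' \<otimes>\<^bsub>quotient d\<^esub> A)
        \<oplus>\<^bsub>quotient d\<^esub> A'' \<otimes>\<^bsub>quotient d\<^esub> (A \<otimes>\<^bsub>quotient d\<^esub> A') = \<zero>\<^bsub>quotient d\<^esub>"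
      unfolding ** m add_quotient zero_quotient by (simp only:)
  qed
qed

lemma submodule_coset_image:
  assumes "const_subspace A" "A \<subseteq> D"
  shows "submodule (coset d ` A) (ring_of_type_algebra :: complex ring) (quotient d)"
proof -
  have Q: "Module.module (ring_of_type_algebra :: complex ring) (quotient d)"
    using complex_lie_algebra_quotient by (rule complex_lie_algebra.axioms(1))
  have A: "0 \<in> A" "\<And>\<delta> \<epsilon>. \<delta> \<in> A \<Longrightarrow> \<epsilon> \<in> A \<Longrightarrow> \<delta> + \<epsilon> \<in> A" "\<And>c \<delta>. \<delta> \<in> A \<Longrightarrow> const_scale c \<delta> \<in> A"
    using assms(1) unfolding const_subspace_def by blast+
  show ?thesis
  proof (rule Module.module.submoduleI[OF Q])
    show "coset d ` A \<subseteq> carrier (quotient d)" unfolding carrier_quotient using assms(2) by blast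
    show "\<zero>\<^bsub>quotient d\<^esub> \<in> coset d ` A" unfolding zero_quotient using A(1) by blast
  next
    fix U assume "U \<in> coset d ` A"
    then obtain \<delta> where \<delta>: "\<delta> \<in> A" "U = coset d \<delta>" by blast
    have m: "const_scale (- 1) \<delta> \<in> A" by (rule A(3)[OF \<delta>(1)])
    have "const_scale (- 1) \<delta> + \<delta> = 0"
      by (simp add: fun_eq_iff vfield_scale_def mfps_const_uminus)
    then have "coset d (const_scale (- 1) \<delta>) \<oplus>\<^bsub>quotient d\<^esub> U = \<zero>\<^bsub>quotient d\<^esub>"
      by (simp only: \<delta>(2) add_quotient zero_quotient)
    then have "\<ominus>\<^bsub>quotient d\<^esub> U = coset d (const_scale (- 1) \<delta>)"
      using \<delta> m assms(2) by (intro abelian_group.minus_equality[OF module.axioms(2)[OF Q]]) (auto simp: carrier_quotient)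
    then show "\<ominus>\<^bsub>quotient d\<^esub> U \<in> coset d ` A" using m by blast
  next
    fix U V assume "U \<in> coset d ` A" "V \<in> coset d ` A"
    then obtain \<delta> \<epsilon> where "\<delta> \<in> A" "U = coset d \<delta>" "\<epsilon> \<in> A" "V = coset d \<epsilon>" by blast
    then show "U \<oplus>\<^bsub>quotient d\<^esub> V \<in> coset d ` A"
      using A(2) by (simp only: add_quotient) blast
  next
    fix c :: complex and U assume "U \<in> coset d ` A"
    then obtain \<delta> where "\<delta> \<in> A" "U = coset d \<delta>" by blast
    then show "c \<odot>\<^bsub>quotient d\<^esub> U \<in> coset d ` A"
      using A(3) by (simp only: smult_quotient) blast
  qed
qed

text \<open>
  The images of the \<open>T i\<close> are submodules of the quotient, hence they contain the derived series.
\<close>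

lemma solvable_quotient:
  assumes T0: "T 0 = D" and T: "\<And>i. const_subspace (T i)" "\<And>i. T i \<subseteq> D"
    and br: "\<And>i \<delta> \<epsilon>. \<delta> \<in> T i \<Longrightarrow> \<epsilon> \<in> T i \<Longrightarrow> vfield_bracket \<delta> \<epsilon> \<in> T (Suc i)"
    and end_T: "\<And>i. i \<ge> k \<Longrightarrow> T i \<subseteq> power_D d"
  shows "solvable_lie_algebra (quotient d)"
proof -
  have zero: "\<zero>\<^bsub>quotient d\<^esub> \<in> derived_series (quotient d) i" for i
  proof (cases i)
    case (Suc j)
    have "\<zero>\<^bsub>quotient d\<^esub> \<in> H" if "submodule H (ring_of_type_algebra :: complex ring) (quotient d)" for H
      using submodule.axioms(1)[OF that] subgroup.one_closed by fastforce
    then show ?thesis unfolding Suc derived_series.simps lie_bracket_space_def by blast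
  next
    case 0
    have "coset d 0 \<in> coset d ` D" using vfield.subspace_0[OF subspace_D] by blast
    then show ?thesis by (simp only: 0 derived_series.simps carrier_quotient zero_quotient)
  qed
  have sub: "derived_series (quotient d) i \<subseteq> coset d ` T i" for i
  proof (induction i)
    case 0
    then show ?case by (simp add: carrier_quotient T0)
  next
    case (Suc i)
    have "U \<otimes>\<^bsub>quotient d\<^esub> V \<in> coset d ` T (Suc i)"
      if "U \<in> derived_series (quotient d) i" "V \<in> derived_series (quotient d) i" for U V
    proof -
      from that Suc.IH obtain \<delta> \<epsilon> where *: "\<delta> \<in> T i" "\<epsilon> \<in> T i" "U = coset d \<delta>" "V = coset d \<epsilon>" by blast
      then have D: "\<delta> \<in> D" "\<epsilon> \<in> D" using T(2) by blast+
      show ?thesis unfolding *(3,4) mult_quotient[OF D] using br[OF *(1,2)] by blast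
    qed
    then show ?case
      using submodule_coset_image[OF T(1,2)[of "Suc i"]]
      unfolding derived_series.simps lie_bracket_space_def by blast
  qed
  have "derived_series (quotient d) i = {\<zero>\<^bsub>quotient d\<^esub>}" if "i \<ge> k" for i
  proof -
    have "coset d \<delta> = coset d 0" if "\<delta> \<in> power_D d" for \<delta>
      using that unfolding coset_eq_iff diff_zero .
    then have "coset d ` T i \<subseteq> {\<zero>\<^bsub>quotient d\<^esub>}"
      using end_T[OF that] unfolding zero_quotient by blast
    then show ?thesis using sub[of i] zero[of i] by blast
  qed
  then show ?thesis
    by (intro solvable_lie_algebra.intro complex_lie_algebra_quotient solvable_lie_algebra_axioms.intro) blast
qed

end

theorem proposition6p2:
  fixes f :: "(complex, 'n::finite) mfps" and d :: nat
  assumes "CARD('n) \<le> 3"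
    and "is_free f"
    and "\<not> is_product f"
    and "d \<ge> 1"
  shows "solvable_lie_algebra (Der_log_quotient f d)"
proof -
  interpret singular_fields "Der_log f" by (rule not_product_singular_fields[OF assms(3)])
  from assms(2) obtain \<delta> :: "'n \<Rightarrow> 'n vfield" and u where
    f: "f \<noteq> 0" "mfps_reduced f" and \<delta>: "\<And>i. \<delta> i \<in> Der_log f"
    and u: "u dvd 1" "det (\<chi> i j. \<delta> i (mfps_X j)) = u * f"
    unfolding is_free_def by blast
  \<comment> \<open>The generators are indexed by the type 3, with repetitions if there are fewer than three of them.\<close>
  obtain t :: "'n \<Rightarrow> 3" where t: "inj t"
    using assms(1) inj_on_iff_card_le[of "UNIV :: 'n set" "UNIV :: 3 set"] by auto
  define x where "x k = \<delta> (inv_into UNIV t k)" for k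
  have x: "x k \<in> Der_log f" for k by (simp add: x_def \<delta>)
  have xt: "x (t i) = \<delta> i" for i using t by (simp add: x_def)
  have span: "\<exists>v. \<epsilon> - const_comb x v \<in> mD" if \<epsilon>: "\<epsilon> \<in> Der_log f" for \<epsilon>
  proof -
    obtain a where a: "\<epsilon> = (\<Sum>i\<in>UNIV. vfield_scale (a i) (\<delta> i))"
      using Der_log_generators[OF f \<delta> u \<epsilon>] by blast
    define v where "v = (\<Sum>i\<in>UNIV. mfps_nth (a i) 0 *s axis (t i) (1 :: complex))"
    have "const_comb x v = (\<Sum>i\<in>UNIV. const_scale (mfps_nth (a i) 0) (\<delta> i))"
      by (simp only: v_def const_comb_sum const_comb_scale const_comb_axis xt)
    then have "\<epsilon> - const_comb x v = (\<Sum>i\<in>UNIV. vfield_scale (a i - mfps_const (mfps_nth (a i) 0)) (\<delta> i))"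
      by (simp only: a vfield.scale_left_diff_distrib sum_subtractf)
    also have "\<dots> \<in> mD"
      by (intro vfield.subspace_sum[OF subspace_mD] scale_in_mD \<delta>)
        (simp add: order_ge_1_iff mfps_nth_const del: One_nat_def)
    finally show ?thesis by blast
  qed
  have "\<not> (\<forall>c. const_comb (cyclic_brackets x) c \<in> mD \<longrightarrow> c = 0)"
    using sl2_triple_if_independent_brackets[of x, OF x span] free_no_sl2_triple[OF assms(2,3)] by blast
  then obtain c where "const_comb (cyclic_brackets x) c \<in> mD" "c \<noteq> 0" by blast
  from brackets_two_dimensional[of x, OF x span this] obtain p q where pq: "p \<in> Der_log f" "q \<in> Der_log f"
    "\<And>\<delta> \<epsilon>. \<delta> \<in> Der_log f \<Longrightarrow> \<epsilon> \<in> Der_log f \<Longrightarrow>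
      \<exists>a b. vfield_bracket \<delta> \<epsilon> - (const_scale a p + const_scale b q) \<in> mD"
    by blast
  from derived_chain[OF pq, of d] obtain T where
    "T 0 = Der_log f" "\<forall>i. const_subspace (T i) \<and> T i \<subseteq> Der_log f"
    "\<forall>i. \<forall>\<delta>\<in>T i. \<forall>\<epsilon>\<in>T i. vfield_bracket \<delta> \<epsilon> \<in> T (Suc i)" "\<forall>i\<ge>d + 3. T i \<subseteq> power_D d"
    by blast
  then have "solvable_lie_algebra (quotient d)"
    by (intro solvable_quotient[of T "d + 3"]) blast+
  moreover have "quotient d = Der_log_quotient f d"
    by (simp only: quotient_def Der_log_quotient_def lie_D_def Der_log_lie_def power_D_def)
  ultimately show ?thesis by simp
qed

end
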